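(* Let $\mathsf{A}(t',t)=\widetilde{\mathsf{A}}(t')\Theta(t'-t)$ be an $N\times N$ complex time-dependent matrix with entries in $\mathrm{Sm}_\Theta(I)$ and let $\boldsymbol{v},\boldsymbol{w}\in\mathbb{C}^N$ be time-independent vectors with $\boldsymbol{w}^H\boldsymbol{v}=1$. Let $\mathsf{U}$ be the time-ordered exponential of $\mathsf{A}$. Assume that the $\ast$-Lanczos algorithm run on $(\mathsf{A},\boldsymbol{w},\boldsymbol{v})$ does not break down until the $n$th step (i.e. the no-breakdown assumption holds for $\beta_1,\dots,\beta_{n-1}$), when a lucky breakdown arises, i.e. $\widehat{\boldsymbol{v}}_n\equiv0$ (or $\boldsymbol{w}_n\equiv0$). Then $$\boldsymbol{w}^H(\mathsf{A}^{\ast j})\,\boldsymbol{v}=\boldsymbol{e}_1^H(\mathsf{T}_n^{\ast j})\,\boldsymbol{e}_1\quad\text{for all } j\ge0,$$ $$\boldsymbol{w}^H\mathsf{U}(t',t)\boldsymbol{v}=\int_t^{t'}\mathsf{R}_\ast(\mathsf{T}_n)_{1,1}(\tau,t)\,d\tau\quad\text{for } t'\ge t,\ t',t\in I.$$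
   Context: Let $I\subseteq\mathbb{R}$ be an interval and $t',t$ real variables in $I$. Distributions and the $\ast$-product. $\mathrm{D}(I)$ is the class of distributions of the form $d(t',t)=\widetilde d(t',t)\Theta(t'-t)+\sum_{i=0}^{M}\widetilde d_i(t',t)\delta^{(i)}(t'-t)$ with $M$ finite and $\widetilde d,\widetilde d_i$ smooth functions on $I^2$; $\Theta$ is the Heaviside function with $\Theta(0)=1$ and $\delta^{(i)}$ is the $i$-th derivative of the Dirac delta. $\mathrm{Sm}_\Theta(I)\subset \mathrm{D}(I)$ is the subclass of those of the form $\widetilde f(t',t)\Theta(t'-t)$. The (non-commutative, associative) $\ast$-product on $\mathrm{D}(I)$ is $(f_2\ast f_1)(t',t)=\int_{-\infty}^{\infty}f_2(t',\tau)f_1(\tau,t)\,d\tau$ (in the sense of distributions); on $\mathrm{Sm}_\Theta(I)$ it equals $\Theta(t'-t)\int_t^{t'}\widetilde f_2(t',\tau)\widetilde f_1(\tau,t)\,d\tau$. For $f(t',t)=\widetilde f(t',t)\Theta(t'-t)$ one has $f\ast\delta'=-(\partial_t\widetilde f)\Theta(t'-t)+\widetilde f(t',t')\delta(t'-t)$ and $\delta'\ast f=(\partial_{t'}\widetilde f)\Theta(t'-t)+\widetilde f(t,t)\delta(t'-t)$, and $\delta^{(i)}\ast\delta^{(j)}=\delta^{(i+j)}$. The identity is $1_\ast=\delta(t'-t)$. The product extends to matrices and vectors with entries in $\mathrm{D}(I)$ by the usual row-by-column rule, with identity $\mathrm{Id}_\ast=\mathrm{Id}\,1_\ast$; $\mathsf{M}^{\ast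 j}$ is the $j$-th $\ast$-power, with $\mathsf{M}^{\ast 0}=\mathrm{Id}_\ast$. When no product symbol is written between a time-independent vector and a matrix, it is the usual matrix-vector product. The $\ast$-inverse $f^{\ast-1}$ satisfies $f^{\ast-1}\ast f=f\ast f^{\ast-1}=1_\ast$ (with $\mathrm{Id}_\ast$ for matrices). The $\ast$-resolvent of a matrix $\mathsf{M}$ is $\mathsf{R}_\ast(\mathsf{M})=(\mathrm{Id}_\ast-\mathsf{M})^{\ast-1}=\mathrm{Id}_\ast+\sum_{k\ge1}\mathsf{M}^{\ast k}$. The expression $\int_t^{t'}\mathsf{R}_\ast(\mathsf{T}_n)_{1,1}(\tau,t)\,d\tau$ means $(\Theta\ast\mathsf{R}_\ast(\mathsf{T}_n)_{1,1})(t',t)$. Time-ordered exponential. $\mathsf{U}(t',t)$ is the unique solution of $\frac{d}{dt'}\mathsf{U}(t',t)=\widetilde{\mathsf{A}}(t')\mathsf{U}(t',t)$, $\mathsf{U}(t,t)=\mathrm{Id}$, $t'\ge t$. The $\ast$-Lanczos algorithm. Input: $\mathsf{A},\boldsymbol{w},\boldsymbol{v}$. Set $\boldsymbol{v}_{-1}=\boldsymbol{w}_{-1}=0$, $\boldsymbol{v}_0=\boldsymbol{v}\,1_\ast$, $\boldsymbol{w}_0^H=\boldsymbol{w}^H1_\ast$. For $k=1,2,\dots$ define $$\alpha_{k-1}=\boldsymbol{w}_{k-1}^H\ast\mathsf{A}\ast\boldsymbol{v}_{k-1},\qquad \boldsymbol{w}_k^H=\boldsymbol{w}_{k-1}^H\ast\mathsf{A}-\alpha_{k-1}\ast\boldsymbol{w}_{k-1}^H-\beta_{k-1}\ast\boldsymbol{w}_{k-2}^H,$$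 $$\widehat{\boldsymbol{v}}_k=\mathsf{A}\ast\boldsymbol{v}_{k-1}-\boldsymbol{v}_{k-1}\ast\alpha_{k-1}-\boldsymbol{v}_{k-2},\qquad \beta_k=\boldsymbol{w}_k^H\ast\mathsf{A}\ast\boldsymbol{v}_{k-1},\qquad \boldsymbol{v}_k=\widehat{\boldsymbol{v}}_k\ast\beta_k^{\ast-1},$$ where for $k=1$ the terms with index $-1$ are absent. (Here $\boldsymbol{w}_k^H$ denotes a row vector of distributions.) The matrix $\mathsf{T}_n$ is the $n\times n$ tridiagonal matrix with diagonal entries $\alpha_0,\dots,\alpha_{n-1}$, all superdiagonal entries equal to $1_\ast$, and subdiagonal entries $\beta_1,\dots,\beta_{n-1}$. No-breakdown assumption for $\beta_1,\dots,\beta_{n-1}$: each $\beta_j$, $1\le j\le n-1$, is $\ast$-invertible, with inverse in $\mathrm{D}(I)$, and $\beta_j^{(1,0)}(t,t)\neq0$ for every $t\in I$, where $\beta_j^{(1,0)}(t',t)=\frac{\partial}{\partial t}\beta_j(t',t)$ (the derivative being taken of the smooth coefficient of $\Theta(t'-t)$; it is known that under this condition all coefficients involved lie in $\mathrm{Sm}_\Theta(I)$). $\boldsymbol{e}_1$ is the first canonical basis vector. *)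

theory Defs
  imports "HOL-Analysis.Analysis" "HOL-Library.Function_Algebras"
begin

section \<open>Smooth functions on an interval\<close>

text \<open>The interval may contain its end points; derivatives there are one-sided
  (\<open>at t within I\<close>).\<close>

definition smooth1 :: "real set \<Rightarrow> (real \<Rightarrow> complex) \<Rightarrow> bool" where
  "smooth1 I f \<longleftrightarrow> (\<exists>F :: nat \<Rightarrow> real \<Rightarrow> complex.
     (\<forall>t\<in>I. F 0 t = f t) \<and>
     (\<forall>k. \<forall>t\<in>I. (F k has_vector_derivative F (Suc k) t) (at t within I)))"

text \<open>Smoothness on \<open>I \<times> I\<close>: in the witness, \<open>F i j\<close> is the mixed partial derivative of order
  \<open>i\<close> in the first and \<open>j\<close> in the second variable.\<close>

definition smooth2 :: "real set \<Rightarrow> (real \<Rightarrow> real \<Rightarrow> complex) \<Rightarrow> bool" where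
  "smooth2 I f \<longleftrightarrow> (\<exists>F :: nat \<Rightarrow> nat \<Rightarrow> real \<Rightarrow> real \<Rightarrow> complex.
     (\<forall>x\<in>I. \<forall>y\<in>I. F 0 0 x y = f x y) \<and>
     (\<forall>i j. continuous_on (I \<times> I) (\<lambda>(x, y). F i j x y)) \<and>
     (\<forall>i j. \<forall>x\<in>I. \<forall>y\<in>I.
        ((\<lambda>s. F i j s y) has_vector_derivative F (Suc i) j x y) (at x within I) \<and>
        ((\<lambda>s. F i j x s) has_vector_derivative F i (Suc j) x y) (at y within I)))"


section \<open>Distributions and the \<open>*\<close>-product\<close>

text \<open>
  A distribution \<open>d(t',t)\<close> of the class \<open>D(I)\<close> is, for each fixed \<open>t'\<close>, a distribution in the
  variable \<open>t\<close>.  It is represented by its pairing with test functions in that variable,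
  \<open>\<phi> \<mapsto> (t' \<mapsto> \<integral> d(t',t) \<phi>(t) dt)\<close>.

  Since \<open>d(t',t)\<close> is supported in \<open>t \<le> t'\<close>, the pairing makes sense for every smooth \<open>\<phi>\<close>
  that vanishes near the left end of \<open>I\<close>; no condition is needed at the right end.  This
  space of test functions is preserved by all elements of \<open>D(I)\<close>.

  To make equality of distributions the literal equality of HOL functions, test functions are
  extended by \<open>0\<close> outside \<open>I\<close>, and pairings with functions that are not test functions are
  \<open>0\<close>.
\<close>

definition test_fun :: "real set \<Rightarrow> (real \<Rightarrow> complex) set" where
  "test_fun I = {\<phi>. smooth1 I \<phi> \<and> (\<forall>t. t \<notin> I \<longrightarrow> \<phi> t = 0) \<and>
                    (\<exists>c\<in>interior I. \<forall>t<c. \<phi> t = 0)}"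

type_synonym dist = "(real \<Rightarrow> complex) \<Rightarrow> real \<Rightarrow> complex"

text \<open>\<open>Theta_dist I f\<close> is \<open>f(t',t) \<Theta>(t'-t)\<close>.\<close>

definition Theta_dist :: "real set \<Rightarrow> (real \<Rightarrow> real \<Rightarrow> complex) \<Rightarrow> dist" where
  "Theta_dist I f = (\<lambda>\<phi> t'.
     if \<phi> \<in> test_fun I \<and> t' \<in> I then integral {t\<in>I. t \<le> t'} (\<lambda>t. f t' t * \<phi> t) else 0)"

text \<open>\<open>delta_dist I i g\<close> is \<open>g(t',t) \<delta>\<^sup>(\<^sup>i\<^sup>)(t'-t)\<close>.  The derivatives of \<open>\<delta>\<close> are taken with
  respect to its argument \<open>t'-t\<close>, so the sign \<open>(-1)^i\<close> of \<open>\<partial>\<^sub>t\<^sup>i\<close> cancels the one from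
  integration by parts: \<open>\<integral> g(t',t) \<delta>\<^sup>(\<^sup>i\<^sup>)(t'-t) \<phi>(t) dt\<close> is the \<open>i\<close>-th derivative of
  \<open>t \<mapsto> g(t',t) \<phi>(t)\<close> at \<open>t = t'\<close>.\<close>

definition deriv_on :: "real set \<Rightarrow> (real \<Rightarrow> complex) \<Rightarrow> real \<Rightarrow> complex" where
  "deriv_on I h = (\<lambda>t. vector_derivative h (at t within I))"

definition delta_dist :: "real set \<Rightarrow> nat \<Rightarrow> (real \<Rightarrow> real \<Rightarrow> complex) \<Rightarrow> dist" where
  "delta_dist I i g = (\<lambda>\<phi> t'.
     if \<phi> \<in> test_fun I \<and> t' \<in> I then (deriv_on I ^^ i) (\<lambda>t. g t' t * \<phi> t) t' else 0)"

definition D_class :: "real set \<Rightarrow> dist set" where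
  "D_class I = {Theta_dist I f + (\<Sum>i\<le>M. delta_dist I i (g i)) | f g (M::nat).
                  smooth2 I f \<and> (\<forall>i\<le>M. smooth2 I (g i))}"

definition Theta :: "real set \<Rightarrow> dist" where
  "Theta I = Theta_dist I (\<lambda>_ _. 1)"

definition delta :: "real set \<Rightarrow> nat \<Rightarrow> dist" where
  "delta I i = delta_dist I i (\<lambda>_ _. 1)"

abbreviation one_star :: "real set \<Rightarrow> dist" where
  "one_star I \<equiv> delta I 0"

text \<open>Pairing \<open>\<integral> f\<^sub>2(t',\<tau>) f\<^sub>1(\<tau>,t) d\<tau>\<close> with \<open>\<phi>(t)\<close> gives
  \<open>\<integral> f\<^sub>2(t',\<tau>) (\<integral> f\<^sub>1(\<tau>,t) \<phi>(t) dt) d\<tau>\<close>, so the \<open>*\<close>-product is the composition of the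
  pairings.\<close>

definition star :: "dist \<Rightarrow> dist \<Rightarrow> dist"  (infixl "\<star>" 70) where
  "f2 \<star> f1 = (\<lambda>\<phi>. f2 (f1 \<phi>))"

definition scale :: "complex \<Rightarrow> dist \<Rightarrow> dist" where
  "scale c f = (\<lambda>\<phi> t'. c * f \<phi> t')"

definition star_invertible :: "real set \<Rightarrow> dist \<Rightarrow> bool" where
  "star_invertible I f \<longleftrightarrow> (\<exists>g\<in>D_class I. g \<star> f = one_star I \<and> f \<star> g = one_star I)"

definition star_inverse :: "real set \<Rightarrow> dist \<Rightarrow> dist" where
  "star_inverse I f = (THE g. g \<in> D_class I \<and> g \<star> f = one_star I \<and> f \<star> g = one_star I)"


subsection \<open>Consistency with the explicit product formulas\<close>

text \<open>Only \<open>star_delta_delta\<close> (\<open>\<delta>\<^sup>(\<^sup>i\<^sup>) * \<delta>\<^sup>(\<^sup>j\<^sup>) = \<delta>\<^sup>(\<^sup>i\<^sup>+\<^sup>j\<^sup>)\<close>) and \<open>star_Theta_dist_delta_1\<close>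
  (\<open>f * \<delta>' = -(\<partial>\<^sub>t f) \<Theta>(t'-t) + f(t',t') \<delta>(t'-t)\<close>) matter here; they confirm the sign and
  order conventions above.\<close>

lemma deriv_on_eqI:
  assumes "is_interval I" "interior I \<noteq> {}" "t \<in> I" "(f has_vector_derivative f') (at t within I)"
  shows "deriv_on I f t = f'"
proof -
  have "at t within I \<noteq> bot"
  proof -
    have "I \<noteq> {x}" for x using assms(2) by auto
    moreover have "connected I" using assms(1) by (simp add: is_interval_connected_1)
    ultimately have "t islimpt I" using assms(3) by (intro connected_imp_perfect)
    then show ?thesis by (simp add: trivial_limit_within)
  qed
  then show ?thesis unfolding deriv_on_def using assms(4)
    by (rule vector_derivative_within)
qed

lemma deriv_on_cong:
  assumes "t \<in> I" "\<And>s. s \<in> I \<Longrightarrow> f s = g s"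
  shows "deriv_on I f t = deriv_on I g t"
proof -
  have "(f has_vector_derivative D) (at t within I) = (g has_vector_derivative D) (at t within I)" for D
    using has_vector_derivative_transform[OF assms(1), where f=f and g=g and f'=D]
      has_vector_derivative_transform[OF assms(1), where f=g and g=f and f'=D] assms(2) by auto
  then show ?thesis by (simp add: deriv_on_def vector_derivative_def)
qed

lemma derivs_on_cong:
  assumes "t \<in> I" "\<And>s. s \<in> I \<Longrightarrow> f s = g s"
  shows "(deriv_on I ^^ i) f t = (deriv_on I ^^ i) g t"
  using assms
proof (induction i arbitrary: t)
  case (Suc i)
  then show ?case by (auto intro!: deriv_on_cong)
qed auto

lemma derivs_on_zero:
  assumes I: "is_interval I" "interior I \<noteq> {}" and "t \<in> I"
  shows "(deriv_on I ^^ i) (\<lambda>_. 0) t = 0"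
  using assms(3)
proof (induction i arbitrary: t)
  case (Suc i)
  have "deriv_on I ((deriv_on I ^^ i) (\<lambda>_. 0)) t = deriv_on I (\<lambda>_. 0) t"
    by (rule deriv_on_cong) (use Suc in auto)
  also have "\<dots> = 0" by (rule deriv_on_eqI[OF I Suc.prems]) simp
  finally show ?case by simp
qed simp

lemma test_funE:
  assumes "\<phi> \<in> test_fun I"
  obtains c where "c \<in> I" "\<And>t. t \<le> c \<Longrightarrow> \<phi> t = 0" "c \<in> interior I"
proof -
  obtain c where c: "c \<in> interior I" "\<forall>t<c. \<phi> t = 0" using assms by (auto simp: test_fun_def)
  then obtain e where e: "e > 0" "ball c e \<subseteq> interior I" using open_contains_ball open_interior by metis
  have "c - e/2 \<in> interior I" using e by (auto simp: dist_real_def subset_iff)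
  then show ?thesis using that[of "c - e/2"] c e interior_subset by fastforce
qed

lemma delta_apply:
  "delta I i \<phi> = (\<lambda>t. if \<phi> \<in> test_fun I \<and> t \<in> I then (deriv_on I ^^ i) \<phi> t else 0)"
  by (auto simp: delta_def delta_dist_def)

lemma delta_1_test:
  assumes I: "is_interval I" "interior I \<noteq> {}" and "\<phi> \<in> test_fun I"
  shows "delta I 1 \<phi> \<in> test_fun I"
proof -
  obtain F where F: "\<And>t. t\<in>I \<Longrightarrow> F 0 t = \<phi> t"
    "\<And>k t. t\<in>I \<Longrightarrow> (F k has_vector_derivative F (Suc k) t) (at t within I)"
    using assms(3) unfolding test_fun_def smooth1_def by blast
  have d: "delta I 1 \<phi> t = F 1 t" if "t \<in> I" for t
    using that assms deriv_on_eqI[OF I that F(2)[OF that, of 0]] deriv_on_cong[OF that, of \<phi> "F 0"] F(1)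
    by (simp add: delta_apply)
  have s: "smooth1 I (delta I 1 \<phi>)" unfolding smooth1_def
    by (rule exI[of _ "\<lambda>k. F (Suc k)"]) (use F d in auto)
  obtain c where c: "c \<in> I" "\<And>t. t \<le> c \<Longrightarrow> \<phi> t = 0" "c \<in> interior I" using assms(3) by (rule test_funE) blast
  have "delta I 1 \<phi> t = 0" if "t < c" for t
  proof (cases "t \<in> I")
    case True
    have "((\<lambda>_. 0) has_vector_derivative 0) (at t within I)" by simp
    then have "(\<phi> has_vector_derivative 0) (at t within I)"
      by (rule has_vector_derivative_transform_within[where d="c-t"]) (use that c True in \<open>auto simp: dist_real_def\<close>)
    then show ?thesis using deriv_on_eqI[OF I True] True by (auto simp: delta_apply)
  qed (auto simp: delta_apply)
  then have "\<exists>c\<in>interior I. \<forall>t<c. delta I 1 \<phi> t = 0" using c by blast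
  moreover have "\<forall>t. t \<notin> I \<longrightarrow> delta I 1 \<phi> t = 0" by (simp add: delta_apply)
  ultimately show ?thesis using s unfolding test_fun_def by blast
qed

lemma delta_Suc:
  assumes I: "is_interval I" "interior I \<noteq> {}"
  shows "delta I (Suc i) = delta I i \<star> delta I 1"
proof (intro ext)
  fix \<phi> t
  show "delta I (Suc i) \<phi> t = (delta I i \<star> delta I 1) \<phi> t"
  proof (cases "\<phi> \<in> test_fun I \<and> t \<in> I")
    case True
    have "(deriv_on I ^^ i) (delta I 1 \<phi>) t = (deriv_on I ^^ i) (deriv_on I \<phi>) t"
      using True by (intro derivs_on_cong) (auto simp: delta_apply)
    then show ?thesis using True delta_1_test[OF I]
      by (simp add: star_def delta_apply[of I i] delta_apply[of I "Suc i"] funpow_swap1)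
  next
    case False
    have "delta I 1 \<phi> = (\<lambda>_. 0)" if "\<phi> \<notin> test_fun I" using that by (auto simp: delta_apply)
    moreover note derivs_on_zero[OF I]
    ultimately show ?thesis using False by (auto simp: star_def delta_apply[of I i] delta_apply[of I "Suc i"])
  qed
qed

lemma delta_0_test: "\<phi> \<in> test_fun I \<Longrightarrow> delta I 0 \<phi> = \<phi>"
  by (auto simp: delta_apply test_fun_def)

lemma star_delta_delta:
  assumes I: "is_interval I" "interior I \<noteq> {}"
  shows "delta I i \<star> delta I j = delta I (i + j)"
proof (induction j)
  case 0
  have "smooth1 I (\<lambda>_. 0)" by (auto simp: smooth1_def intro!: exI[of _ "\<lambda>_ _. 0"])
  then have z: "(\<lambda>_. 0) \<in> test_fun I" using I by (auto simp: test_fun_def)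
  have "delta I i (delta I 0 \<phi>) = delta I i \<phi>" for \<phi>
  proof (cases "\<phi> \<in> test_fun I")
    case False
    then have "delta I 0 \<phi> = (\<lambda>_. 0)" "delta I i \<phi> = (\<lambda>_. 0)" by (auto simp: delta_apply)
    moreover have "delta I i (\<lambda>_. 0) = (\<lambda>_. 0)"
      using derivs_on_zero[OF I] by (auto simp: delta_apply)
    ultimately show ?thesis by simp
  qed (simp add: delta_0_test)
  then show ?case by (auto simp: star_def)
next
  case (Suc j)
  then show ?case using delta_Suc[OF I] by (simp add: star_def fun_eq_iff)
qed

lemma star_Theta_dist_delta_1:
  assumes I: "is_interval I" "interior I \<noteq> {}" and "smooth2 I f"
  shows "Theta_dist I f \<star> delta I 1 =
    Theta_dist I (\<lambda>t' t. - vector_derivative (\<lambda>s. f t' s) (at t within I))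
      + delta_dist I 0 (\<lambda>t' t. f t' t')"
proof (intro ext)
  fix \<phi> t'
  show "(Theta_dist I f \<star> delta I 1) \<phi> t' =
    (Theta_dist I (\<lambda>t' t. - vector_derivative (\<lambda>s. f t' s) (at t within I))
      + delta_dist I 0 (\<lambda>t' t. f t' t')) \<phi> t'"
  proof (cases "\<phi> \<in> test_fun I \<and> t' \<in> I")
    case True
    then have \<phi>: "\<phi> \<in> test_fun I" and t': "t' \<in> I" by auto
    obtain c where c: "c \<in> I" "\<And>t. t \<le> c \<Longrightarrow> \<phi> t = 0" "c \<in> interior I" using \<phi> by (rule test_funE) blast
    obtain P where P: "\<And>t. t\<in>I \<Longrightarrow> P 0 t = \<phi> t"
      "\<And>k t. t\<in>I \<Longrightarrow> (P k has_vector_derivative P (Suc k) t) (at t within I)"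
      using \<phi> unfolding test_fun_def smooth1_def by blast
    obtain F where F0: "(\<forall>x\<in>I. \<forall>y\<in>I. F 0 0 x y = f x y) \<and>
     (\<forall>i j. continuous_on (I \<times> I) (\<lambda>(x, y). F i j x y)) \<and>
     (\<forall>i j. \<forall>x\<in>I. \<forall>y\<in>I.
        ((\<lambda>s. F i j s y) has_vector_derivative F (Suc i) j x y) (at x within I) \<and>
        ((\<lambda>s. F i j x s) has_vector_derivative F i (Suc j) x y) (at y within I))"
      using assms(3) unfolding smooth2_def by (rule exE)
    have F: "\<And>x y. x\<in>I \<Longrightarrow> y\<in>I \<Longrightarrow> F 0 0 x y = f x y"
      "\<And>i j. continuous_on (I \<times> I) (\<lambda>(x, y). F i j x y)"
      "\<And>i j x y. x\<in>I \<Longrightarrow> y\<in>I \<Longrightarrow> ((\<lambda>s. F i j x s) has_vector_derivative F i (Suc j) x y) (at y within I)"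
      using F0 by blast+
    have d\<phi>: "(\<phi> has_vector_derivative delta I 1 \<phi> t) (at t within I)" if "t \<in> I" for t
    proof -
      have "(\<phi> has_vector_derivative P 1 t) (at t within I)"
        by (rule has_vector_derivative_transform[OF that, where f="P 0"])
           (use P(1) P(2)[OF that, of 0] in auto)
      moreover then have "delta I 1 \<phi> t = P 1 t"
        using deriv_on_eqI[OF I that] that \<phi> by (simp add: delta_apply)
      ultimately show ?thesis by simp
    qed
    define g where "g t = vector_derivative (\<lambda>s. f t' s) (at t within I)" for t
    have df: "(f t' has_vector_derivative g t) (at t within I)" if "t \<in> I" for t
    proof -
      have "(f t' has_vector_derivative F 0 1 t' t) (at t within I)"
        by (rule has_vector_derivative_transform[OF that, where f="F 0 0 t'"])
           (use F(1) F(3)[OF t' that, of 0 0] t' in auto)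
      moreover then have "g t = F 0 1 t' t"
        using deriv_on_eqI[OF I that] by (simp add: deriv_on_def g_def)
      ultimately show ?thesis by simp
    qed
    have gF: "g t = F 0 1 t' t" if "t \<in> I" for t
    proof -
      have "(f t' has_vector_derivative F 0 1 t' t) (at t within I)"
        by (rule has_vector_derivative_transform[OF that, where f="F 0 0 t'"])
           (use F(1) F(3)[OF t' that, of 0 0] t' in auto)
      then show ?thesis
        using deriv_on_eqI[OF I that] by (simp add: deriv_on_def g_def)
    qed
    have *: "integral {t\<in>I. t \<le> t'} h = (if c \<le> t' then integral {c..t'} h else 0)"
      if "\<And>t. t < c \<Longrightarrow> h t = 0" for h :: "real \<Rightarrow> complex"
    proof (cases "c \<le> t'")
      case True
      have sub: "{c..t'} \<subseteq> {t\<in>I. t \<le> t'}" 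
        using mem_is_interval_1_I[OF I(1) c(1) t'] by auto 
      have "integral {c..t'} h = integral {t\<in>I. t \<le> t'} h"
      proof -
        have "integral {t\<in>I. t \<le> t'} h = integral {t\<in>I. t \<le> t'} (\<lambda>t. if t \<in> {c..t'} then h t else 0)"
          by (rule integral_cong) (use that in auto)
        also have "\<dots> = integral ({c..t'} \<inter> {t\<in>I. t \<le> t'}) h" by (rule integral_restrict_Int)
        also have "{c..t'} \<inter> {t\<in>I. t \<le> t'} = {c..t'}" using sub by auto
        finally show ?thesis by simp
      qed
      then show ?thesis using True by simp
    next
      case False
      have "integral {t\<in>I. t \<le> t'} h = integral {t\<in>I. t \<le> t'} (\<lambda>_. 0)"
        by (rule integral_cong) (use that False in auto)
      then show ?thesis using False by simp
    qed
    have dz: "delta I 1 \<phi> t = 0" if "t < c" for t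
    proof (cases "t \<in> I")
      case True
      have "((\<lambda>_. 0) has_vector_derivative 0) (at t within I)" by simp
      then have "(\<phi> has_vector_derivative 0) (at t within I)"
        by (rule has_vector_derivative_transform_within[where d="c-t"]) (use that c True in \<open>auto simp: dist_real_def\<close>)
      then show ?thesis using deriv_on_eqI[OF I True] True by (auto simp: delta_apply)
    qed (auto simp: delta_apply)
    have l: "(Theta_dist I f \<star> delta I 1) \<phi> t' =
        (if c \<le> t' then integral {c..t'} (\<lambda>t. f t' t * delta I 1 \<phi> t) else 0)"
      using delta_1_test[OF I \<phi>] t' dz by (simp add: star_def Theta_dist_def *)
    have r: "Theta_dist I (\<lambda>t' t. - vector_derivative (\<lambda>s. f t' s) (at t within I)) \<phi> t' =
        (if c \<le> t' then - integral {c..t'} (\<lambda>t. g t * \<phi> t) else 0)"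
      using \<phi> t' c by (simp add: Theta_dist_def * g_def[symmetric])
    show ?thesis
    proof (cases "c \<le> t'")
      case True
      have sub: "{c..t'} \<subseteq> I" 
        using mem_is_interval_1_I[OF I(1) c(1) t'] by auto 
      have ftc: "((\<lambda>t. f t' t * delta I 1 \<phi> t + g t * \<phi> t) has_integral f t' t' * \<phi> t' - f t' c * \<phi> c) {c..t'}"
      proof (rule fundamental_theorem_of_calculus[OF True])
        fix x assume "x \<in> {c..t'}"
        then have "x \<in> I" using sub by auto
        from has_vector_derivative_mult[OF df[OF this] d\<phi>[OF this]]
        show "((\<lambda>t. f t' t * \<phi> t) has_vector_derivative f t' x * delta I 1 \<phi> x + g x * \<phi> x) (at x within {c..t'})"
          using has_vector_derivative_within_subset sub by blast
      qed
      have "continuous_on I (\<lambda>t. F 0 1 t' t)"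
      proof -
        have "continuous_on I ((\<lambda>(x,y). F 0 1 x y) \<circ> (\<lambda>t. (t', t)))"
          by (intro continuous_on_compose continuous_intros continuous_on_subset[OF F(2)]) (use t' in auto)
        then show ?thesis by (simp add: o_def)
      qed
      then have "continuous_on I g" using gF by (simp cong: continuous_on_cong)
      moreover have "continuous_on I \<phi>" using d\<phi>
        by (meson continuous_on_eq_continuous_within has_vector_derivative_continuous)
      ultimately have "continuous_on {c..t'} (\<lambda>t. g t * \<phi> t)"
        using sub by (auto intro!: continuous_intros intro: continuous_on_subset)
      then have i2: "(\<lambda>t. g t * \<phi> t) integrable_on {c..t'}" by (rule integrable_continuous_real)
      from has_integral_diff[OF ftc integrable_integral[OF i2]]
      have "integral {c..t'} (\<lambda>t. f t' t * delta I 1 \<phi> t) = f t' t' * \<phi> t' - integral {c..t'} (\<lambda>t. g t * \<phi> t)"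
        using c by (auto simp: integral_unique)
      then show ?thesis using l r True \<phi> t' by (simp add: delta_dist_def)
    next
      case False
      then show ?thesis using l r \<phi> t' c by (simp add: delta_dist_def)
    qed
  next
    case False
    have "delta I 1 \<phi> = (\<lambda>_. 0)" if "\<phi> \<notin> test_fun I" using that by (auto simp: delta_apply)
    then show ?thesis using False by (auto simp: star_def Theta_dist_def delta_dist_def)
  qed
qed


subsection \<open>Matrices and vectors of distributions\<close>

text \<open>Matrices with rows and columns indexed by a finite set \<open>K\<close> are functions that are \<open>0\<close>
  outside \<open>K \<times> K\<close>, so that equality of matrices is equality of functions.\<close>

definition D_mats :: "real set \<Rightarrow> 'k set \<Rightarrow> ('k \<Rightarrow> 'k \<Rightarrow> dist) set" where
  "D_mats I K = {X. (\<forall>i\<in>K. \<forall>j\<in>K. X i j \<in> D_class I) \<and> (\<forall>i j. i \<notin> K \<or> j \<notin> K \<longrightarrow> X i j = 0)}"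

definition mat_id :: "real set \<Rightarrow> 'k set \<Rightarrow> 'k \<Rightarrow> 'k \<Rightarrow> dist" where
  "mat_id I K = (\<lambda>i j. if i \<in> K \<and> i = j then one_star I else 0)"

definition mat_mult :: "'k set \<Rightarrow> ('k \<Rightarrow> 'k \<Rightarrow> dist) \<Rightarrow> ('k \<Rightarrow> 'k \<Rightarrow> dist) \<Rightarrow> 'k \<Rightarrow> 'k \<Rightarrow> dist" where
  "mat_mult K X Y = (\<lambda>i j. \<Sum>k\<in>K. X i k \<star> Y k j)"

primrec mat_pow :: "real set \<Rightarrow> 'k set \<Rightarrow> ('k \<Rightarrow> 'k \<Rightarrow> dist) \<Rightarrow> nat \<Rightarrow> 'k \<Rightarrow> 'k \<Rightarrow> dist" where
  "mat_pow I K X 0 = mat_id I K"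
| "mat_pow I K X (Suc m) = mat_mult K X (mat_pow I K X m)"

definition mat_invertible :: "real set \<Rightarrow> 'k set \<Rightarrow> ('k \<Rightarrow> 'k \<Rightarrow> dist) \<Rightarrow> bool" where
  "mat_invertible I K X \<longleftrightarrow>
     (\<exists>Y\<in>D_mats I K. mat_mult K Y X = mat_id I K \<and> mat_mult K X Y = mat_id I K)"

definition mat_inverse :: "real set \<Rightarrow> 'k set \<Rightarrow> ('k \<Rightarrow> 'k \<Rightarrow> dist) \<Rightarrow> 'k \<Rightarrow> 'k \<Rightarrow> dist" where
  "mat_inverse I K X =
     (THE Y. Y \<in> D_mats I K \<and> mat_mult K Y X = mat_id I K \<and> mat_mult K X Y = mat_id I K)"

definition star_resolvent :: "real set \<Rightarrow> 'k set \<Rightarrow> ('k \<Rightarrow> 'k \<Rightarrow> dist) \<Rightarrow> 'k \<Rightarrow> 'k \<Rightarrow> dist" where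
  "star_resolvent I K X = mat_inverse I K (mat_id I K - X)"

definition row_mat :: "('k::finite \<Rightarrow> dist) \<Rightarrow> ('k \<Rightarrow> 'k \<Rightarrow> dist) \<Rightarrow> 'k \<Rightarrow> dist" where
  "row_mat x Y = (\<lambda>j. \<Sum>k\<in>UNIV. x k \<star> Y k j)"

definition mat_col :: "('k::finite \<Rightarrow> 'k \<Rightarrow> dist) \<Rightarrow> ('k \<Rightarrow> dist) \<Rightarrow> 'k \<Rightarrow> dist" where
  "mat_col X y = (\<lambda>i. \<Sum>k\<in>UNIV. X i k \<star> y k)"

definition row_col :: "('k::finite \<Rightarrow> dist) \<Rightarrow> ('k \<Rightarrow> dist) \<Rightarrow> dist" where
  "row_col x y = (\<Sum>k\<in>UNIV. x k \<star> y k)"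

text \<open>\<open>sandwich K x X y\<close> is \<open>x\<^sup>H X y\<close> for time-independent \<open>x\<close> and \<open>y\<close>.\<close>

definition sandwich ::
  "'k set \<Rightarrow> ('k \<Rightarrow> complex) \<Rightarrow> ('k \<Rightarrow> 'k \<Rightarrow> dist) \<Rightarrow> ('k \<Rightarrow> complex) \<Rightarrow> dist" where
  "sandwich K x X y = (\<Sum>i\<in>K. \<Sum>j\<in>K. scale (cnj (x i) * y j) (X i j))"

definition e1 :: "nat \<Rightarrow> complex" where
  "e1 i = (if i = 0 then 1 else 0)"


section \<open>Time-ordered exponential\<close>

definition star_mat :: "real set \<Rightarrow> (real \<Rightarrow> complex^'N^'N) \<Rightarrow> 'N \<Rightarrow> 'N \<Rightarrow> dist" where
  "star_mat I A = (\<lambda>i j. Theta_dist I (\<lambda>t' t. A t' $ i $ j))"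

definition time_ordered_exp ::
  "real set \<Rightarrow> (real \<Rightarrow> complex^'N^'N) \<Rightarrow> (real \<Rightarrow> real \<Rightarrow> complex^'N^'N) \<Rightarrow> bool" where
  "time_ordered_exp I A U \<longleftrightarrow>
     (\<forall>t\<in>I. U t t = mat 1 \<and>
        (\<forall>t'\<in>I. t \<le> t' \<longrightarrow>
           ((\<lambda>s. U s t) has_vector_derivative A t' ** U t' t) (at t' within {s\<in>I. t \<le> s})))"


section \<open>The \<open>*\<close>-Lanczos algorithm\<close>

text \<open>\<open>lz_w\<close> is the row vector \<open>w\<^sub>k\<^sup>H\<close>.  The unused \<open>lz_vhat 0\<close> and \<open>lz_beta 0\<close> are set to
  \<open>0\<close>.\<close>

function
  lz_alpha :: "real set \<Rightarrow> ('N::finite \<Rightarrow> 'N \<Rightarrow> dist) \<Rightarrow> complex^'N \<Rightarrow> complex^'N \<Rightarrow> nat \<Rightarrow> dist" and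
  lz_beta :: "real set \<Rightarrow> ('N::finite \<Rightarrow> 'N \<Rightarrow> dist) \<Rightarrow> complex^'N \<Rightarrow> complex^'N \<Rightarrow> nat \<Rightarrow> dist" and
  lz_w :: "real set \<Rightarrow> ('N::finite \<Rightarrow> 'N \<Rightarrow> dist) \<Rightarrow> complex^'N \<Rightarrow> complex^'N \<Rightarrow> nat \<Rightarrow> 'N \<Rightarrow> dist" and
  lz_vhat :: "real set \<Rightarrow> ('N::finite \<Rightarrow> 'N \<Rightarrow> dist) \<Rightarrow> complex^'N \<Rightarrow> complex^'N \<Rightarrow> nat \<Rightarrow> 'N \<Rightarrow> dist" and
  lz_v :: "real set \<Rightarrow> ('N::finite \<Rightarrow> 'N \<Rightarrow> dist) \<Rightarrow> complex^'N \<Rightarrow> complex^'N \<Rightarrow> nat \<Rightarrow> 'N \<Rightarrow> dist"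
where
  "lz_alpha I A w v k = row_col (row_mat (lz_w I A w v k) A) (lz_v I A w v k)"
| "lz_beta I A w v 0 = 0"
| "lz_beta I A w v (Suc k) = row_col (row_mat (lz_w I A w v (Suc k)) A) (lz_v I A w v k)"
| "lz_w I A w v 0 = (\<lambda>i. scale (cnj (w $ i)) (one_star I))"
| "lz_w I A w v (Suc 0) =
     (\<lambda>i. row_mat (lz_w I A w v 0) A i - lz_alpha I A w v 0 \<star> lz_w I A w v 0 i)"
| "lz_w I A w v (Suc (Suc k)) =
     (\<lambda>i. row_mat (lz_w I A w v (Suc k)) A i
           - lz_alpha I A w v (Suc k) \<star> lz_w I A w v (Suc k) i
           - lz_beta I A w v (Suc k) \<star> lz_w I A w v k i)"
| "lz_vhat I A w v 0 = 0"
| "lz_vhat I A w v (Suc 0) =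
     (\<lambda>i. mat_col A (lz_v I A w v 0) i - lz_v I A w v 0 i \<star> lz_alpha I A w v 0)"
| "lz_vhat I A w v (Suc (Suc k)) =
     (\<lambda>i. mat_col A (lz_v I A w v (Suc k)) i
           - lz_v I A w v (Suc k) i \<star> lz_alpha I A w v (Suc k)
           - lz_v I A w v k i)"
| "lz_v I A w v 0 = (\<lambda>i. scale (v $ i) (one_star I))"
| "lz_v I A w v (Suc k) =
     (\<lambda>i. lz_vhat I A w v (Suc k) i \<star> star_inverse I (lz_beta I A w v (Suc k)))"
  by pat_completeness auto
termination
  by (relation "Wellfounded.measure (\<lambda>x. case x of
        Inl (Inl (_, _, _, _, k)) \<Rightarrow> 4 * k + 3
      | Inl (Inr (_, _, _, _, k)) \<Rightarrow> 4 * k + 1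
      | Inr (Inl (_, _, _, _, k)) \<Rightarrow> 4 * k
      | Inr (Inr (Inl (_, _, _, _, k))) \<Rightarrow> 4 * k
      | Inr (Inr (Inr (_, _, _, _, k))) \<Rightarrow> 4 * k + 2)") auto

definition lz_T ::
  "real set \<Rightarrow> ('N::finite \<Rightarrow> 'N \<Rightarrow> dist) \<Rightarrow> complex^'N \<Rightarrow> complex^'N \<Rightarrow> nat \<Rightarrow> nat \<Rightarrow> nat \<Rightarrow> dist" where
  "lz_T I A w v n = (\<lambda>i j.
     if i < n \<and> j < n then
       if j = i then lz_alpha I A w v i
       else if j = Suc i then one_star I
       else if i = Suc j then lz_beta I A w v i
       else 0
     else 0)"

text \<open>The superscript \<open>(1,0)\<close> refers to the derivative in the second time variable \<open>t\<close> of the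
  smooth coefficient \<open>b(t',t)\<close> of \<open>\<Theta>(t'-t)\<close>, evaluated at \<open>t' = t\<close>.\<close>

definition no_breakdown :: "real set \<Rightarrow> dist \<Rightarrow> bool" where
  "no_breakdown I \<beta> \<longleftrightarrow> star_invertible I \<beta> \<and>
     (\<exists>b. smooth2 I b \<and> \<beta> = Theta_dist I b \<and>
          (\<forall>t\<in>I. vector_derivative (\<lambda>s. b t s) (at t within I) \<noteq> 0))"

end

theory Submission
  imports Defs
begin

text \<open>The star product is composition of operators on test functions that vanish near the left end of \<open>I\<close>.  In
  this picture elements of \<open>Sm\<^sub>\<Theta>(I)\<close> are Volterra integral operators, \<open>\<delta>'\<close> is differentiation, and \<open>\<Theta>\<close> is its
  two-sided inverse.

  The identities between \<open>A\<close> and \<open>T = T\<^sub>n\<close> are algebra.  The Lanczos vectors are biorthogonal (\<open>biorthogonality\<close>), and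
  their recurrences read \<open>A V = V T\<close> when \<open>v\<close> breaks down and \<open>T W = W A\<close> when \<open>w\<close> does (\<open>A_V_eq_V_T\<close>, \<open>T_W_eq_W_A\<close>).  Either relation
  passes to powers and to resolvents (\<open>intertwine_pow\<close>, \<open>intertwine_inverse\<close>).  As \<open>w\<^sub>0 V\<close> and \<open>W v\<^sub>0\<close> are the first unit
  vector, \<open>w\<^sup>H X v\<close> equals the corner entry of the intertwined matrix \<open>X'\<close> (\<open>corner_entry\<close>).

  The analysis is in the existence of the inverses.  Volterra operators have resolvents with smooth kernels
  (\<open>volterra_resolvent\<close>), but \<open>T\<close> has units on its superdiagonal and the vectors \<open>v\<^sub>k\<close> contain derivatives of
  \<open>\<delta>\<close>.  Both are controlled by the order of an operator, the number of integrations that it performs.  The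
  order is additive under products, because conjugation by \<open>\<delta>'\<close> preserves the ring of integral plus
  multiplication operators (\<open>Ord_star\<close>).  The vectors \<open>w\<^sub>k\<close> and \<open>v\<^sub>k\<close> have orders \<open>k\<close> and \<open>-k\<close>, hence \<open>\<alpha>\<^sub>k\<close> and \<open>\<beta>\<^sub>k\<close> have orders
  1 and 2 (\<open>lanczos_orders\<close>).  The condition on the derivative of \<open>\<beta>\<^sub>k\<close> at the diagonal says that the leading coefficient
  has no zero, so that \<open>\<beta>\<^sub>k\<close> has an inverse of order -2 (\<open>beta_inverse\<close>).  Conjugating \<open>T\<close> by the diagonal
  matrix of the operators \<open>\<delta>\<^sup>(\<^sup>i\<^sup>)\<close> makes all of its entries Volterra operators, which yields the inverse
  of \<open>1 - T\<close> (\<open>balanced_inverse\<close>).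

  For the last claim let \<open>L\<close> be the inverse of \<open>1 - A\<close>.  The kernel of \<open>\<Theta> * L\<close> satisfies the backward evolution
  equation and so coincides with \<open>U\<close> on \<open>t \<le> t'\<close> (\<open>evolution_kernel\<close>).  Reading equations between kernels off
  equations between operators requires that the operator determines its kernel (\<open>kernel_unique\<close>).\<close>

section \<open>Signed integrals over an interval\<close>

text \<open>The integral of \<open>h\<close> from \<open>a\<close> to \<open>x\<close>, with the opposite sign for \<open>x < a\<close>, written over the fixed interval
  \<open>[0,1]\<close>: continuity and differentiation in all parameters, including the end points, then reduce
  to the standard facts on parameter integrals.\<close>

definition sint :: "real \<Rightarrow> real \<Rightarrow> (real \<Rightarrow> complex) \<Rightarrow> complex" where
  "sint a x h = integral {0..1} (\<lambda>s. (x - a) *\<^sub>R h (a + s * (x - a)))"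

definition pd1 :: "real set \<Rightarrow> (real \<Rightarrow> real \<Rightarrow> complex) \<Rightarrow> (real \<Rightarrow> real \<Rightarrow> complex) \<Rightarrow> bool" where
  "pd1 I f f' \<longleftrightarrow> (\<forall>x\<in>I. \<forall>y\<in>I. ((\<lambda>s. f s y) has_vector_derivative f' x y) (at x within I))"

definition pd2 :: "real set \<Rightarrow> (real \<Rightarrow> real \<Rightarrow> complex) \<Rightarrow> (real \<Rightarrow> real \<Rightarrow> complex) \<Rightarrow> bool" where
  "pd2 I f f' \<longleftrightarrow> (\<forall>x\<in>I. \<forall>y\<in>I. ((\<lambda>s. f x s) has_vector_derivative f' x y) (at y within I))"

text \<open>Membership in the class of \<open>m\<close> times continuously differentiable functions on \<open>I \<times> I\<close>, by recursion
  on \<open>m\<close>.  Unlike \<open>smooth2\<close>, this says nothing about the symmetry of mixed derivatives, so closure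
  properties and the bootstrapping of resolvents are plain inductions on \<open>m\<close>.\<close>

primrec Ck :: "real set \<Rightarrow> nat \<Rightarrow> (real \<Rightarrow> real \<Rightarrow> complex) \<Rightarrow> bool" where
  "Ck I 0 f \<longleftrightarrow> continuous_on (I \<times> I) (\<lambda>(x, y). f x y)"
| "Ck I (Suc m) f \<longleftrightarrow> continuous_on (I \<times> I) (\<lambda>(x, y). f x y) \<and>
     (\<exists>f1 f2. pd1 I f f1 \<and> pd2 I f f2 \<and> Ck I m f1 \<and> Ck I m f2)"

text \<open>The kernel of a product of two elements of \<open>Sm\<^sub>\<Theta>(I)\<close>.  The signed integral extends it smoothly to
  all of \<open>I \<times> I\<close>, although only \<open>y \<le> x\<close> matters for the operator.\<close>

definition conv :: "(real \<Rightarrow> real \<Rightarrow> complex) \<Rightarrow> (real \<Rightarrow> real \<Rightarrow> complex) \<Rightarrow> real \<Rightarrow> real \<Rightarrow> complex" where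
  "conv f g x y = sint y x (\<lambda>\<tau>. f x \<tau> * g \<tau> y)"

locale time_interval =
  fixes I :: "real set"
  assumes ivl: "is_interval I" and int: "interior I \<noteq> {}"
begin

lemma cvx: "convex I" using ivl is_interval_convex by blast

lemma mem_I: "a \<in> I \<Longrightarrow> b \<in> I \<Longrightarrow> a \<le> x \<Longrightarrow> x \<le> b \<Longrightarrow> x \<in> I"
  using ivl mem_is_interval_1_I by blast

lemma Icc_I: "a \<in> I \<Longrightarrow> b \<in> I \<Longrightarrow> {a..b} \<subseteq> I"
proof
  fix x assume "a \<in> I" "b \<in> I" "x \<in> {a..b}"
  then show "x \<in> I" using mem_I[of a b x] by simp
qed

lemma seg_mem:
  assumes "a \<in> I" "x \<in> I" "s \<in> {0..1}" shows "a + s * (x - a) \<in> I"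
proof -
  have "(1 - s) *\<^sub>R a + s *\<^sub>R x \<in> I" using cvx assms by (auto simp: convex_alt)
  then show ?thesis by (simp add: algebra_simps)
qed

lemma at_I_nontrivial: "t \<in> I \<Longrightarrow> at t within I \<noteq> bot"
proof -
  assume t: "t \<in> I"
  have "I \<noteq> {x}" for x using int by auto
  moreover have "connected I" using ivl by (simp add: is_interval_connected_1)
  ultimately have "t islimpt I" using t by (intro connected_imp_perfect)
  then show ?thesis by (simp add: trivial_limit_within)
qed

lemma vd_unique:
  assumes "t \<in> I" "(f has_vector_derivative a) (at t within I)" "(f has_vector_derivative b) (at t within I)"
  shows "a = b"
  using vector_derivative_unique_within[OF at_I_nontrivial[OF assms(1)] assms(2,3)] .

text \<open>Antiderivatives and uniform limits live on compact intervals, while \<open>I\<close> is arbitrary.  Derivatives and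
  continuity within \<open>I\<close> at a point can be tested on a compact subinterval that also contains finitely
  many prescribed points.\<close>

lemma compact_nhd:
  assumes x: "x \<in> I" and a: "a \<in> I" "b \<in> I"
  obtains c d where "{c..d} \<subseteq> I" "x \<in> {c..d}" "a \<in> {c..d}" "b \<in> {c..d}"
    "at x within {c..d} = at x within I"
    "\<exists>e>0. \<forall>z\<in>I. dist z x < e \<longrightarrow> z \<in> {c..d}"
proof -
  have "\<exists>c0\<in>I. c0 \<le> x \<and> (c0 < x \<or> (\<forall>z\<in>I. x \<le> z))"
  proof (cases "\<exists>z\<in>I. z < x")
    case True
    then obtain z where "z \<in> I" "z < x" by blast
    then show ?thesis by (intro bexI[of _ z]) auto
  next
    case False
    then show ?thesis using x by (intro bexI[of _ x]) (auto simp: not_less)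
  qed
  then obtain c0 where c0: "c0 \<in> I" "c0 \<le> x" "c0 < x \<or> (\<forall>z\<in>I. x \<le> z)" by blast
  have "\<exists>d0\<in>I. x \<le> d0 \<and> (x < d0 \<or> (\<forall>z\<in>I. z \<le> x))"
  proof (cases "\<exists>z\<in>I. x < z")
    case True
    then obtain z where "z \<in> I" "x < z" by blast
    then show ?thesis by (intro bexI[of _ z]) auto
  next
    case False
    then show ?thesis using x by (intro bexI[of _ x]) (auto simp: not_less)
  qed
  then obtain d0 where d0: "d0 \<in> I" "x \<le> d0" "x < d0 \<or> (\<forall>z\<in>I. z \<le> x)" by blast
  define c where "c = min (min a b) c0"
  define d where "d = max (max a b) d0"
  have "c \<in> I" "d \<in> I" using a c0 d0 by (auto simp: c_def d_def min_def max_def)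
  then have sub: "{c..d} \<subseteq> I" by (rule Icc_I)
  define e where "e = min (if c0 < x then x - c0 else 1) (if x < d0 then d0 - x else 1)"
  have e0: "e > 0" by (auto simp: e_def)
  have e: "z \<in> {c..d}" if z: "z \<in> I" "dist z x < e" for z
  proof -
    have "\<bar>z - x\<bar> < e" using z(2) by (simp add: dist_real_def)
    then have "c0 \<le> z" "z \<le> d0" using c0 d0 z(1) by (auto simp: e_def split: if_splits)
    then show ?thesis by (auto simp: c_def d_def)
  qed
  have "at x within {c..d} = at x within I"
  proof (rule at_within_nhd[where S="ball x e"])
    show "x \<in> ball x e" using e0 by simp
    show "{c..d} \<inter> ball x e - {x} = I \<inter> ball x e - {x}"
      using sub e by (auto simp: dist_commute)
  qed simp
  moreover have "x \<in> {c..d}" "a \<in> {c..d}" "b \<in> {c..d}"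
    using c0(2) d0(2) by (auto simp: c_def d_def)
  moreover have "\<exists>e>0. \<forall>z\<in>I. dist z x < e \<longrightarrow> z \<in> {c..d}" using e0 e by blast
  ultimately show ?thesis using that sub by blast
qed

lemma cont_seg:
  assumes "continuous_on I h" "a \<in> I" "x \<in> I"
  shows "continuous_on {0..1} (\<lambda>s. h (a + s * (x - a)))"
  by (rule continuous_on_compose2[OF assms(1)]) (use seg_mem[OF assms(2,3)] in \<open>auto intro!: continuous_intros\<close>)

lemma sint_FTC:
  assumes S: "is_interval S" "a \<in> S" "x \<in> S"
    and H: "\<And>z. z \<in> S \<Longrightarrow> (H has_vector_derivative h z) (at z within S)"
  shows "sint a x h = H x - H a"
proof -
  have mem: "a + s * (x - a) \<in> S" if "s \<in> {0..1}" for s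
  proof -
    have "(1 - s) *\<^sub>R a + s *\<^sub>R x \<in> S" using is_interval_convex[OF S(1)] S that by (auto simp: convex_alt)
    then show ?thesis by (simp add: algebra_simps)
  qed
  have "((\<lambda>s. (x - a) *\<^sub>R h (a + s * (x - a))) has_integral (H \<circ> (\<lambda>s. a + s * (x - a))) 1 - (H \<circ> (\<lambda>s. a + s * (x - a))) 0) {0..1}"
  proof (rule fundamental_theorem_of_calculus)
    fix s :: real assume s: "s \<in> {0..1}"
    have 1: "((\<lambda>s. a + s * (x - a)) has_vector_derivative (x - a)) (at s within {0..1})"
      by (auto intro!: derivative_eq_intros simp: has_real_derivative_iff_has_vector_derivative[symmetric])
    have 2: "(H has_vector_derivative h (a + s * (x - a))) (at (a + s * (x - a)) within ((\<lambda>s. a + s * (x - a)) ` {0..1}))"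
      by (rule has_vector_derivative_within_subset[OF H[OF mem[OF s]]]) (use mem in auto)
    show "(H \<circ> (\<lambda>s. a + s * (x - a)) has_vector_derivative (x - a) *\<^sub>R h (a + s * (x - a))) (at s within {0..1})"
      by (rule vector_diff_chain_within[OF 1 2])
  qed simp
  then have "integral {0..1} (\<lambda>s. (x - a) *\<^sub>R h (a + s * (x - a))) = H x - H a"
    by (intro integral_unique) (simp add: o_def)
  then show ?thesis unfolding sint_def .
qed

lemma sint_deriv:
  assumes h: "continuous_on I h" and a: "a \<in> I" and x: "x \<in> I"
  shows "((\<lambda>z. sint a z h) has_vector_derivative h x) (at x within I)"
proof -
  obtain c d where cd: "{c..d} \<subseteq> I" "x \<in> {c..d}" "a \<in> {c..d}" "at x within {c..d} = at x within I"
    by (rule compact_nhd[OF x a a])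
  obtain H where H: "\<And>z. z \<in> {c..d} \<Longrightarrow> (H has_vector_derivative h z) (at z within {c..d})"
    by (rule antiderivative_continuous[OF continuous_on_subset[OF h cd(1)]]) (rule that)
  have eq: "sint a z h = H z - H a" if "z \<in> {c..d}" for z
    by (rule sint_FTC[OF _ cd(3) that H]) auto
  have "((\<lambda>z. H z - H a) has_vector_derivative h x) (at x within {c..d})"
    using has_vector_derivative_diff[OF H[OF cd(2)] has_vector_derivative_const[of "H a"]] by simp
  then have "((\<lambda>z. sint a z h) has_vector_derivative h x) (at x within {c..d})"
    by (rule has_vector_derivative_transform[OF cd(2), rotated]) (use eq in auto)
  then show ?thesis using cd(4) by simp
qed

lemma sint_refl [simp]: "sint a a h = 0" by (simp add: sint_def)

lemma sint_cong: "a \<in> I \<Longrightarrow> x \<in> I \<Longrightarrow> (\<And>z. z \<in> I \<Longrightarrow> h z = h' z) \<Longrightarrow> sint a x h = sint a x h'"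
  unfolding sint_def by (rule integral_cong) (use seg_mem in auto)

lemma sint_integral:
  assumes h: "continuous_on I h" and a: "a \<in> I" and x: "x \<in> I" and "a \<le> x"
  shows "sint a x h = integral {a..x} h"
proof -
  have sub: "{a..x} \<subseteq> I" by (rule Icc_I[OF a x])
  obtain H where H: "\<And>z. z \<in> {a..x} \<Longrightarrow> (H has_vector_derivative h z) (at z within {a..x})"
    by (rule antiderivative_continuous[OF continuous_on_subset[OF h sub]]) (rule that)
  have "(h has_integral H x - H a) {a..x}" by (rule fundamental_theorem_of_calculus[OF assms(4) H])
  moreover have "sint a x h = H x - H a" by (rule sint_FTC[OF _ _ _ H]) (use assms(4) in auto)
  ultimately show ?thesis by (simp add: integral_unique)
qed

lemma sint_integrable:
  fixes h :: "real \<Rightarrow> complex"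
  assumes "continuous_on I h" "a \<in> I" "x \<in> I"
  shows "(\<lambda>s. (x - a) *\<^sub>R h (a + s * (x - a))) integrable_on {0..1}"
  by (rule integrable_continuous_real, intro continuous_on_scaleR continuous_on_const cont_seg[OF assms])

lemma sint_add:
  assumes "continuous_on I h" "continuous_on I h'" "a \<in> I" "x \<in> I"
  shows "sint a x (\<lambda>z. h z + h' z) = sint a x h + sint a x h'"
  unfolding sint_def scaleR_add_right
  by (rule integral_add) (use assms sint_integrable in auto)

lemma sint_mult: "sint a x (\<lambda>z. c * h z) = c * sint a x h"
proof -
  have "sint a x (\<lambda>z. c * h z) = integral {0..1} (\<lambda>s. c * ((x - a) *\<^sub>R h (a + s * (x - a))))"
    unfolding sint_def by (simp add: algebra_simps)
  then show ?thesis by (simp add: sint_def)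
qed

lemma sint_swap: "a \<in> I \<Longrightarrow> x \<in> I \<Longrightarrow> continuous_on I h \<Longrightarrow> sint x a h = - sint a x h"
proof -
  assume a: "a \<in> I" "x \<in> I" "continuous_on I h"
  obtain c d where cd: "{c..d} \<subseteq> I" "x \<in> {c..d}" "a \<in> {c..d}"
    by (rule compact_nhd[OF a(2,1,1)])
  obtain H where H: "\<And>z. z \<in> {c..d} \<Longrightarrow> (H has_vector_derivative h z) (at z within {c..d})"
    by (rule antiderivative_continuous[OF continuous_on_subset[OF a(3) cd(1)]]) (rule that)
  show ?thesis using sint_FTC[OF _ cd(3,2) H] sint_FTC[OF _ cd(2,3) H] by simp
qed

lemma zero_deriv_const:
  assumes "\<And>z. z \<in> I \<Longrightarrow> (h has_vector_derivative 0) (at z within I)" "a \<in> I" "x \<in> I"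
  shows "h x = h (a::real) "
proof -
  obtain c where "\<And>x. x \<in> I \<Longrightarrow> h x = c"
    by (rule has_vector_derivative_zero_constant[OF cvx assms(1)]) (assumption, rule that)
  then show ?thesis using assms by auto
qed

lemma eq_by_deriv:
  assumes "\<And>z. z \<in> I \<Longrightarrow> (h has_vector_derivative d z) (at z within I)"
    "\<And>z. z \<in> I \<Longrightarrow> (k has_vector_derivative d z) (at z within I)" "a \<in> I" "h a = k a" "x \<in> I"
  shows "h x = k (x::real)"
proof -
  have "h x - k x = h a - k a"
  proof (rule zero_deriv_const[of "\<lambda>z. h z - k z"])
    show "((\<lambda>z. h z - k z) has_vector_derivative 0) (at z within I)" if "z \<in> I" for z
      using has_vector_derivative_diff[OF assms(1)[OF that] assms(2)[OF that]] by simp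
  qed (rule assms)+
  then show ?thesis using assms(4) by simp
qed

section \<open>Kernels with continuous partial derivatives\<close>

abbreviation cont2 :: "(real \<Rightarrow> real \<Rightarrow> complex) \<Rightarrow> bool" where
  "cont2 f \<equiv> continuous_on (I \<times> I) (\<lambda>(x, y). f x y)"

lemma cont2_compose:
  assumes "cont2 f" "continuous_on S p" "continuous_on S q" "\<And>z. z \<in> S \<Longrightarrow> p z \<in> I" "\<And>z. z \<in> S \<Longrightarrow> q z \<in> I"
  shows "continuous_on S (\<lambda>z. f (p z) (q z))"
proof -
  have "continuous_on S (\<lambda>z. (\<lambda>(x, y). f x y) (p z, q z))"
    by (rule continuous_on_compose2[OF assms(1)]) (use assms in \<open>auto intro!: continuous_intros\<close>)
  then show ?thesis by simp
qed

lemma cont2_1: "cont2 f \<Longrightarrow> x \<in> I \<Longrightarrow> continuous_on I (\<lambda>y. f x y)"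
  by (rule cont2_compose[where p="\<lambda>_. x" and q="\<lambda>y. y"]) (auto intro!: continuous_intros)

lemma cont2_2: "cont2 f \<Longrightarrow> y \<in> I \<Longrightarrow> continuous_on I (\<lambda>x. f x y)"
  by (rule cont2_compose[where q="\<lambda>_. y" and p="\<lambda>y. y"]) (auto intro!: continuous_intros)

lemma cont2_cong: "(\<And>x y. x \<in> I \<Longrightarrow> y \<in> I \<Longrightarrow> f x y = g x y) \<Longrightarrow> cont2 f = cont2 g"
  by (intro continuous_on_cong) auto

lemma cont2_swap: "cont2 f \<Longrightarrow> cont2 (\<lambda>x y. f y x)"
  unfolding case_prod_unfold
    by (rule cont2_compose[where f=f]) (auto intro!: continuous_intros simp: case_prod_unfold)

lemma conv_integrand:
  assumes "cont2 f" "cont2 g"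
  shows "x \<in> I \<Longrightarrow> y \<in> I \<Longrightarrow> continuous_on I (\<lambda>\<tau>. f x \<tau> * g \<tau> y)"
  by (intro continuous_intros cont2_1 cont2_2 assms)

lemma conv_cont:
  assumes "cont2 f" "cont2 g"
  shows "cont2 (conv f g)"
proof -
  let ?S = "(I \<times> I) \<times> cbox 0 (1::real)"
  have m: "fst p \<in> I" "snd p \<in> I" "snd p + s * (fst p - snd p) \<in> I" if "(p, s) \<in> ?S" for p s
    using that seg_mem by auto
  have c: "continuous_on ?S (\<lambda>z. snd (fst z) + snd z * (fst (fst z) - snd (fst z)))"
    by (intro continuous_intros)
  have "continuous_on ?S (\<lambda>z. (fst (fst z) - snd (fst z)) *\<^sub>R
     (f (fst (fst z)) (snd (fst z) + snd z * (fst (fst z) - snd (fst z))) *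
       g (snd (fst z) + snd z * (fst (fst z) - snd (fst z))) (snd (fst z))))"
    by (intro continuous_intros cont2_compose[OF assms(1)] cont2_compose[OF assms(2)]) (use m in auto)
  then have "continuous_on (I \<times> I) (\<lambda>p. integral (cbox 0 1) ((\<lambda>p s. (fst p - snd p) *\<^sub>R
     (f (fst p) (snd p + s * (fst p - snd p)) * g (snd p + s * (fst p - snd p)) (snd p))) p))"
    by (intro integral_continuous_on_param) (simp add: case_prod_unfold)
  then show ?thesis by (simp add: conv_def sint_def case_prod_unfold)
qed

text \<open>The chain rule along the diagonal; continuity of one partial derivative suffices for total
  differentiability, also at the boundary of \<open>I \<times> I\<close>.\<close>

lemma diag_deriv:
  fixes \<Psi> :: "real \<Rightarrow> real \<Rightarrow> complex"
  assumes x: "x \<in> I"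
    and 1: "((\<lambda>z. \<Psi> z x) has_vector_derivative a) (at x within I)"
    and 2: "pd2 I \<Psi> b" and b: "cont2 b"
  shows "((\<lambda>z. \<Psi> z z) has_vector_derivative a + b x x) (at x within I)"
proof -
  have "((\<lambda>(x, y). \<Psi> x y) has_derivative (\<lambda>(tx, ty). tx *\<^sub>R a + blinfun_scaleR_left (b x x) ty)) (at (x, x) within I \<times> I)"
  proof (rule has_derivative_partialsI[where f=\<Psi> and fx="\<lambda>tx. tx *\<^sub>R a" and fy="\<lambda>u v. blinfun_scaleR_left (b u v)"])
    show "((\<lambda>z. \<Psi> z x) has_derivative (\<lambda>tx. tx *\<^sub>R a)) (at x within I)"
      using 1 by (simp add: has_vector_derivative_def)
    show "((\<lambda>z. \<Psi> u z) has_derivative blinfun_apply (blinfun_scaleR_left (b u v))) (at v within I)"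
      if "u \<in> I" "v \<in> I" for u v
      using 2 that by (auto simp: pd2_def has_vector_derivative_def)
    have "continuous (at (x, x) within I \<times> I) (\<lambda>p. b (fst p) (snd p))"
      using b x by (auto simp: continuous_on_eq_continuous_within case_prod_unfold)
    then have "continuous (at (x, x) within I \<times> I) (\<lambda>p. blinfun_scaleR_left (b (fst p) (snd p)))"
      by (intro continuous_intros)
    then show "continuous (at (x, x) within I \<times> I) (\<lambda>(u, v). blinfun_scaleR_left (b u v))"
      by (simp add: case_prod_unfold)
  qed (use x cvx in auto)
  then have d: "((\<lambda>(x, y). \<Psi> x y) has_derivative (\<lambda>(tx, ty). tx *\<^sub>R a + ty *\<^sub>R b x x)) (at (x, x) within I \<times> I)"
    by (simp add: case_prod_unfold)
  have c: "((\<lambda>z. (z, z)) has_derivative (\<lambda>h. (h, h))) (at x within I)"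
    by (auto intro!: derivative_eq_intros)
  have "((\<lambda>(x, y). \<Psi> x y) has_derivative (\<lambda>(tx, ty). tx *\<^sub>R a + ty *\<^sub>R b x x)) (at (x, x) within (\<lambda>z. (z, z)) ` I)"
    by (rule has_derivative_subset[OF d]) auto
  from has_derivative_in_compose[OF c this] show ?thesis by (simp add: has_vector_derivative_def algebra_simps)
qed

lemma pd1_cong:
  assumes "pd1 I f f'" "\<And>x y. x \<in> I \<Longrightarrow> y \<in> I \<Longrightarrow> g x y = f x y" "\<And>x y. x \<in> I \<Longrightarrow> y \<in> I \<Longrightarrow> g' x y = f' x y"
  shows "pd1 I g g'"
  unfolding pd1_def
proof (intro ballI)
  fix x y assume xy: "x \<in> I" "y \<in> I"
  have "((\<lambda>s. f s y) has_vector_derivative f' x y) (at x within I)" using assms(1) xy by (simp add: pd1_def)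
  then have "((\<lambda>s. g s y) has_vector_derivative f' x y) (at x within I)"
    by (rule has_vector_derivative_transform[OF xy(1), rotated]) (use assms(2) xy in auto)
  then show "((\<lambda>s. g s y) has_vector_derivative g' x y) (at x within I)" using assms(3) xy by simp
qed

lemma pd2_iff: "pd2 I f f' \<longleftrightarrow> pd1 I (\<lambda>x y. f y x) (\<lambda>x y. f' y x)"
  by (auto simp: pd1_def pd2_def)

lemma pd2_cong:
  assumes "pd2 I f f'" "\<And>x y. x \<in> I \<Longrightarrow> y \<in> I \<Longrightarrow> g x y = f x y" "\<And>x y. x \<in> I \<Longrightarrow> y \<in> I \<Longrightarrow> g' x y = f' x y"
  shows "pd2 I g g'"
  using assms(1) unfolding pd2_iff by (rule pd1_cong) (use assms(2,3) in auto)

lemma pd1_unique: "pd1 I f f' \<Longrightarrow> pd1 I f f'' \<Longrightarrow> x \<in> I \<Longrightarrow> y \<in> I \<Longrightarrow> f' x y = f'' x y"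
  unfolding pd1_def using vd_unique by blast

lemma pd2_unique: "pd2 I f f' \<Longrightarrow> pd2 I f f'' \<Longrightarrow> x \<in> I \<Longrightarrow> y \<in> I \<Longrightarrow> f' x y = f'' x y"
  unfolding pd2_iff by (rule pd1_unique)

lemma pd1_add: "pd1 I f f' \<Longrightarrow> pd1 I g g' \<Longrightarrow> pd1 I (\<lambda>x y. f x y + g x y) (\<lambda>x y. f' x y + g' x y)"
  unfolding pd1_def by (auto intro!: has_vector_derivative_add)

lemma pd1_mult: "pd1 I f f' \<Longrightarrow> pd1 I g g' \<Longrightarrow> pd1 I (\<lambda>x y. f x y * g x y) (\<lambda>x y. f x y * g' x y + f' x y * g x y)"
  unfolding pd1_def by (auto intro!: has_vector_derivative_mult)

lemma pd2_add: "pd2 I f f' \<Longrightarrow> pd2 I g g' \<Longrightarrow> pd2 I (\<lambda>x y. f x y + g x y) (\<lambda>x y. f' x y + g' x y)"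
  unfolding pd2_iff by (rule pd1_add)

lemma pd2_mult: "pd2 I f f' \<Longrightarrow> pd2 I g g' \<Longrightarrow> pd2 I (\<lambda>x y. f x y * g x y) (\<lambda>x y. f x y * g' x y + f' x y * g x y)"
  unfolding pd2_iff by (rule pd1_mult)

lemma Ck_cont: "Ck I m f \<Longrightarrow> cont2 f" by (cases m) auto

lemma Ck_SucE:
  assumes "Ck I (Suc m) f"
  obtains f1 f2 where "pd1 I f f1" "pd2 I f f2" "Ck I m f1" "Ck I m f2" "cont2 f"
  using assms by auto

lemma Ck_SucD: "Ck I (Suc m) f \<Longrightarrow> Ck I m f"
proof (induction m arbitrary: f)
  case (Suc m)
  obtain f1 f2 where f: "pd1 I f f1" "pd2 I f f2" "Ck I (Suc m) f1" "Ck I (Suc m) f2" "cont2 f"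
    by (rule Ck_SucE[OF Suc.prems])
  have "Ck I m f1" "Ck I m f2" using Suc.IH f by blast+
  then show ?case using f by auto
qed auto

lemma Ck_cong: "Ck I m f \<Longrightarrow> (\<And>x y. x \<in> I \<Longrightarrow> y \<in> I \<Longrightarrow> g x y = f x y) \<Longrightarrow> Ck I m g"
proof (induction m)
  case 0
  then show ?case using cont2_cong[of g f] by simp
next
  case (Suc m)
  from Suc.prems(1) obtain f1 f2 where f: "pd1 I f f1" "pd2 I f f2" "Ck I m f1" "Ck I m f2" "cont2 f" by auto
  have "pd1 I g f1" "pd2 I g f2" using pd1_cong[OF f(1)] pd2_cong[OF f(2)] Suc.prems(2) by auto
  moreover have "cont2 g" using cont2_cong[of g f] Suc.prems(2) f(5) by simp
  ultimately show ?case using f by auto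
qed

lemma Ck_SucI: "pd1 I f f1 \<Longrightarrow> pd2 I f f2 \<Longrightarrow> cont2 f \<Longrightarrow> Ck I m f1 \<Longrightarrow> Ck I m f2 \<Longrightarrow> Ck I (Suc m) f"
  by auto

lemma Ck_swap: "Ck I m f \<Longrightarrow> Ck I m (\<lambda>x y. f y x)"
proof (induction m arbitrary: f)
  case 0
  then show ?case using cont2_swap[of f] by simp
next
  case (Suc m)
  obtain f1 f2 where f: "pd1 I f f1" "pd2 I f f2" "Ck I m f1" "Ck I m f2" "cont2 f"
    using Suc.prems by (elim Ck_SucE)
  show ?case
    by (rule Ck_SucI[of _ "\<lambda>x y. f2 y x" "\<lambda>x y. f1 y x"])
      (use f Suc.IH cont2_swap[of f] in \<open>auto simp: pd1_def pd2_def\<close>)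
qed

lemma Ck_const: "Ck I m (\<lambda>x y. c)"
proof (induction m arbitrary: c)
  case (Suc m)
  show ?case
    by (rule Ck_SucI[of _ "\<lambda>x y. 0" "\<lambda>x y. 0"]) (use Suc in \<open>auto simp: pd1_def pd2_def\<close>)
qed auto

lemma Ck_add: "Ck I m f \<Longrightarrow> Ck I m g \<Longrightarrow> Ck I m (\<lambda>x y. f x y + g x y)"
proof (induction m arbitrary: f g)
  case 0
  then show ?case by (auto simp: case_prod_unfold intro!: continuous_intros)
next
  case (Suc m)
  obtain f1 f2 where f: "pd1 I f f1" "pd2 I f f2" "Ck I m f1" "Ck I m f2" "cont2 f"
    by (rule Ck_SucE[OF Suc.prems(1)])
  obtain g1 g2 where g: "pd1 I g g1" "pd2 I g g2" "Ck I m g1" "Ck I m g2" "cont2 g"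
    by (rule Ck_SucE[OF Suc.prems(2)])
  have "cont2 (\<lambda>x y. f x y + g x y)"
    using f(5) g(5) by (auto simp: case_prod_unfold intro!: continuous_intros)
  then show ?case
    using Ck_SucI[OF pd1_add[OF f(1) g(1)] pd2_add[OF f(2) g(2)]] f g Suc.IH by blast
qed

lemma Ck_mult: "Ck I m f \<Longrightarrow> Ck I m g \<Longrightarrow> Ck I m (\<lambda>x y. f x y * g x y)"
proof (induction m arbitrary: f g)
  case 0
  then show ?case by (auto simp: case_prod_unfold intro!: continuous_intros)
next
  case (Suc m)
  obtain f1 f2 where f: "pd1 I f f1" "pd2 I f f2" "Ck I m f1" "Ck I m f2" "cont2 f"
    by (rule Ck_SucE[OF Suc.prems(1)])
  obtain g1 g2 where g: "pd1 I g g1" "pd2 I g g2" "Ck I m g1" "Ck I m g2" "cont2 g"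
    by (rule Ck_SucE[OF Suc.prems(2)])
  have "cont2 (\<lambda>x y. f x y * g x y)"
    using f(5) g(5) by (auto simp: case_prod_unfold intro!: continuous_intros)
  moreover have "Ck I m f" "Ck I m g" using Suc.prems Ck_SucD by blast+
  ultimately show ?case
    by (intro Ck_SucI[OF pd1_mult[OF f(1) g(1)] pd2_mult[OF f(2) g(2)]] Ck_add Suc.IH f g)
qed

lemma Ck_cmult: "Ck I m f \<Longrightarrow> Ck I m (\<lambda>x y. c * f x y)"
  by (rule Ck_mult[OF Ck_const])

lemma Ck_minus: "Ck I m f \<Longrightarrow> Ck I m (\<lambda>x y. - f x y)"
  using Ck_cmult[of m f "-1"] by simp

lemma Ck_diff: "Ck I m f \<Longrightarrow> Ck I m g \<Longrightarrow> Ck I m (\<lambda>x y. f x y - g x y)"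
  using Ck_add[OF _ Ck_minus] by simp

lemma Ck_sum: "finite K \<Longrightarrow> (\<And>k. k \<in> K \<Longrightarrow> Ck I m (f k)) \<Longrightarrow> Ck I m (\<lambda>x y. \<Sum>k\<in>K. f k x y)"
  by (induction K rule: finite_induct) (auto intro: Ck_const Ck_add)

lemma Ck_diag: "Ck I m f \<Longrightarrow> Ck I m (\<lambda>x y. f x x)"
proof (induction m arbitrary: f)
  case 0
  then have "continuous_on (I \<times> I) (\<lambda>z. f (fst z) (fst z))"
    by (intro cont2_compose[of f]) (auto intro!: continuous_intros)
  then show ?case by (simp add: case_prod_unfold)
next
  case (Suc m)
  obtain f1 f2 where f: "pd1 I f f1" "pd2 I f f2" "Ck I m f1" "Ck I m f2" "cont2 f"
    using Suc.prems by (elim Ck_SucE)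
  have 1: "pd1 I (\<lambda>x y. f x x) (\<lambda>x y. f1 x x + f2 x x)"
    unfolding pd1_def
    using diag_deriv[OF _ _ f(2) Ck_cont[OF f(4)]] f(1) by (auto simp: pd1_def)
  have 2: "pd2 I (\<lambda>x y. f x x) (\<lambda>x y. 0)" by (auto simp: pd2_def)
  have "continuous_on (I \<times> I) (\<lambda>z. f (fst z) (fst z))"
    using f(5) by (intro cont2_compose[of f]) (auto intro!: continuous_intros)
  then have "cont2 (\<lambda>x y. f x x)" by (simp add: case_prod_unfold)
  then show ?case
    by (rule Ck_SucI[OF 1 2]) (use f Suc.IH in \<open>auto intro!: Ck_add Ck_const\<close>)
qed

lemma Ck_diag': "Ck I m f \<Longrightarrow> Ck I m (\<lambda>x y. f y y)"
  using Ck_swap[OF Ck_diag] by simp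

lemma pd1_inverse:
  assumes "pd1 I f f1" "\<And>x y. x \<in> I \<Longrightarrow> y \<in> I \<Longrightarrow> f x y \<noteq> 0"
  shows "pd1 I (\<lambda>x y. inverse (f x y)) (\<lambda>x y. - (inverse (f x y) * f1 x y * inverse (f x y)))"
  unfolding pd1_def
proof (intro ballI)
  fix x y assume xy: "x \<in> I" "y \<in> I"
  then have "((\<lambda>s. f s y) has_derivative (\<lambda>h. h *\<^sub>R f1 x y)) (at x within I)"
    using assms(1) by (auto simp: pd1_def has_vector_derivative_def)
  from Deriv.has_derivative_inverse[OF assms(2)[OF xy] this]
  show "((\<lambda>s. inverse (f s y)) has_vector_derivative - (inverse (f x y) * f1 x y * inverse (f x y))) (at x within I)"
    unfolding has_vector_derivative_def by (simp add: mult.assoc)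
qed

lemma Ck_inverse:
  assumes "Ck I m f" "\<And>x y. x \<in> I \<Longrightarrow> y \<in> I \<Longrightarrow> f x y \<noteq> 0"
  shows "Ck I m (\<lambda>x y. inverse (f x y))"
  using assms
proof (induction m arbitrary: f)
  case 0
  then show ?case by (auto simp: case_prod_unfold intro!: continuous_intros)
next
  case (Suc m)
  obtain f1 f2 where f: "pd1 I f f1" "pd2 I f f2" "Ck I m f1" "Ck I m f2" "cont2 f"
    using Suc.prems by (elim Ck_SucE)
  have c: "cont2 (\<lambda>x y. inverse (f x y))"
    using f(5) Suc.prems(2) by (auto simp: case_prod_unfold intro!: continuous_intros)
  have 1: "pd1 I (\<lambda>x y. inverse (f x y)) (\<lambda>x y. - (inverse (f x y) * f1 x y * inverse (f x y)))"
    by (rule pd1_inverse[OF f(1) Suc.prems(2)])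
  have 2: "pd2 I (\<lambda>x y. inverse (f x y)) (\<lambda>x y. - (inverse (f x y) * f2 x y * inverse (f x y)))"
    using f(2) unfolding pd2_iff by (rule pd1_inverse) (rule Suc.prems(2))
  have "Ck I m (\<lambda>x y. inverse (f x y))" using Suc.IH Suc.prems Ck_SucD by blast
  then show ?case
    by (intro Ck_SucI[OF 1 2 c] Ck_minus Ck_mult f)
qed

section \<open>Volterra composition of kernels\<close>

lemma sint_leibniz:
  assumes "pd1 I m m1" "cont2 m" "cont2 m1" "a \<in> I" "z \<in> I" "x \<in> I"
  shows "((\<lambda>u. sint a z (m u)) has_vector_derivative sint a z (m1 x)) (at x within I)"
proof -
  have mem: "a + s * (z - a) \<in> I" if "s \<in> cbox 0 1" for s using that seg_mem[OF assms(4,5)] by auto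
  have "((\<lambda>u. integral (cbox 0 1) ((\<lambda>u s. (z - a) *\<^sub>R m u (a + s * (z - a))) u)) has_vector_derivative
     integral (cbox 0 1) ((\<lambda>u s. (z - a) *\<^sub>R m1 u (a + s * (z - a))) x)) (at x within I)"
  proof (rule leibniz_rule_vector_derivative)
    show "((\<lambda>u. (z - a) *\<^sub>R m u (a + s * (z - a))) has_vector_derivative (z - a) *\<^sub>R m1 u (a + s * (z - a))) (at u within I)"
      if "u \<in> I" "s \<in> cbox 0 1" for u s
      by (rule has_vector_derivative_scaleR[where f="\<lambda>_. z - a" and f'=0, simplified])
        (use assms(1) that mem in \<open>auto simp: pd1_def\<close>)
    show "(\<lambda>s. (z - a) *\<^sub>R m u (a + s * (z - a))) integrable_on cbox 0 1" if "u \<in> I" for u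
      using sint_integrable[OF cont2_1[OF assms(2) that] assms(4,5)] by simp
    have "continuous_on (I \<times> cbox 0 1) (\<lambda>p. (z - a) *\<^sub>R m1 (fst p) (a + snd p * (z - a)))"
      by (intro continuous_intros cont2_compose[OF assms(3)]) (use mem in auto)
    then show "continuous_on (I \<times> cbox 0 1) (\<lambda>(u, s). (z - a) *\<^sub>R m1 u (a + s * (z - a)))"
      by (simp add: case_prod_unfold)
  qed (use assms cvx in auto)
  then show ?thesis by (simp add: sint_def)
qed

text \<open>The first variable enters as the upper limit and as a parameter of the integrand; separating the two
  and applying the chain rule along the diagonal gives Leibniz' rule.\<close>

lemma conv_pd1:
  assumes f: "cont2 f" "pd1 I f f1" "cont2 f1" and g: "cont2 g"
  shows "pd1 I (conv f g) (\<lambda>x y. f x x * g x y + conv f1 g x y)"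
  unfolding pd1_def
proof (intro ballI)
  fix x y assume xy: "x \<in> I" "y \<in> I"
  define \<Psi> where "\<Psi> = (\<lambda>u z. sint y z (\<lambda>\<tau>. f u \<tau> * g \<tau> y))"
  have c: "cont2 (\<lambda>u \<tau>. f u \<tau> * g \<tau> y)" if "cont2 f" for f
    unfolding case_prod_unfold
    by (intro continuous_intros cont2_compose[OF that] cont2_compose[OF g]) (use xy in auto)
  have "((\<lambda>u. \<Psi> u x) has_vector_derivative conv f1 g x y) (at x within I)"
    unfolding \<Psi>_def conv_def
    by (rule sint_leibniz) (use f xy c in \<open>auto simp: pd1_def intro!: derivative_eq_intros\<close>)
  moreover have "pd2 I \<Psi> (\<lambda>u z. f u z * g z y)"
    unfolding \<Psi>_def pd2_def
    by (intro ballI sint_deriv cont2_1[OF c[OF f(1)]]) (use xy in auto)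
  ultimately have "((\<lambda>z. \<Psi> z z) has_vector_derivative conv f1 g x y + f x x * g x y) (at x within I)"
    by (intro diag_deriv[where b="\<lambda>u z. f u z * g z y"] c f xy)
  then show "((\<lambda>s. conv f g s y) has_vector_derivative f x x * g x y + conv f1 g x y) (at x within I)"
    unfolding \<Psi>_def conv_def by (simp add: add.commute)
qed

text \<open>Exchanging the two time variables reverses products; with it every fact on one variable of a product
  yields the corresponding fact on the other.\<close>

lemma conv_swap:
  assumes "cont2 f" "cont2 g" "x \<in> I" "y \<in> I"
  shows "conv f g x y = - conv (\<lambda>x y. g y x) (\<lambda>x y. f y x) y x"
proof -
  have "continuous_on I (\<lambda>\<tau>. f x \<tau> * g \<tau> y)" by (rule conv_integrand) (use assms in auto)
  from sint_swap[OF assms(3,4) this] show ?thesis by (simp add: conv_def mult.commute)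
qed

lemma pd1_minus: "pd1 I f f' \<Longrightarrow> pd1 I (\<lambda>x y. - f x y) (\<lambda>x y. - f' x y)"
  unfolding pd1_def by (auto intro!: has_vector_derivative_minus)

lemma conv_pd2:
  assumes g: "cont2 g" "pd2 I g g2" "cont2 g2" and f: "cont2 f"
  shows "pd2 I (conv f g) (\<lambda>x y. conv f g2 x y - f x y * g y y)"
proof -
  have "pd1 I (conv (\<lambda>x y. g y x) (\<lambda>x y. f y x)) (\<lambda>x y. g x x * f y x + conv (\<lambda>x y. g2 y x) (\<lambda>x y. f y x) x y)"
    by (rule conv_pd1) (use g f cont2_swap in \<open>auto simp: pd2_iff\<close>)
  then have "pd1 I (\<lambda>x y. - conv (\<lambda>x y. g y x) (\<lambda>x y. f y x) x y) (\<lambda>x y. - (g x x * f y x + conv (\<lambda>x y. g2 y x) (\<lambda>x y. f y x) x y))"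
    by (rule pd1_minus)
  then show ?thesis unfolding pd2_iff
    by (rule pd1_cong) (use conv_swap[OF f g(1)] conv_swap[OF f g(3)] in auto)
qed

lemma Ck_conv: "Ck I m f \<Longrightarrow> Ck I m g \<Longrightarrow> Ck I m (conv f g)"
proof (induction m arbitrary: f g)
  case 0
  then show ?case using conv_cont by simp
next
  case (Suc m)
  obtain f1 f2 where f: "pd1 I f f1" "pd2 I f f2" "Ck I m f1" "Ck I m f2" "cont2 f"
    by (rule Ck_SucE[OF Suc.prems(1)])
  obtain g1 g2 where g: "pd1 I g g1" "pd2 I g g2" "Ck I m g1" "Ck I m g2" "cont2 g"
    by (rule Ck_SucE[OF Suc.prems(2)])
  have m: "Ck I m f" "Ck I m g" using Suc.prems Ck_SucD by blast+
  show ?case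
    by (intro Ck_SucI[OF conv_pd1[OF f(5,1) Ck_cont[OF f(3)] g(5)] conv_pd2[OF g(5,2) Ck_cont[OF g(4)] f(5)]]
       conv_cont Ck_add Ck_diff Ck_mult Ck_diag[OF m(1)] Ck_diag'[OF m(2)] Suc.IH f g m)
qed

section \<open>Symmetry of mixed derivatives\<close>

text \<open>The difference \<open>g u z - g u x\<close> is the integral of \<open>g\<^sub>2 u\<close> from \<open>x\<close> to \<open>z\<close>.  Its derivative in \<open>u\<close> is, on the one hand,
  the integral of \<open>g\<^sub>2\<^sub>1\<close> and, on the other hand, an increment of \<open>g\<^sub>1\<close>, that is, the integral of
  \<open>g\<^sub>1\<^sub>2\<close>; differentiation in \<open>z\<close> compares the integrands.\<close>

lemma schwarz:
  assumes g: "pd1 I g g1" "pd2 I g g2" "pd2 I g1 g12" "pd1 I g2 g21"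
    and c: "cont2 g2" "cont2 g12" "cont2 g21" and xy: "x \<in> I" "y \<in> I"
  shows "g12 x y = g21 x y"
proof -
  have eq: "sint x z (g12 x) = sint x z (g21 x)" if z: "z \<in> I" for z
  proof -
    have "sint x z (g12 x) = g1 x z - g1 x x"
      by (rule sint_FTC[OF ivl]) (use g(3) xy z in \<open>auto simp: pd2_def\<close>)
    moreover have "((\<lambda>u. g u z - g u x) has_vector_derivative g1 x z - g1 x x) (at x within I)"
      by (intro has_vector_derivative_diff) (use g(1) xy z in \<open>auto simp: pd1_def\<close>)
    moreover have "((\<lambda>u. g u z - g u x) has_vector_derivative sint x z (g21 x)) (at x within I)"
    proof (rule has_vector_derivative_transform[OF xy(1)])
      show "((\<lambda>u. sint x z (g2 u)) has_vector_derivative sint x z (g21 x)) (at x within I)"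
        by (rule sint_leibniz) (use g c xy z in auto)
      show "g u z - g u x = sint x z (g2 u)" if "u \<in> I" for u
        by (rule sint_FTC[OF ivl, symmetric]) (use g(2) xy z that in \<open>auto simp: pd2_def\<close>)
    qed
    ultimately show ?thesis using vd_unique[OF xy(1)] by metis
  qed
  have "((\<lambda>z. sint x z (g12 x)) has_vector_derivative g12 x y) (at y within I)"
    by (rule sint_deriv[OF cont2_1[OF c(2)]]) (use xy in auto)
  moreover have "((\<lambda>z. sint x z (g12 x)) has_vector_derivative g21 x y) (at y within I)"
  proof (rule has_vector_derivative_transform[OF xy(2) eq])
    show "((\<lambda>z. sint x z (g21 x)) has_vector_derivative g21 x y) (at y within I)"
      by (rule sint_deriv[OF cont2_1[OF c(3)]]) (use xy in auto)
  qed
  ultimately show ?thesis using vd_unique[OF xy(2)] by blast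
qed

lemma Ck_all_partials:
  assumes "\<forall>m. Ck I m f"
  shows "\<exists>f1 f2. pd1 I f f1 \<and> pd2 I f f2 \<and> (\<forall>m. Ck I m f1) \<and> (\<forall>m. Ck I m f2)"
proof -
  have "Ck I (Suc 0) f" using assms by blast
  then obtain f1 f2 where f: "pd1 I f f1" "pd2 I f f2" by auto
  have "Ck I m f1 \<and> Ck I m f2" for m
  proof -
    have "Ck I (Suc m) f" using assms by blast
    then obtain g1 g2 where g: "pd1 I f g1" "pd2 I f g2" "Ck I m g1" "Ck I m g2" by auto
    then show ?thesis
      using Ck_cong[OF g(3) pd1_unique[OF f(1) g(1)]] Ck_cong[OF g(4) pd2_unique[OF f(2) g(2)]] by simp
  qed
  then show ?thesis using f by blast
qed

text \<open>A doubly indexed family of derivatives is obtained by applying chosen partial derivatives repeatedly;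
  that it is consistent in the second variable is the symmetry of mixed derivatives.\<close>

lemma smooth2_iff: "smooth2 I f \<longleftrightarrow> (\<forall>m. Ck I m f)"
proof
  assume "smooth2 I f"
  then obtain F where F0: "(\<forall>x\<in>I. \<forall>y\<in>I. F 0 0 x y = f x y) \<and>
     (\<forall>i j. continuous_on (I \<times> I) (\<lambda>(x, y). F i j x y)) \<and>
     (\<forall>i j. \<forall>x\<in>I. \<forall>y\<in>I.
        ((\<lambda>s. F i j s y) has_vector_derivative F (Suc i) j x y) (at x within I) \<and>
        ((\<lambda>s. F i j x s) has_vector_derivative F i (Suc j) x y) (at y within I))"
    unfolding smooth2_def by (rule exE)
  then have F: "pd1 I (F i j) (F (Suc i) j)" "pd2 I (F i j) (F i (Suc j))" "cont2 (F i j)" for i j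
    unfolding pd1_def pd2_def by blast+
  have "Ck I m (F i j)" for m i j
  proof (induction m arbitrary: i j)
    case 0
    then show ?case using F by simp
  next
    case (Suc m)
    show ?case by (rule Ck_SucI[OF F Suc Suc])
  qed
  then show "\<forall>m. Ck I m f" using Ck_cong F0 by metis
next
  assume f: "\<forall>m. Ck I m f"
  define P where "P = (\<lambda>f. \<forall>m. Ck I m f)"
  have "\<forall>f. \<exists>f1 f2. P f \<longrightarrow> pd1 I f f1 \<and> pd2 I f f2 \<and> P f1 \<and> P f2"
    using Ck_all_partials unfolding P_def by blast
  then obtain d1 d2 where d: "\<And>f. P f \<Longrightarrow> pd1 I f (d1 f)" "\<And>f. P f \<Longrightarrow> pd2 I f (d2 f)"
    "\<And>f. P f \<Longrightarrow> P (d1 f)" "\<And>f. P f \<Longrightarrow> P (d2 f)" by metis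
  have Pc: "cont2 f" if "P f" for f using that Ck_cont unfolding P_def by blast
  define F where "F = (\<lambda>i j. (d1 ^^ i) ((d2 ^^ j) f))"
  have P0: "P ((d2 ^^ j) f)" for j by (induction j) (use f d in \<open>auto simp: P_def\<close>)
  have PF: "P (F i j)" for i j unfolding F_def by (induction i) (use P0 d in auto)
  have F1: "pd1 I (F i j) (F (Suc i) j)" for i j using d(1)[OF PF[of i j]] by (simp add: F_def)
  have F2: "pd2 I (F i j) (F i (Suc j))" for i j
  proof (induction i)
    case 0
    then show ?case using d(2)[OF P0[of j]] by (simp add: F_def)
  next
    case (Suc i)
    have a: "pd2 I (F (Suc i) j) (d2 (F (Suc i) j))" by (rule d(2)[OF PF])
    have b: "d2 (F (Suc i) j) x y = F (Suc i) (Suc j) x y" if "x \<in> I" "y \<in> I" for x y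
      by (rule schwarz[OF F1 Suc d(2)[OF PF] F1 Pc[OF PF] Pc[OF d(4)[OF PF]] Pc[OF PF] that])
    show ?case by (rule pd2_cong[OF a refl b[symmetric]])
  qed
  have 1: "\<forall>x\<in>I. \<forall>y\<in>I. F 0 0 x y = f x y" by (simp add: F_def)
  have 2: "\<forall>i j. continuous_on (I \<times> I) (\<lambda>(x, y). F i j x y)" using Pc PF by blast
  have 3: "\<forall>i j. \<forall>x\<in>I. \<forall>y\<in>I.
        ((\<lambda>s. F i j s y) has_vector_derivative F (Suc i) j x y) (at x within I) \<and>
        ((\<lambda>s. F i j x s) has_vector_derivative F i (Suc j) x y) (at y within I)"
    using F1 F2 unfolding pd1_def pd2_def by blast
  show "smooth2 I f" unfolding smooth2_def
    by (rule exI[of _ F]) (intro conjI 1 2 3)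
qed

lemma smooth2_cont: "smooth2 I f \<Longrightarrow> cont2 f"
  using Ck_cont smooth2_iff by blast

lemma smooth2_partials:
  assumes "smooth2 I f"
  obtains f1 f2 where "pd1 I f f1" "pd2 I f f2" "smooth2 I f1" "smooth2 I f2"
  using Ck_all_partials[of f] assms unfolding smooth2_iff by blast

lemma smooth2_const: "smooth2 I (\<lambda>x y. c)" by (simp add: smooth2_iff Ck_const)
lemma smooth2_add: "smooth2 I f \<Longrightarrow> smooth2 I g \<Longrightarrow> smooth2 I (\<lambda>x y. f x y + g x y)"
  by (simp add: smooth2_iff Ck_add)
lemma smooth2_mult: "smooth2 I f \<Longrightarrow> smooth2 I g \<Longrightarrow> smooth2 I (\<lambda>x y. f x y * g x y)"
  by (simp add: smooth2_iff Ck_mult)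
lemma smooth2_minus: "smooth2 I f \<Longrightarrow> smooth2 I (\<lambda>x y. - f x y)"
  by (simp add: smooth2_iff Ck_minus)
lemma smooth2_sum: "finite K \<Longrightarrow> (\<And>k. k \<in> K \<Longrightarrow> smooth2 I (f k)) \<Longrightarrow> smooth2 I (\<lambda>x y. \<Sum>k\<in>K. f k x y)"
  by (simp add: smooth2_iff Ck_sum)
lemma smooth2_swap: "smooth2 I f \<Longrightarrow> smooth2 I (\<lambda>x y. f y x)"
  by (simp add: smooth2_iff Ck_swap)
lemma smooth2_diag: "smooth2 I f \<Longrightarrow> smooth2 I (\<lambda>x y. f x x)"
  by (simp add: smooth2_iff Ck_diag)
lemma smooth2_conv: "smooth2 I f \<Longrightarrow> smooth2 I g \<Longrightarrow> smooth2 I (conv f g)"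
  by (simp add: smooth2_iff Ck_conv)
lemma smooth2_inverse: "smooth2 I f \<Longrightarrow> (\<And>x y. x \<in> I \<Longrightarrow> y \<in> I \<Longrightarrow> f x y \<noteq> 0) \<Longrightarrow> smooth2 I (\<lambda>x y. inverse (f x y))"
  by (simp add: smooth2_iff Ck_inverse)
lemma smooth2_cong: "smooth2 I f \<Longrightarrow> (\<And>x y. x \<in> I \<Longrightarrow> y \<in> I \<Longrightarrow> g x y = f x y) \<Longrightarrow> smooth2 I g"
  using Ck_cong unfolding smooth2_iff by blast

lemma smooth1_smooth2:
  assumes "smooth1 I g" shows "smooth2 I (\<lambda>x y. g x)"
proof -
  obtain G where G: "\<forall>t\<in>I. G 0 t = g t" "\<And>k t. t \<in> I \<Longrightarrow> (G k has_vector_derivative G (Suc k) t) (at t within I)"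
    using assms unfolding smooth1_def by blast
  have c: "continuous_on I (G k)" for k
    unfolding continuous_on_eq_continuous_within using G(2) has_vector_derivative_continuous by blast
  have "Ck I m (\<lambda>x y. G k x)" for m k
  proof (induction m arbitrary: k)
    case 0
    have "continuous_on (I \<times> I) (\<lambda>z. G k (fst z))"
      by (rule continuous_on_compose2[OF c]) (auto intro!: continuous_intros)
    then show ?case by (simp add: case_prod_unfold)
  next
    case (Suc m)
    have "continuous_on (I \<times> I) (\<lambda>z. G k (fst z))"
      by (rule continuous_on_compose2[OF c]) (auto intro!: continuous_intros)
    then show ?case
      by (intro Ck_SucI[of _ "\<lambda>x y. G (Suc k) x" "\<lambda>x y. 0"] Suc Ck_const)
        (auto simp: pd1_def pd2_def G case_prod_unfold)
  qed
  then have "smooth2 I (\<lambda>x y. G 0 x)" by (simp add: smooth2_iff)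
  then show ?thesis by (rule smooth2_cong) (use G in auto)
qed

lemma smooth2_smooth1:
  assumes "smooth2 I f" "y \<in> I" shows "smooth1 I (\<lambda>x. f x y)"
proof -
  obtain F where F0: "(\<forall>x\<in>I. \<forall>y\<in>I. F 0 0 x y = f x y) \<and>
     (\<forall>i j. continuous_on (I \<times> I) (\<lambda>(x, y). F i j x y)) \<and>
     (\<forall>i j. \<forall>x\<in>I. \<forall>y\<in>I.
        ((\<lambda>s. F i j s y) has_vector_derivative F (Suc i) j x y) (at x within I) \<and>
        ((\<lambda>s. F i j x s) has_vector_derivative F i (Suc j) x y) (at y within I))"
    using assms(1) unfolding smooth2_def by (rule exE)
  show ?thesis unfolding smooth1_def
    by (rule exI[of _ "\<lambda>k x. F k 0 x y"]) (use F0 assms(2) in auto)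
qed

end

text \<open>Partial derivatives as functions of the kernel, one-sided at the end points of \<open>I\<close>.\<close>

definition dx :: "real set \<Rightarrow> (real \<Rightarrow> real \<Rightarrow> complex) \<Rightarrow> real \<Rightarrow> real \<Rightarrow> complex" where
  "dx I f x y = vector_derivative (\<lambda>s. f s y) (at x within I)"

definition dy :: "real set \<Rightarrow> (real \<Rightarrow> real \<Rightarrow> complex) \<Rightarrow> real \<Rightarrow> real \<Rightarrow> complex" where
  "dy I f x y = vector_derivative (\<lambda>s. f x s) (at y within I)"

definition mconv :: "'k set \<Rightarrow> ('k \<Rightarrow> 'k \<Rightarrow> real \<Rightarrow> real \<Rightarrow> complex) \<Rightarrow> ('k \<Rightarrow> 'k \<Rightarrow> real \<Rightarrow> real \<Rightarrow> complex)
    \<Rightarrow> 'k \<Rightarrow> 'k \<Rightarrow> real \<Rightarrow> real \<Rightarrow> complex" where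
  "mconv K k l i j x y = (\<Sum>p\<in>K. conv (k i p) (l p j) x y)"

text \<open>The terms \<open>k, k * k, k * k * k, \<dots>\<close> of the Neumann series of a matrix of Volterra kernels.\<close>

primrec neumann :: "'k set \<Rightarrow> ('k \<Rightarrow> 'k \<Rightarrow> real \<Rightarrow> real \<Rightarrow> complex) \<Rightarrow> nat \<Rightarrow> 'k \<Rightarrow> 'k \<Rightarrow> real \<Rightarrow> real \<Rightarrow> complex" where
  "neumann K k 0 = k"
| "neumann K k (Suc m) = mconv K k (neumann K k m)"

context time_interval
begin

lemma smooth2_dx: assumes "smooth2 I f" shows "pd1 I f (dx I f)" "smooth2 I (dx I f)"
proof -
  obtain f1 f2 where f: "pd1 I f f1" "smooth2 I f1" using smooth2_partials[OF assms] by metis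
  have eq: "dx I f x y = f1 x y" if "x \<in> I" "y \<in> I" for x y
    unfolding dx_def
    by (rule vector_derivative_within[OF at_I_nontrivial[OF that(1)]]) (use f(1) that in \<open>auto simp: pd1_def\<close>)
  show "pd1 I f (dx I f)" using pd1_cong[OF f(1) refl eq] .
  show "smooth2 I (dx I f)" using smooth2_cong[OF f(2) eq] .
qed

lemma smooth2_dy: assumes "smooth2 I f" shows "pd2 I f (dy I f)" "smooth2 I (dy I f)"
proof -
  have "dy I f = (\<lambda>x y. dx I (\<lambda>x y. f y x) y x)" by (simp add: dx_def dy_def fun_eq_iff)
  moreover note smooth2_dx[OF smooth2_swap[OF assms]]
  ultimately show "pd2 I f (dy I f)" "smooth2 I (dy I f)"
    using smooth2_swap[of "dx I (\<lambda>x y. f y x)"] by (simp_all add: pd2_iff)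
qed

lemma conv_cong:
  assumes "\<And>x y. x \<in> I \<Longrightarrow> y \<in> I \<Longrightarrow> f x y = f' x y" "\<And>x y. x \<in> I \<Longrightarrow> y \<in> I \<Longrightarrow> g x y = g' x y"
    "x \<in> I" "y \<in> I"
  shows "conv f g x y = conv f' g' x y"
  unfolding conv_def by (rule sint_cong) (use assms in auto)

lemma conv_add_right:
  assumes "cont2 f" "cont2 g" "cont2 h" "x \<in> I" "y \<in> I"
  shows "conv f (\<lambda>x y. g x y + h x y) x y = conv f g x y + conv f h x y"
  unfolding conv_def distrib_left by (intro sint_add conv_integrand assms)

lemma conv_add_left:
  assumes "cont2 f" "cont2 g" "cont2 h" "x \<in> I" "y \<in> I"
  shows "conv (\<lambda>x y. f x y + g x y) h x y = conv f h x y + conv g h x y"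
  unfolding conv_def distrib_right by (intro sint_add conv_integrand assms)

lemma conv_mult_left: "conv (\<lambda>x y. a x * f x y) g x y = a x * conv f g x y"
  unfolding conv_def sint_mult[symmetric] by (simp add: mult.assoc)

lemma conv_mult_right: "conv f (\<lambda>x y. g x y * a y) x y = conv f g x y * a y"
  unfolding conv_def mult.commute[of _ "a y"] sint_mult[symmetric] by (simp add: mult_ac)

lemma conv_0_left [simp]: "conv (\<lambda>x y. 0) g x y = 0" by (simp add: conv_def sint_def)
lemma conv_0_right [simp]: "conv f (\<lambda>x y. 0) x y = 0" by (simp add: conv_def sint_def)
lemma conv_refl [simp]: "conv f g x x = 0" by (simp add: conv_def)

lemma cont2_sum: "finite K \<Longrightarrow> (\<And>k. k \<in> K \<Longrightarrow> cont2 (f k)) \<Longrightarrow> cont2 (\<lambda>x y. \<Sum>k\<in>K. f k x y)"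
  using Ck_sum[of K 0 f] by simp

lemma cont2_add: "cont2 f \<Longrightarrow> cont2 g \<Longrightarrow> cont2 (\<lambda>x y. f x y + g x y)"
  using Ck_add[of 0 f g] by simp

lemma cont2_mult: "cont2 f \<Longrightarrow> cont2 g \<Longrightarrow> cont2 (\<lambda>x y. f x y * g x y)"
  using Ck_mult[of 0 f g] by simp

lemma conv_sum_right:
  assumes "finite K" "cont2 f" "\<And>k. k \<in> K \<Longrightarrow> cont2 (g k)" "x \<in> I" "y \<in> I"
  shows "conv f (\<lambda>x y. \<Sum>k\<in>K. g k x y) x y = (\<Sum>k\<in>K. conv f (g k) x y)"
  using assms(1,3)
proof (induction K rule: finite_induct)
  case (insert k K)
  have "cont2 (\<lambda>x y. \<Sum>k\<in>K. g k x y)" using insert by (intro cont2_sum) auto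
  then show ?case using insert assms conv_add_right[of f "g k"] by simp
qed simp

lemma conv_sum_left:
  assumes "finite K" "cont2 f" "\<And>k. k \<in> K \<Longrightarrow> cont2 (g k)" "x \<in> I" "y \<in> I"
  shows "conv (\<lambda>x y. \<Sum>k\<in>K. g k x y) f x y = (\<Sum>k\<in>K. conv (g k) f x y)"
  using assms(1,3)
proof (induction K rule: finite_induct)
  case (insert k K)
  have "cont2 (\<lambda>x y. \<Sum>k\<in>K. g k x y)" using insert by (intro cont2_sum) auto
  then show ?case using insert assms conv_add_left[of "g k" _ f] by simp
qed simp

text \<open>With the first argument of \<open>f\<close> frozen at \<open>x\<close>, both sides have the same derivative in the upper limit
  and vanish on the diagonal.  This replaces the exchange of integrals over a triangle.\<close>

lemma conv_assoc:
  assumes f: "cont2 f" and g: "cont2 g" and h: "cont2 h" and xy: "x \<in> I" "y \<in> I"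
  shows "conv f (conv g h) x y = conv (conv f g) h x y"
proof -
  define \<phi> where "\<phi> = (\<lambda>(z::real) s. f x s)"
  have \<phi>: "cont2 \<phi>" unfolding \<phi>_def case_prod_unfold
    by (intro cont2_compose[OF f] continuous_intros) (use xy in auto)
  have \<phi>1: "pd1 I \<phi> (\<lambda>z s. 0)" by (auto simp: \<phi>_def pd1_def)
  have z: "cont2 (\<lambda>z s. 0)" by simp
  have gh: "cont2 (conv g h)" by (rule conv_cont[OF g h])
  have \<phi>g: "cont2 (conv \<phi> g)" by (rule conv_cont[OF \<phi> g])
  have d1: "pd1 I (conv \<phi> (conv g h)) (\<lambda>z y. f x z * conv g h z y)"
    using conv_pd1[OF \<phi> \<phi>1 z gh] by (simp add: \<phi>_def)
  have d2: "pd1 I (conv \<phi> g) (\<lambda>z t. f x z * g z t)"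
    using conv_pd1[OF \<phi> \<phi>1 z g] by (simp add: \<phi>_def)
  have "cont2 (\<lambda>z t. f x z)" unfolding case_prod_unfold
    by (intro cont2_compose[OF f] continuous_intros) (use xy in auto)
  then have c: "cont2 (\<lambda>z t. f x z * g z t)" using g by (rule cont2_mult)
  have d3: "pd1 I (conv (conv \<phi> g) h) (\<lambda>z y. f x z * conv g h z y)"
    using conv_pd1[OF \<phi>g d2 c h] by (simp add: conv_mult_left)
  have "conv \<phi> (conv g h) x y = conv (conv \<phi> g) h x y"
    by (rule eq_by_deriv[where a=y and d="\<lambda>z. f x z * conv g h z y"])
      (use d1 d3 xy in \<open>auto simp: pd1_def\<close>)
  then show ?thesis by (simp add: conv_def \<phi>_def)
qed

section \<open>Resolvents of Volterra kernels\<close>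

lemma integral_pow: "((\<lambda>s. s ^ m) has_integral 1 / real (Suc m)) {0..1::real}"
proof -
  have "((\<lambda>s. s ^ m) has_integral 1 ^ Suc m / real (Suc m) - 0 ^ Suc m / real (Suc m)) {0..1}"
  proof (rule fundamental_theorem_of_calculus)
    show "((\<lambda>s. s ^ Suc m / real (Suc m)) has_vector_derivative s ^ m) (at s within {0..1})" for s :: real
      unfolding has_real_derivative_iff_has_vector_derivative[symmetric]
      by (rule derivative_eq_intros refl | simp)+
  qed simp
  then show ?thesis by simp
qed

text \<open>Composition raises the order of vanishing at the diagonal by one and gains the factor \<open>1/(m+1)\<close>; iterated,
  this produces the factorials that make the Neumann series converge.\<close>

lemma conv_bound:
  assumes f: "cont2 f" and g: "cont2 g" and S: "{c..d} \<subseteq> I" "x \<in> {c..d}" "y \<in> {c..d}"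
    and M: "0 \<le> M" "\<And>\<tau>. \<tau> \<in> {c..d} \<Longrightarrow> norm (f x \<tau>) \<le> M"
    and B: "\<And>\<tau>. \<tau> \<in> {c..d} \<Longrightarrow> norm (g \<tau> y) \<le> B * \<bar>\<tau> - y\<bar> ^ m"
  shows "norm (conv f g x y) \<le> M * B * \<bar>x - y\<bar> ^ Suc m / real (Suc m)"
proof -
  let ?g = "\<lambda>s. (M * B * \<bar>x - y\<bar> ^ Suc m) * s ^ m"
  have mem: "y + s * (x - y) \<in> {c..d}" if "s \<in> {0..1}" for s
  proof -
    have "(1 - s) *\<^sub>R y + s *\<^sub>R x \<in> {c..d}" using convex_real_interval(5)[of c d] S that
      by (auto simp: convex_alt)
    then show ?thesis by (simp add: algebra_simps)
  qed
  have gi: "(?g has_integral (M * B * \<bar>x - y\<bar> ^ Suc m) * (1 / real (Suc m))) {0..1}"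
    by (rule has_integral_mult_right[OF integral_pow])
  have "norm (conv f g x y) \<le> integral {0..1} ?g"
    unfolding conv_def sint_def
  proof (rule integral_norm_bound_integral)
    show "(\<lambda>s. (x - y) *\<^sub>R (f x (y + s * (x - y)) * g (y + s * (x - y)) y)) integrable_on {0..1}"
      by (rule sint_integrable[OF conv_integrand[OF f g]]) (use S in auto)
    show "?g integrable_on {0..1}" using gi by blast
    fix s :: real assume s: "s \<in> {0..1}"
    let ?p = "y + s * (x - y)"
    have "norm (f x ?p * g ?p y) \<le> M * (B * \<bar>?p - y\<bar> ^ m)"
      unfolding norm_mult by (intro mult_mono M B mem[OF s]) auto
    then have "norm (f x ?p * g ?p y) \<le> M * B * (s ^ m * \<bar>x - y\<bar> ^ m)"
      using s by (simp add: abs_mult power_mult_distrib)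
    then have "\<bar>x - y\<bar> * norm (f x ?p * g ?p y) \<le> \<bar>x - y\<bar> * (M * B * (s ^ m * \<bar>x - y\<bar> ^ m))"
      by (rule mult_left_mono) simp
    then show "norm ((x - y) *\<^sub>R (f x ?p * g ?p y)) \<le> ?g s" by (simp add: mult_ac)
  qed
  also have "integral {0..1} ?g = M * B * \<bar>x - y\<bar> ^ Suc m / real (Suc m)"
    unfolding integral_unique[OF gi] by simp
  finally show ?thesis .
qed

text \<open>Limits that are uniform only on compact squares are thereby continuous on all of \<open>I \<times> I\<close>.\<close>

lemma cont2_local:
  assumes "\<And>c d. {c..d} \<subseteq> I \<Longrightarrow> continuous_on ({c..d} \<times> {c..d}) (\<lambda>(x, y). f x y)"
  shows "cont2 f"
  unfolding continuous_on_eq_continuous_within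
proof
  fix p assume p: "p \<in> I \<times> I"
  obtain x y where xy: "p = (x, y)" "x \<in> I" "y \<in> I" using p by auto
  obtain c d where cd: "{c..d} \<subseteq> I" "x \<in> {c..d}" "y \<in> {c..d}"
    "\<exists>e>0. \<forall>z\<in>I. dist z x < e \<longrightarrow> z \<in> {c..d}"
    by (rule compact_nhd[OF xy(2,3,3)])
  obtain c' d' where cd': "{c'..d'} \<subseteq> I" "y \<in> {c'..d'}"
    "c \<in> {c'..d'}" "d \<in> {c'..d'}"
    "\<exists>e>0. \<forall>z\<in>I. dist z y < e \<longrightarrow> z \<in> {c'..d'}"
    by (rule compact_nhd[OF xy(3), of c d]) (use cd in auto)
  obtain e1 e2 where e: "e1 > 0" "e2 > 0" "\<And>z. z \<in> I \<Longrightarrow> dist z x < e1 \<Longrightarrow> z \<in> {c..d}"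
    "\<And>z. z \<in> I \<Longrightarrow> dist z y < e2 \<Longrightarrow> z \<in> {c'..d'}" using cd(4) cd'(5) by blast
  have sub: "{c..d} \<subseteq> {c'..d'}" using cd'(3,4) by auto
  have "at p within ({c'..d'} \<times> {c'..d'}) = at p within (I \<times> I)"
  proof (rule at_within_nhd[where S="ball p (min e1 e2)"])
    show "{c'..d'} \<times> {c'..d'} \<inter> ball p (min e1 e2) - {p} = I \<times> I \<inter> ball p (min e1 e2) - {p}"
    proof -
      have "a \<in> {c'..d'} \<and> b \<in> {c'..d'}" if "a \<in> I" "b \<in> I" "dist (a, b) p < min e1 e2" for a b
      proof -
        have "dist a x \<le> dist (a, b) p" "dist b y \<le> dist (a, b) p"
          using dist_fst_le[of "(a, b)" p] dist_snd_le[of "(a, b)" p] xy by auto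
        then show ?thesis using e(3)[OF that(1)] e(4)[OF that(2)] that(3) sub by auto
      qed
      then show ?thesis using cd'(1) by (auto simp: dist_commute)
    qed
  qed (use e in auto)
  moreover have "continuous (at p within ({c'..d'} \<times> {c'..d'})) (\<lambda>(x, y). f x y)"
    using assms[OF cd'(1)] cd(2) cd'(2) sub xy(1) unfolding continuous_on_eq_continuous_within by blast
  ultimately show "continuous (at p within (I \<times> I)) (\<lambda>(x, y). f x y)" by simp
qed

lemma cont2_bounded:
  assumes "finite K" "\<And>i j. i \<in> K \<Longrightarrow> j \<in> K \<Longrightarrow> cont2 (k i j)" "{c..d} \<subseteq> I"
  obtains M where "0 \<le> M" "\<And>i j x y. i \<in> K \<Longrightarrow> j \<in> K \<Longrightarrow> x \<in> {c..d} \<Longrightarrow> y \<in> {c..d} \<Longrightarrow> norm (k i j x y) \<le> M"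
proof -
  have "\<exists>M. \<forall>z\<in>{c..d} \<times> {c..d}. norm (k i j (fst z) (snd z)) \<le> M" if "i \<in> K" "j \<in> K" for i j
  proof -
    have "compact ((\<lambda>z. k i j (fst z) (snd z)) ` ({c..d} \<times> {c..d}))"
      by (intro compact_continuous_image compact_Times compact_Icc cont2_compose[OF assms(2)[OF that]] continuous_intros)
        (use assms(3) in auto)
    then show ?thesis using compact_imp_bounded bounded_iff by (metis (no_types, lifting) image_eqI)
  qed
  then obtain M where M: "\<And>i j z. i \<in> K \<Longrightarrow> j \<in> K \<Longrightarrow> z \<in> {c..d} \<times> {c..d} \<Longrightarrow> norm (k i j (fst z) (snd z)) \<le> M i j"
    by metis
  define M' where "M' = (\<Sum>i\<in>K. \<Sum>j\<in>K. \<bar>M i j\<bar>)"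
  have "norm (k i j x y) \<le> M'" if "i \<in> K" "j \<in> K" "x \<in> {c..d}" "y \<in> {c..d}" for i j x y
  proof -
    have "norm (k i j x y) \<le> \<bar>M i j\<bar>" using M[of i j "(x, y)"] that by auto
    also have "\<dots> \<le> (\<Sum>j\<in>K. \<bar>M i j\<bar>)" using that assms(1) by (intro member_le_sum) auto
    also have "\<dots> \<le> M'" unfolding M'_def
      using that assms(1) by (intro member_le_sum[of i K "\<lambda>i. \<Sum>j\<in>K. \<bar>M i j\<bar>"]) (auto intro: sum_nonneg)
    finally show ?thesis .
  qed
  moreover have "0 \<le> M'" by (auto simp: M'_def intro!: sum_nonneg)
  ultimately show ?thesis using that by blast
qed

lemma mconv_cont:
  assumes "finite K" "\<And>i j. i \<in> K \<Longrightarrow> j \<in> K \<Longrightarrow> cont2 (k i j)" "\<And>i j. i \<in> K \<Longrightarrow> j \<in> K \<Longrightarrow> cont2 (l i j)"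
    "i \<in> K" "j \<in> K"
  shows "cont2 (mconv K k l i j)"
proof -
  have "cont2 (\<lambda>x y. \<Sum>p\<in>K. conv (k i p) (l p j) x y)"
    by (intro cont2_sum conv_cont assms)
  then show ?thesis by (simp add: mconv_def[abs_def])
qed

lemma mconv_cong:
  assumes "\<And>i j x y. i \<in> K \<Longrightarrow> j \<in> K \<Longrightarrow> x \<in> I \<Longrightarrow> y \<in> I \<Longrightarrow> k i j x y = k' i j x y"
    "\<And>i j x y. i \<in> K \<Longrightarrow> j \<in> K \<Longrightarrow> x \<in> I \<Longrightarrow> y \<in> I \<Longrightarrow> l i j x y = l' i j x y"
    "i \<in> K" "j \<in> K" "x \<in> I" "y \<in> I"
  shows "mconv K k l i j x y = mconv K k' l' i j x y"
  unfolding mconv_def by (intro sum.cong conv_cong refl) (use assms in auto)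

lemma mconv_assoc:
  assumes K: "finite K"
    and c: "\<And>i j. i \<in> K \<Longrightarrow> j \<in> K \<Longrightarrow> cont2 (k i j)" "\<And>i j. i \<in> K \<Longrightarrow> j \<in> K \<Longrightarrow> cont2 (l i j)"
     "\<And>i j. i \<in> K \<Longrightarrow> j \<in> K \<Longrightarrow> cont2 (m i j)"
    and ij: "i \<in> K" "j \<in> K" "x \<in> I" "y \<in> I"
  shows "mconv K k (mconv K l m) i j x y = mconv K (mconv K k l) m i j x y"
proof -
  have "mconv K k (mconv K l m) i j x y = (\<Sum>p\<in>K. conv (k i p) (\<lambda>x y. \<Sum>q\<in>K. conv (l p q) (m q j) x y) x y)"
    unfolding mconv_def by (simp add: mconv_def[abs_def])
  also have "\<dots> = (\<Sum>p\<in>K. \<Sum>q\<in>K. conv (k i p) (conv (l p q) (m q j)) x y)"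
    by (intro sum.cong refl conv_sum_right K conv_cont c ij)
  also have "\<dots> = (\<Sum>p\<in>K. \<Sum>q\<in>K. conv (conv (k i p) (l p q)) (m q j) x y)"
    by (intro sum.cong refl conv_assoc c ij)
  also have "\<dots> = (\<Sum>q\<in>K. \<Sum>p\<in>K. conv (conv (k i p) (l p q)) (m q j) x y)"
    by (rule sum.swap)
  also have "\<dots> = (\<Sum>q\<in>K. conv (\<lambda>x y. \<Sum>p\<in>K. conv (k i p) (l p q) x y) (m q j) x y)"
    by (intro sum.cong refl conv_sum_left[symmetric] K conv_cont c ij)
  also have "\<dots> = mconv K (mconv K k l) m i j x y"
    unfolding mconv_def by (simp add: mconv_def[abs_def])
  finally show ?thesis .
qed

lemma neumann_cont:
  assumes "finite K" "\<And>i j. i \<in> K \<Longrightarrow> j \<in> K \<Longrightarrow> cont2 (k i j)"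
  shows "i \<in> K \<Longrightarrow> j \<in> K \<Longrightarrow> cont2 (neumann K k m i j)"
proof (induction m arbitrary: i j)
  case (Suc m)
  show ?case unfolding neumann.simps by (rule mconv_cont[OF assms Suc.IH Suc.prems])
qed (use assms in simp)

lemma neumann_Suc_right:
  assumes "finite K" "\<And>i j. i \<in> K \<Longrightarrow> j \<in> K \<Longrightarrow> cont2 (k i j)"
  shows "i \<in> K \<Longrightarrow> j \<in> K \<Longrightarrow> x \<in> I \<Longrightarrow> y \<in> I \<Longrightarrow> neumann K k (Suc m) i j x y = mconv K (neumann K k m) k i j x y"
proof (induction m arbitrary: i j x y)
  case (Suc m)
  have "neumann K k (Suc (Suc m)) i j x y = mconv K k (neumann K k (Suc m)) i j x y" by simp
  also have "\<dots> = mconv K k (mconv K (neumann K k m) k) i j x y"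
    by (rule mconv_cong[OF refl Suc.IH Suc.prems])
  also have "\<dots> = mconv K (mconv K k (neumann K k m)) k i j x y"
    by (rule mconv_assoc[OF assms neumann_cont[OF assms] assms(2) Suc.prems])
  finally show ?case by simp
qed simp

lemma neumann_bound:
  assumes K: "finite K" "\<And>i j. i \<in> K \<Longrightarrow> j \<in> K \<Longrightarrow> cont2 (k i j)"
    and S: "{c..d} \<subseteq> I"
    and M: "0 \<le> M" "\<And>i j x y. i \<in> K \<Longrightarrow> j \<in> K \<Longrightarrow> x \<in> {c..d} \<Longrightarrow> y \<in> {c..d} \<Longrightarrow> norm (k i j x y) \<le> M"
  shows "i \<in> K \<Longrightarrow> j \<in> K \<Longrightarrow> x \<in> {c..d} \<Longrightarrow> y \<in> {c..d} \<Longrightarrow>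
    norm (neumann K k m i j x y) \<le> M * (real (card K) * M) ^ m / fact m * \<bar>x - y\<bar> ^ m"
proof (induction m arbitrary: i j x y)
  case 0
  then show ?case using M(2) by simp
next
  case (Suc m)
  let ?B = "M * (real (card K) * M) ^ m / fact m"
  have "norm (neumann K k (Suc m) i j x y) \<le> (\<Sum>p\<in>K. norm (conv (k i p) (neumann K k m p j) x y))"
    by (simp add: mconv_def norm_sum)
  also have "\<dots> \<le> (\<Sum>p\<in>K. M * ?B * \<bar>x - y\<bar> ^ Suc m / real (Suc m))"
    by (intro sum_mono conv_bound[OF _ _ S]) (use K M Suc neumann_cont[OF K] in auto)
  also have "\<dots> = M * (real (card K) * M) ^ Suc m / fact (Suc m) * \<bar>x - y\<bar> ^ Suc m"
    by (simp add: field_simps)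
  finally show ?case .
qed

lemma conv_limit:
  assumes f: "cont2 f" and g: "\<And>n. cont2 (g n)" "cont2 h"
    and lim: "uniform_limit ({c..d} \<times> {c..d}) (\<lambda>n p. g n (fst p) (snd p)) (\<lambda>p. h (fst p) (snd p)) sequentially"
    and S: "{c..d} \<subseteq> I" "x \<in> {c..d}" "y \<in> {c..d}"
  shows "(\<lambda>n. conv f (g n) x y) \<longlonglongrightarrow> conv f h x y"
proof (rule tendstoI)
  fix e :: real assume e: "e > 0"
  obtain M where M: "0 \<le> M" "\<And>i j x y. i \<in> {()} \<Longrightarrow> j \<in> {()} \<Longrightarrow> x \<in> {c..d} \<Longrightarrow> y \<in> {c..d} \<Longrightarrow> norm (f x y) \<le> M"
    using cont2_bounded[of "{()}" "\<lambda>_ _. f", OF _ _ S(1)] f by (metis finite.emptyI finite_insert)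
  \<comment> \<open>the summand 1 keeps the divisor positive when \<open>M\<close> or \<open>x - y\<close> is \<open>0\<close>\<close>
  define q where "q = M * \<bar>x - y\<bar> + 1"
  have q: "q > 0" using M(1) by (simp add: q_def add_nonneg_pos)
  have "\<forall>\<^sub>F n in sequentially. \<forall>p\<in>{c..d} \<times> {c..d}. dist (g n (fst p) (snd p)) (h (fst p) (snd p)) < e / q"
    using lim e q by (intro uniform_limitD) auto
  then show "\<forall>\<^sub>F n in sequentially. dist (conv f (g n) x y) (conv f h x y) < e"
  proof (rule eventually_mono)
    fix n assume n: "\<forall>p\<in>{c..d} \<times> {c..d}. dist (g n (fst p) (snd p)) (h (fst p) (snd p)) < e / q"
    have xy: "x \<in> I" "y \<in> I" using S by auto
    let ?g = "\<lambda>x y. g n x y + (-1) * h x y"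
    have m1: "cont2 (\<lambda>x y. (-1) * h x y)" by (rule cont2_mult) (use g(2) in auto)
    have cg: "cont2 ?g" by (rule cont2_add[OF g(1) m1])
    have "conv f ?g x y = conv f (g n) x y + conv f (\<lambda>x y. (-1) * h x y) x y"
      by (rule conv_add_right[OF f g(1) m1 xy])
    also have "conv f (\<lambda>x y. (-1) * h x y) x y = - conv f h x y"
      using conv_mult_right[of f h "\<lambda>_. -1" x y] by simp
    finally have "dist (conv f (g n) x y) (conv f h x y) = norm (conv f ?g x y)"
      by (simp add: dist_norm)
    also have "\<dots> \<le> M * (e / q) * \<bar>x - y\<bar> ^ Suc 0 / real (Suc 0)"
    proof (rule conv_bound[OF f cg S M(1)])
      show "norm (f x \<tau>) \<le> M" if "\<tau> \<in> {c..d}" for \<tau> using M(2) that S by auto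
      show "norm (?g \<tau> y) \<le> e / q * \<bar>\<tau> - y\<bar> ^ 0" if "\<tau> \<in> {c..d}" for \<tau>
        using n[rule_format, of "(\<tau>, y)"] that S by (simp add: dist_norm)
    qed
    also have "\<dots> = (e / q) * (q - 1)" by (simp add: q_def)
    also have "\<dots> < e" using e q by (simp add: field_simps)
    finally show "dist (conv f (g n) x y) (conv f h x y) < e" .
  qed
qed

lemma conv_limit_left:
  assumes f: "cont2 f" and g: "\<And>n. cont2 (g n)" "cont2 h"
    and lim: "uniform_limit ({c..d} \<times> {c..d}) (\<lambda>n p. g n (fst p) (snd p)) (\<lambda>p. h (fst p) (snd p)) sequentially"
    and S: "{c..d} \<subseteq> I" "x \<in> {c..d}" "y \<in> {c..d}"
  shows "(\<lambda>n. conv (g n) f x y) \<longlonglongrightarrow> conv h f x y"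
proof -
  have xy: "x \<in> I" "y \<in> I" using S by auto
  have "uniform_limit ({c..d} \<times> {c..d}) (\<lambda>n p. g n (snd p) (fst p)) (\<lambda>p. h (snd p) (fst p)) sequentially"
    unfolding uniform_limit_iff
  proof (intro allI impI)
    fix e :: real assume "e > 0"
    then have "\<forall>\<^sub>F n in sequentially. \<forall>p\<in>{c..d} \<times> {c..d}. dist (g n (fst p) (snd p)) (h (fst p) (snd p)) < e"
      using lim by (intro uniform_limitD)
    then show "\<forall>\<^sub>F n in sequentially. \<forall>p\<in>{c..d} \<times> {c..d}. dist (g n (snd p) (fst p)) (h (snd p) (fst p)) < e"
      by (rule eventually_mono) auto
  qed
  then have "(\<lambda>n. conv (\<lambda>x y. f y x) (\<lambda>x y. g n y x) y x) \<longlonglongrightarrow> conv (\<lambda>x y. f y x) (\<lambda>x y. h y x) y x"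
    by (intro conv_limit[OF cont2_swap[OF f] cont2_swap[OF g(1)] cont2_swap[OF g(2)] _ S(1,3,2)])
  then have "(\<lambda>n. - conv (\<lambda>x y. f y x) (\<lambda>x y. g n y x) y x) \<longlonglongrightarrow> - conv (\<lambda>x y. f y x) (\<lambda>x y. h y x) y x"
    by (rule tendsto_minus)
  then show ?thesis using conv_swap[OF g(1) f xy] conv_swap[OF g(2) f xy] by simp
qed

lemma neumann_uniform:
  assumes K: "finite K" "\<And>i j. i \<in> K \<Longrightarrow> j \<in> K \<Longrightarrow> cont2 (k i j)"
    and S: "{c..d} \<subseteq> I" and ij: "i \<in> K" "j \<in> K"
  shows "uniform_limit ({c..d} \<times> {c..d}) (\<lambda>n p. \<Sum>m<n. neumann K k m i j (fst p) (snd p))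
    (\<lambda>p. \<Sum>m. neumann K k m i j (fst p) (snd p)) sequentially"
proof -
  obtain M where M: "0 \<le> M" "\<And>i j x y. i \<in> K \<Longrightarrow> j \<in> K \<Longrightarrow> x \<in> {c..d} \<Longrightarrow> y \<in> {c..d} \<Longrightarrow> norm (k i j x y) \<le> M"
    using cont2_bounded[of K k c d, OF K(1) K(2) S] by blast
  let ?X = "real (card K) * M * \<bar>d - c\<bar>"
  show ?thesis
  proof (rule Weierstrass_m_test)
    fix m p assume p: "p \<in> {c..d} \<times> {c..d}"
    have "norm (neumann K k m i j (fst p) (snd p)) \<le> M * (real (card K) * M) ^ m / fact m * \<bar>fst p - snd p\<bar> ^ m"
      by (rule neumann_bound[OF K S M]) (use ij p in auto)
    also have "\<dots> \<le> M * (real (card K) * M) ^ m / fact m * \<bar>d - c\<bar> ^ m"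
      by (intro mult_left_mono power_mono) (use p M in auto)
    also have "\<dots> = M * (?X ^ m /\<^sub>R fact m)" by (simp add: field_simps)
    finally show "norm (neumann K k m i j (fst p) (snd p)) \<le> M * (?X ^ m /\<^sub>R fact m)" .
  next
    show "summable (\<lambda>m. M * (?X ^ m /\<^sub>R fact m))"
      by (intro summable_mult summable_exp_generic)
  qed
qed

lemma pd1_sum: "finite K \<Longrightarrow> (\<And>k. k \<in> K \<Longrightarrow> pd1 I (f k) (f' k)) \<Longrightarrow>
    pd1 I (\<lambda>x y. \<Sum>k\<in>K. f k x y) (\<lambda>x y. \<Sum>k\<in>K. f' k x y)"
  unfolding pd1_def by (auto intro!: has_vector_derivative_sum)

lemma pd2_sum: "finite K \<Longrightarrow> (\<And>k. k \<in> K \<Longrightarrow> pd2 I (f k) (f' k)) \<Longrightarrow>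
    pd2 I (\<lambda>x y. \<Sum>k\<in>K. f k x y) (\<lambda>x y. \<Sum>k\<in>K. f' k x y)"
  unfolding pd2_iff by (rule pd1_sum)

text \<open>Bootstrapping: the derivative in the first variable falls on \<open>k\<close> in \<open>k + k * r\<close>, and the one in the second
  variable falls on \<open>k\<close> in \<open>k + r * k\<close>.  Hence both derivatives of \<open>r\<close> are as regular as \<open>r\<close> itself.\<close>

lemma resolvent_smooth:
  assumes K: "finite K" and k: "\<And>i j. i \<in> K \<Longrightarrow> j \<in> K \<Longrightarrow> smooth2 I (k i j)"
    and r: "\<And>i j. i \<in> K \<Longrightarrow> j \<in> K \<Longrightarrow> cont2 (r i j)"
    and eq1: "\<And>i j x y. i \<in> K \<Longrightarrow> j \<in> K \<Longrightarrow> x \<in> I \<Longrightarrow> y \<in> I \<Longrightarrow> r i j x y = k i j x y + mconv K k r i j x y"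
    and eq2: "\<And>i j x y. i \<in> K \<Longrightarrow> j \<in> K \<Longrightarrow> x \<in> I \<Longrightarrow> y \<in> I \<Longrightarrow> r i j x y = k i j x y + mconv K r k i j x y"
    and ij: "i \<in> K" "j \<in> K"
  shows "smooth2 I (r i j)"
proof -
  note [simp] = smooth2_cont
  have "\<forall>i\<in>K. \<forall>j\<in>K. Ck I m (r i j)" for m
  proof (induction m)
    case 0
    then show ?case using r by simp
  next
    case (Suc m)
    show ?case
    proof (intro ballI)
      fix i j assume ij: "i \<in> K" "j \<in> K"
      have C: "Ck I m (k i j)" "Ck I m (dx I (k i j))" "Ck I m (dy I (k i j))" if "i \<in> K" "j \<in> K" for i j
        using k[OF that] smooth2_dx(2)[OF k[OF that]] smooth2_dy(2)[OF k[OF that]] by (auto simp: smooth2_iff)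
      have "pd1 I (\<lambda>x y. k i j x y + (\<Sum>p\<in>K. conv (k i p) (r p j) x y))
        (\<lambda>x y. dx I (k i j) x y + (\<Sum>p\<in>K. k i p x x * r p j x y + conv (dx I (k i p)) (r p j) x y))"
        by (intro pd1_add pd1_sum conv_pd1 smooth2_dx smooth2_cont K r k ij)
      then have 1: "pd1 I (r i j) (\<lambda>x y. dx I (k i j) x y + (\<Sum>p\<in>K. k i p x x * r p j x y + conv (dx I (k i p)) (r p j) x y))"
        by (rule pd1_cong) (use eq1 ij in \<open>auto simp: mconv_def\<close>)
      have "pd2 I (\<lambda>x y. k i j x y + (\<Sum>p\<in>K. conv (r i p) (k p j) x y))
        (\<lambda>x y. dy I (k i j) x y + (\<Sum>p\<in>K. conv (r i p) (dy I (k p j)) x y - r i p x y * k p j y y))"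
        by (intro pd2_add pd2_sum conv_pd2 smooth2_dy smooth2_cont K r k ij)
      then have 2: "pd2 I (r i j) (\<lambda>x y. dy I (k i j) x y + (\<Sum>p\<in>K. conv (r i p) (dy I (k p j)) x y - r i p x y * k p j y y))"
        by (rule pd2_cong) (use eq2 ij in \<open>auto simp: mconv_def\<close>)
      have R: "Ck I m (r i j)" if "i \<in> K" "j \<in> K" for i j using Suc that by blast
      show "Ck I (Suc m) (r i j)"
      proof (rule Ck_SucI[OF 1 2 r[OF ij]])
        show "Ck I m (\<lambda>x y. dx I (k i j) x y + (\<Sum>p\<in>K. k i p x x * r p j x y + conv (dx I (k i p)) (r p j) x y))"
          by (intro Ck_add Ck_sum Ck_mult Ck_conv Ck_diag[OF C(1)] C R K ij)
        show "Ck I m (\<lambda>x y. dy I (k i j) x y + (\<Sum>p\<in>K. conv (r i p) (dy I (k p j)) x y - r i p x y * k p j y y))"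
          by (intro Ck_add Ck_sum Ck_diff Ck_mult Ck_conv Ck_diag'[OF C(1)] C R K ij)
      qed
    qed
  qed
  then show ?thesis using ij by (simp add: smooth2_iff)
qed

text \<open>The sum of the Neumann series converges uniformly on compact squares, hence is continuous and solves
  both resolvent equations; these force it to be smooth.\<close>

lemma volterra_resolvent:
  assumes K: "finite K" and k: "\<And>i j. i \<in> K \<Longrightarrow> j \<in> K \<Longrightarrow> smooth2 I (k i j)"
  obtains r where "\<And>i j. i \<in> K \<Longrightarrow> j \<in> K \<Longrightarrow> smooth2 I (r i j)"
    "\<And>i j x y. i \<in> K \<Longrightarrow> j \<in> K \<Longrightarrow> x \<in> I \<Longrightarrow> y \<in> I \<Longrightarrow> r i j x y = k i j x y + mconv K k r i j x y"
    "\<And>i j x y. i \<in> K \<Longrightarrow> j \<in> K \<Longrightarrow> x \<in> I \<Longrightarrow> y \<in> I \<Longrightarrow> r i j x y = k i j x y + mconv K r k i j x y"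
proof -
  have kc: "cont2 (k i j)" if "i \<in> K" "j \<in> K" for i j using smooth2_cont[OF k[OF that]] .
  define r where "r = (\<lambda>i j x y. \<Sum>m. neumann K k m i j x y)"
  define s where "s = (\<lambda>n i j x y. \<Sum>m<n. neumann K k m i j x y)"
  have sc: "cont2 (s n i j)" if "i \<in> K" "j \<in> K" for n i j
    unfolding s_def by (intro cont2_sum neumann_cont[OF K kc] that) auto
  have ul: "uniform_limit ({c..d} \<times> {c..d}) (\<lambda>n p. s n i j (fst p) (snd p)) (\<lambda>p. r i j (fst p) (snd p)) sequentially"
    if "i \<in> K" "j \<in> K" "{c..d} \<subseteq> I" for c d i j
    unfolding r_def s_def by (rule neumann_uniform[OF K kc that(3,1,2)])
  have rc: "cont2 (r i j)" if "i \<in> K" "j \<in> K" for i j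
  proof (rule cont2_local)
    fix c d assume cd: "{c..d} \<subseteq> I"
    have "continuous_on ({c..d} \<times> {c..d}) (\<lambda>p. s n i j (fst p) (snd p))" for n
      by (intro cont2_compose[OF sc[OF that]] continuous_intros) (use cd in auto)
    then have "continuous_on ({c..d} \<times> {c..d}) (\<lambda>p. r i j (fst p) (snd p))"
      by (intro uniform_limit_theorem[OF _ ul[OF that cd]]) auto
    then show "continuous_on ({c..d} \<times> {c..d}) (\<lambda>(x, y). r i j x y)" by (simp add: case_prod_unfold)
  qed
  have seg: "{min x y..max x y} \<subseteq> I" if "x \<in> I" "y \<in> I" for x y
    by (rule Icc_I) (use that in \<open>auto simp: min_def max_def\<close>)
  have lim: "(\<lambda>n. s n i j x y) \<longlonglongrightarrow> r i j x y" if "i \<in> K" "j \<in> K" "x \<in> I" "y \<in> I" for i j x y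
    using tendsto_uniform_limitI[OF ul[OF that(1,2) seg[OF that(3,4)]], of "(x, y)"] by simp
  have lim': "(\<lambda>n. s (Suc n) i j x y - k i j x y) \<longlonglongrightarrow> r i j x y - k i j x y"
      if "i \<in> K" "j \<in> K" "x \<in> I" "y \<in> I" for i j x y
    by (intro tendsto_diff tendsto_const LIMSEQ_Suc lim that)
  have sS: "s (Suc n) i j x y - k i j x y = (\<Sum>m<n. neumann K k (Suc m) i j x y)" for n i j x y
    unfolding s_def by (subst sum.lessThan_Suc_shift) simp
  have 1: "r i j x y = k i j x y + mconv K k r i j x y" if "i \<in> K" "j \<in> K" "x \<in> I" "y \<in> I" for i j x y
  proof -
    have "(\<lambda>n. \<Sum>p\<in>K. conv (k i p) (s n p j) x y) \<longlonglongrightarrow> mconv K k r i j x y"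
      unfolding mconv_def
      by (intro tendsto_sum conv_limit[OF kc sc rc ul seg[of x y]] seg[of x y]) (use that in auto)
    moreover have "(\<Sum>p\<in>K. conv (k i p) (s n p j) x y) = s (Suc n) i j x y - k i j x y" for n
    proof -
      have "(\<Sum>p\<in>K. conv (k i p) (s n p j) x y) = (\<Sum>p\<in>K. \<Sum>m<n. conv (k i p) (neumann K k m p j) x y)"
        unfolding s_def by (intro sum.cong refl conv_sum_right kc neumann_cont[OF K kc] that) auto
      also have "\<dots> = (\<Sum>m<n. neumann K k (Suc m) i j x y)"
        unfolding neumann.simps mconv_def by (rule sum.swap)
      finally show ?thesis using sS by simp
    qed
    ultimately have "mconv K k r i j x y = r i j x y - k i j x y"
      using LIMSEQ_unique lim'[OF that] by simp
    then show ?thesis by simp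
  qed
  have 2: "r i j x y = k i j x y + mconv K r k i j x y" if "i \<in> K" "j \<in> K" "x \<in> I" "y \<in> I" for i j x y
  proof -
    have "(\<lambda>n. \<Sum>p\<in>K. conv (s n i p) (k p j) x y) \<longlonglongrightarrow> mconv K r k i j x y"
      unfolding mconv_def
      by (intro tendsto_sum conv_limit_left[OF kc sc rc ul seg[of x y]] seg[of x y]) (use that in auto)
    moreover have "(\<Sum>p\<in>K. conv (s n i p) (k p j) x y) = s (Suc n) i j x y - k i j x y" for n
    proof -
      have "(\<Sum>p\<in>K. conv (s n i p) (k p j) x y) = (\<Sum>p\<in>K. \<Sum>m<n. conv (neumann K k m i p) (k p j) x y)"
        unfolding s_def by (intro sum.cong refl conv_sum_left kc neumann_cont[OF K kc] that) auto
      also have "\<dots> = (\<Sum>m<n. mconv K (neumann K k m) k i j x y)"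
        unfolding mconv_def by (rule sum.swap)
      also have "\<dots> = (\<Sum>m<n. neumann K k (Suc m) i j x y)"
        by (intro sum.cong refl neumann_Suc_right[OF K kc, symmetric] that)
      finally show ?thesis using sS by simp
    qed
    ultimately have "mconv K r k i j x y = r i j x y - k i j x y"
      using LIMSEQ_unique lim'[OF that] by simp
    then show ?thesis by simp
  qed
  show ?thesis by (rule that[OF resolvent_smooth[OF K k rc 1 2] 1 2])
qed

end

section \<open>The ring of operators on test functions\<close>

text \<open>The additive functionals.  All elements of \<open>D(I)\<close> belong here, which is what uniqueness of inverses
  in \<open>D(I)\<close> needs.\<close>

definition addi :: "real set \<Rightarrow> dist set" where
  "addi I = {f. (\<forall>\<phi>. \<phi> \<notin> test_fun I \<longrightarrow> f \<phi> = 0) \<and> (\<forall>\<phi>\<in>test_fun I. \<forall>\<psi>\<in>test_fun I. f (\<phi> + \<psi>) = f \<phi> + f \<psi>)}"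

text \<open>Linear maps of test functions to test functions, extended by \<open>0\<close>.  They form a ring: the star product
  distributes over sums on its right because the left factor is additive on the test functions that the right
  factors produce.\<close>

definition Op :: "real set \<Rightarrow> dist set" where
  "Op I = {f \<in> addi I. (\<forall>\<phi>\<in>test_fun I. f \<phi> \<in> test_fun I) \<and> (\<forall>c. \<forall>\<phi>\<in>test_fun I. f (\<lambda>t. c * \<phi> t) =
      (\<lambda>t. c * f \<phi> t))}"

lemma star_assoc: "(f \<star> g) \<star> h = f \<star> (g \<star> h)"
  by (simp add: star_def)

lemma star_add_left: "(f + g) \<star> h = f \<star> h + g \<star> h"
  by (simp add: star_def fun_eq_iff)

lemma star_diff_left: "(f - g) \<star> h = f \<star> h - g \<star> h"
  by (simp add: star_def fun_eq_iff)

lemma star_0_left [simp]: "0 \<star> h = 0"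
  by (simp add: star_def fun_eq_iff)

lemma star_sum_left: "(\<Sum>k\<in>S. f k) \<star> h = (\<Sum>k\<in>S. f k \<star> h)"
proof (induction S rule: infinite_finite_induct)
  case (insert k S)
  show ?case unfolding sum.insert[OF insert.hyps] star_add_left insert.IH ..
next
  case (infinite S)
  show ?case unfolding sum.infinite[OF infinite] star_0_left ..
next
  case empty
  show ?case unfolding sum.empty star_0_left ..
qed

context time_interval
begin

abbreviation T where "T \<equiv> test_fun I"
abbreviation D where "D \<equiv> delta I (Suc 0)"
abbreviation \<Theta> where "\<Theta> \<equiv> Theta I"
text \<open>Volterra integral operators and multiplication operators; of the function of two variables that
  describes a multiplication operator only the diagonal matters.\<close>

abbreviation Vol where "Vol \<equiv> Theta_dist I"
abbreviation Mult where "Mult \<equiv> delta_dist I 0"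

lemma smooth1_cong: "smooth1 I f \<Longrightarrow> (\<And>x. x \<in> I \<Longrightarrow> g x = f x) \<Longrightarrow> smooth1 I g"
  unfolding smooth1_def by (metis (no_types, lifting))

lemma testI:
  assumes "smooth2 I F" "y \<in> I" "\<And>x. x \<in> I \<Longrightarrow> \<phi> x = F x y" "\<And>x. x \<notin> I \<Longrightarrow> \<phi> x = 0"
    "c \<in> interior I" "\<And>t. t < c \<Longrightarrow> \<phi> t = 0"
  shows "\<phi> \<in> T"
  using smooth1_cong[OF smooth2_smooth1[OF assms(1,2)] assms(3)] assms(4-6)
  unfolding test_fun_def by blast

lemma test_smooth2: "\<phi> \<in> T \<Longrightarrow> smooth2 I (\<lambda>x y. \<phi> x)"
  by (auto simp: test_fun_def intro: smooth1_smooth2)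

lemma test_outside: "\<phi> \<in> T \<Longrightarrow> x \<notin> I \<Longrightarrow> \<phi> x = 0"
  by (simp add: test_fun_def)

lemma test_add: assumes "\<phi> \<in> T" "\<psi> \<in> T" shows "\<phi> + \<psi> \<in> T"
proof -
  obtain c where c: "c \<in> I" "\<And>t. t \<le> c \<Longrightarrow> \<phi> t = 0" "c \<in> interior I" by (rule test_funE[OF assms(1)]) blast
  obtain d where d: "d \<in> I" "\<And>t. t \<le> d \<Longrightarrow> \<psi> t = 0" "d \<in> interior I" by (rule test_funE[OF assms(2)]) blast
  have min: "min c d \<in> interior I" using c d by (simp add: min_def)
  show ?thesis
    by (rule testI[OF smooth2_add[OF test_smooth2[OF assms(1)] test_smooth2[OF assms(2)]] c(1) _ _ min])
      (use c(2) d(2) test_outside[OF assms(1)] test_outside[OF assms(2)] in auto)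
qed

lemma test_cmult: assumes "\<phi> \<in> T" shows "(\<lambda>t. c * \<phi> t) \<in> T"
proof -
  obtain d where d: "d \<in> I" "\<And>t. t \<le> d \<Longrightarrow> \<phi> t = 0" "d \<in> interior I" by (rule test_funE[OF assms(1)]) blast
  show ?thesis
    by (rule testI[OF smooth2_mult[OF smooth2_const test_smooth2[OF assms(1)]], of d _ c d])
      (use d assms test_outside in auto)
qed

lemma test_0: "0 \<in> T"
proof -
  obtain c where "c \<in> interior I" using int by blast
  then show ?thesis
    by (intro testI[OF smooth2_const, of c _ 0 c]) (use interior_subset in auto)
qed

lemma OpI:
  assumes "\<And>\<phi>. \<phi> \<notin> T \<Longrightarrow> f \<phi> = 0" "\<And>\<phi> \<psi>. \<phi> \<in> T \<Longrightarrow> \<psi> \<in> T \<Longrightarrow> f (\<phi> + \<psi>) = f \<phi> + f \<psi>"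
    "\<And>\<phi>. \<phi> \<in> T \<Longrightarrow> f \<phi> \<in> T" "\<And>c \<phi>. \<phi> \<in> T \<Longrightarrow> f (\<lambda>t. c * \<phi> t) = (\<lambda>t. c * f \<phi> t)"
  shows "f \<in> Op I"
  using assms by (auto simp: Op_def addi_def)

lemma Op_addi: "f \<in> Op I \<Longrightarrow> f \<in> addi I" by (simp add: Op_def)

lemma addi_off: "f \<in> addi I \<Longrightarrow> \<phi> \<notin> T \<Longrightarrow> f \<phi> = 0" by (simp add: addi_def)
lemma addi_add: "f \<in> addi I \<Longrightarrow> \<phi> \<in> T \<Longrightarrow> \<psi> \<in> T \<Longrightarrow> f (\<phi> + \<psi>) = f \<phi> + f \<psi>" by (simp add: addi_def)
lemma addi_zero: "f \<in> addi I \<Longrightarrow> f 0 = 0" using addi_add[of f 0 0] test_0 by simp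
lemma Op_off: "f \<in> Op I \<Longrightarrow> \<phi> \<notin> T \<Longrightarrow> f \<phi> = 0" using addi_off Op_addi by blast
lemma Op_T: "f \<in> Op I \<Longrightarrow> f \<phi> \<in> T" using Op_off[of f \<phi>] test_0 by (cases "\<phi> \<in> T") (auto simp: Op_def)
lemma Op_scale: "f \<in> Op I \<Longrightarrow> \<phi> \<in> T \<Longrightarrow> f (\<lambda>t. c * \<phi> t) = (\<lambda>t. c * f \<phi> t)" by (simp add: Op_def)

lemma star_add_right: "f \<in> addi I \<Longrightarrow> g \<in> Op I \<Longrightarrow> h \<in> Op I \<Longrightarrow> f \<star> (g + h) = f \<star> g + f \<star> h"
  using addi_add Op_T by (simp add: star_def fun_eq_iff)

lemma star_0_right: "f \<in> addi I \<Longrightarrow> f \<star> 0 = 0"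
  using addi_zero by (simp add: star_def fun_eq_iff)

lemma Op_star: "f \<in> Op I \<Longrightarrow> g \<in> Op I \<Longrightarrow> f \<star> g \<in> Op I"
proof (rule OpI)
  assume f: "f \<in> Op I" and g: "g \<in> Op I"
  show "(f \<star> g) \<phi> = 0" if "\<phi> \<notin> T" for \<phi>
    unfolding star_def Op_off[OF g that] by (rule addi_zero[OF Op_addi[OF f]])
  show "(f \<star> g) (\<phi> + \<psi>) = (f \<star> g) \<phi> + (f \<star> g) \<psi>" if "\<phi> \<in> T" "\<psi> \<in> T" for \<phi> \<psi>
    unfolding star_def addi_add[OF Op_addi[OF g] that]
    by (rule addi_add[OF Op_addi[OF f] Op_T[OF g] Op_T[OF g]])
  show "(f \<star> g) \<phi> \<in> T" for \<phi> unfolding star_def by (rule Op_T[OF f])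
  show "(f \<star> g) (\<lambda>t. c * \<phi> t) = (\<lambda>t. c * (f \<star> g) \<phi> t)" if "\<phi> \<in> T" for c \<phi>
    unfolding star_def Op_scale[OF g that] by (rule Op_scale[OF f Op_T[OF g]])
qed

lemma Op_0: "0 \<in> Op I" by (rule OpI) (auto simp: test_0 fun_eq_iff)

lemma Op_add: "f \<in> Op I \<Longrightarrow> g \<in> Op I \<Longrightarrow> f + g \<in> Op I"
  by (rule OpI) (auto simp: Op_T Op_off addi_add[OF Op_addi] Op_scale test_add algebra_simps fun_eq_iff)

lemma Op_scale_op: "f \<in> Op I \<Longrightarrow> scale c f \<in> Op I"
  by (rule OpI) (auto simp: scale_def Op_T Op_off addi_add[OF Op_addi] Op_scale test_cmult algebra_simps fun_eq_iff)

lemma Op_minus: "f \<in> Op I \<Longrightarrow> - f \<in> Op I"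
  using Op_scale_op[of f "-1"] by (simp add: scale_def fun_Compl_def)

lemma Op_diff: "f \<in> Op I \<Longrightarrow> g \<in> Op I \<Longrightarrow> f - g \<in> Op I"
  using Op_add[OF _ Op_minus] by simp

lemma Op_sum: "(\<And>k. k \<in> A \<Longrightarrow> f k \<in> Op I) \<Longrightarrow> (\<Sum>k\<in>A. f k) \<in> Op I"
  by (induction A rule: infinite_finite_induct) (auto simp: Op_0 Op_add)

lemma star_minus_right: "f \<in> addi I \<Longrightarrow> g \<in> Op I \<Longrightarrow> f \<star> (- g) = - (f \<star> g)"
  using star_add_right[of f g "- g"] Op_minus star_0_right[of f] by (simp add: eq_neg_iff_add_eq_0 add.commute)

lemma star_diff_right: "f \<in> addi I \<Longrightarrow> g \<in> Op I \<Longrightarrow> h \<in> Op I \<Longrightarrow> f \<star> (g - h) = f \<star> g - f \<star> h"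
  using star_add_right[of f g "- h"] star_minus_right[of f h] Op_minus by simp

lemma star_sum_right:
  assumes "f \<in> addi I" "\<And>k. k \<in> A \<Longrightarrow> g k \<in> Op I"
  shows "f \<star> (\<Sum>k\<in>A. g k) = (\<Sum>k\<in>A. f \<star> g k)"
  using assms by (induction A rule: infinite_finite_induct) (auto simp: star_0_right star_add_right Op_sum)

lemma Op_one: "one_star I \<in> Op I"
proof -
  have "one_star I \<phi> = (if \<phi> \<in> T then \<phi> else 0)" for \<phi>
    using delta_0_test by (auto simp: delta_apply)
  then show ?thesis by (intro OpI) (auto simp: test_add test_cmult)
qed

lemma star_one_left [simp]: "f \<in> Op I \<Longrightarrow> one_star I \<star> f = f"
  by (simp add: star_def fun_eq_iff delta_0_test Op_T)

lemma star_one_right: "f \<in> addi I \<Longrightarrow> f \<star> one_star I = f"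
proof
  fix \<phi> assume f: "f \<in> addi I"
  show "(f \<star> one_star I) \<phi> = f \<phi>"
    using f addi_zero[OF f] addi_off[OF f] delta_0_test[of \<phi> I]
    by (cases "\<phi> \<in> T") (auto simp: star_def delta_apply zero_fun_def[symmetric])
qed

lemma star_one_right' [simp]: "f \<in> Op I \<Longrightarrow> f \<star> one_star I = f"
  using star_one_right Op_addi by blast

lemma star_scale_left: "scale c f \<star> g = scale c (f \<star> g)"
  by (simp add: star_def scale_def)

lemma star_scale_right: "f \<in> Op I \<Longrightarrow> g \<in> Op I \<Longrightarrow> f \<star> scale c g = scale c (f \<star> g)"
  by (simp add: star_def scale_def Op_scale Op_T)

text \<open>To the left of its support a test function contributes nothing, so the integral over the past of \<open>x\<close>
  becomes a signed integral that starts at any point \<open>c\<close> before the support, for every \<open>x\<close> in \<open>I\<close>.\<close>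

lemma Vol_conv:
  assumes \<phi>: "\<phi> \<in> T" and f: "smooth2 I f" and c: "c \<in> I" "\<And>t. t \<le> c \<Longrightarrow> \<phi> t = 0" and x: "x \<in> I"
  shows "Vol f \<phi> x = conv f (\<lambda>\<tau> y. \<phi> \<tau>) x c"
proof -
  let ?h = "\<lambda>t. f x t * \<phi> t"
  have h: "continuous_on I ?h"
    using conv_integrand[OF smooth2_cont[OF f] smooth2_cont[OF test_smooth2[OF \<phi>]] x x] by simp
  have "Vol f \<phi> x = integral {t\<in>I. t \<le> x} ?h" using \<phi> x by (simp add: Theta_dist_def)
  also have "\<dots> = sint c x ?h"
  proof (cases "c \<le> x")
    case True
    have sub: "{c..x} \<subseteq> I" by (rule Icc_I[OF c(1) x])
    have "integral {t\<in>I. t \<le> x} ?h = integral {t\<in>I. t \<le> x} (\<lambda>t. if t \<in> {c..x} then ?h t else 0)"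
      by (rule integral_cong) (use c in auto)
    also have "\<dots> = integral ({c..x} \<inter> {t\<in>I. t \<le> x}) ?h" by (rule integral_restrict_Int)
    also have "{c..x} \<inter> {t\<in>I. t \<le> x} = {c..x}" using sub by auto
    also have "integral {c..x} ?h = sint c x ?h" by (rule sint_integral[OF h c(1) x True, symmetric])
    finally show ?thesis .
  next
    case False
    have "integral {t\<in>I. t \<le> x} ?h = integral {t\<in>I. t \<le> x} (\<lambda>_. 0)"
      by (rule integral_cong) (use c False in auto)
    moreover have "sint c x ?h = integral {0..1::real} (\<lambda>_. 0 :: complex)"
      unfolding sint_def
    proof (rule integral_cong)
      fix s :: real assume "s \<in> {0..1}"
      then have "c + s * (x - c) \<le> c" using False by (simp add: mult_nonneg_nonpos)
      then show "(x - c) *\<^sub>R (f x (c + s * (x - c)) * \<phi> (c + s * (x - c))) = 0" using c by simp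
    qed
    ultimately show ?thesis by simp
  qed
  finally show ?thesis by (simp add: conv_def)
qed

lemma Vol_left_zero:
  assumes \<phi>: "\<phi> \<in> T" and c: "\<And>t. t \<le> c \<Longrightarrow> \<phi> t = 0" and x: "x \<le> c"
  shows "Vol f \<phi> x = 0"
proof -
  have "integral {t\<in>I. t \<le> x} (\<lambda>t. f x t * \<phi> t) = integral {t\<in>I. t \<le> x} (\<lambda>_. 0)"
    by (rule integral_cong) (use c x in auto)
  then show ?thesis by (simp add: Theta_dist_def)
qed

lemma Vol_off: "\<phi> \<notin> T \<Longrightarrow> Vol f \<phi> = 0" "x \<notin> I \<Longrightarrow> Vol f \<phi> x = 0"
  by (auto simp: Theta_dist_def)

lemma Vol_test:
  assumes "smooth2 I f" "\<phi> \<in> T" shows "Vol f \<phi> \<in> T"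
proof -
  obtain c where c: "c \<in> I" "\<And>t. t \<le> c \<Longrightarrow> \<phi> t = 0" "c \<in> interior I" by (rule test_funE[OF assms(2)]) blast
  show ?thesis
    by (rule testI[OF smooth2_conv[OF assms(1) test_smooth2[OF assms(2)]] c(1) _ _ c(3)])
      (use Vol_conv[OF assms(2,1) c(1,2)] Vol_left_zero[OF assms(2) c(2)] Vol_off in auto)
qed

lemma test_funE2:
  assumes "\<phi> \<in> T" "\<psi> \<in> T"
  obtains c where "c \<in> I" "\<And>t. t \<le> c \<Longrightarrow> \<phi> t = 0" "\<And>t. t \<le> c \<Longrightarrow> \<psi> t = 0"
proof -
  obtain c where c: "c \<in> I" "\<And>t. t \<le> c \<Longrightarrow> \<phi> t = 0" "c \<in> interior I" by (rule test_funE[OF assms(1)]) blast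
  obtain d where d: "d \<in> I" "\<And>t. t \<le> d \<Longrightarrow> \<psi> t = 0" "d \<in> interior I" by (rule test_funE[OF assms(2)]) blast
  have "min c d \<in> I" using c d by (simp add: min_def)
  then show ?thesis by (rule that[of "min c d"]) (use c(2) d(2) in auto)
qed

lemma Op_Vol: assumes f: "smooth2 I f" shows "Vol f \<in> Op I"
proof (rule OpI)
  fix \<phi> \<psi> assume t: "\<phi> \<in> T" "\<psi> \<in> T"
  obtain c where c: "c \<in> I" "\<And>t. t \<le> c \<Longrightarrow> \<phi> t = 0" "\<And>t. t \<le> c \<Longrightarrow> \<psi> t = 0"
    by (rule test_funE2[OF t]) blast
  show "Vol f (\<phi> + \<psi>) = Vol f \<phi> + Vol f \<psi>"
  proof
    fix x
    show "Vol f (\<phi> + \<psi>) x = (Vol f \<phi> + Vol f \<psi>) x"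
    proof (cases "x \<in> I")
      case True
      have "Vol f (\<phi> + \<psi>) x = conv f (\<lambda>\<tau> y. (\<phi> + \<psi>) \<tau>) x c"
        by (rule Vol_conv[OF test_add[OF t] f c(1) _ True]) (use c in auto)
      also have "\<dots> = conv f (\<lambda>\<tau> y. \<phi> \<tau>) x c + conv f (\<lambda>\<tau> y. \<psi> \<tau>) x c"
        using conv_add_right[OF smooth2_cont[OF f] smooth2_cont[OF test_smooth2[OF t(1)]] smooth2_cont[OF test_smooth2[OF t(2)]] True c(1)]
        by simp
      finally show ?thesis using Vol_conv[OF t(1) f c(1,2) True] Vol_conv[OF t(2) f c(1,3) True] by simp
    qed (simp add: Vol_off)
  qed
next
  fix a \<phi> assume t: "\<phi> \<in> T"
  obtain c where c: "c \<in> I" "\<And>t. t \<le> c \<Longrightarrow> \<phi> t = 0" "c \<in> interior I" by (rule test_funE[OF t]) blast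
  show "Vol f (\<lambda>t. a * \<phi> t) = (\<lambda>t. a * Vol f \<phi> t)"
  proof
    fix x
    show "Vol f (\<lambda>t. a * \<phi> t) x = a * Vol f \<phi> x"
    proof (cases "x \<in> I")
      case True
      have "Vol f (\<lambda>t. a * \<phi> t) x = conv f (\<lambda>\<tau> y. a * \<phi> \<tau>) x c"
        by (rule Vol_conv[OF test_cmult[OF t] f c(1) _ True]) (use c in auto)
      also have "\<dots> = a * conv f (\<lambda>\<tau> y. \<phi> \<tau>) x c"
        using conv_mult_right[of f "\<lambda>\<tau> y. \<phi> \<tau>" "\<lambda>_. a" x c] by (simp add: mult.commute)
      finally show ?thesis using Vol_conv[OF t f c(1,2) True] by simp
    qed (simp add: Vol_off)
  qed
qed (use Vol_off Vol_test[OF f] in auto)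

lemma Mult_apply: "Mult g \<phi> x = (if \<phi> \<in> T \<and> x \<in> I then g x x * \<phi> x else 0)"
  by (simp add: delta_dist_def)

lemma Op_Mult: assumes g: "smooth2 I g" shows "Mult g \<in> Op I"
proof (rule OpI)
  fix \<phi> assume t: "\<phi> \<in> T"
  obtain c where c: "c \<in> I" "\<And>t. t \<le> c \<Longrightarrow> \<phi> t = 0" "c \<in> interior I" by (rule test_funE[OF t]) blast
  show "Mult g \<phi> \<in> T"
    by (rule testI[OF smooth2_mult[OF smooth2_diag[OF g] test_smooth2[OF t]] c(1) _ _ c(3)])
      (use t c in \<open>auto simp: Mult_apply\<close>)
qed (use test_add test_cmult in \<open>auto simp: Mult_apply fun_eq_iff algebra_simps\<close>)

lemma D_deriv:
  assumes "\<phi> \<in> T" "t \<in> I"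
  shows "(\<phi> has_vector_derivative D \<phi> t) (at t within I)"
proof -
  have 1: "(\<phi> has_vector_derivative dx I (\<lambda>x y. \<phi> x) t t) (at t within I)"
    using smooth2_dx(1)[OF test_smooth2[OF assms(1)]] assms(2) by (auto simp: pd1_def)
  then have "deriv_on I \<phi> t = dx I (\<lambda>x y. \<phi> x) t t" by (rule deriv_on_eqI[OF ivl int assms(2)])
  then show ?thesis using 1 assms by (simp add: delta_apply)
qed

lemma D_eqI: "\<phi> \<in> T \<Longrightarrow> t \<in> I \<Longrightarrow> (\<phi> has_vector_derivative a) (at t within I) \<Longrightarrow> D \<phi> t = a"
  using D_deriv vd_unique by blast

lemma D_off: "\<phi> \<notin> T \<Longrightarrow> D \<phi> = 0" "x \<notin> I \<Longrightarrow> D \<phi> x = 0"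
  by (auto simp: delta_apply)

lemma Op_D: "D \<in> Op I"
proof (rule OpI)
  fix \<phi> \<psi> assume t: "\<phi> \<in> T" "\<psi> \<in> T"
  show "D (\<phi> + \<psi>) = D \<phi> + D \<psi>"
  proof
    fix x
    show "D (\<phi> + \<psi>) x = (D \<phi> + D \<psi>) x"
    proof (cases "x \<in> I")
      case True
      have "((\<lambda>x. \<phi> x + \<psi> x) has_vector_derivative D \<phi> x + D \<psi> x) (at x within I)"
        by (intro has_vector_derivative_add D_deriv t True)
      then show ?thesis using D_eqI[OF test_add[OF t] True] by (simp add: plus_fun_def)
    qed (simp add: D_off)
  qed
next
  fix a \<phi> assume t: "\<phi> \<in> T"
  show "D (\<lambda>t. a * \<phi> t) = (\<lambda>t. a * D \<phi> t)"
  proof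
    fix x
    show "D (\<lambda>t. a * \<phi> t) x = a * D \<phi> x"
    proof (cases "x \<in> I")
      case True
      have "((\<lambda>x. a * \<phi> x) has_vector_derivative a * D \<phi> x) (at x within I)"
        using D_deriv[OF t True] by (rule has_vector_derivative_mult_right)
      then show ?thesis using D_eqI[OF test_cmult[OF t] True] by simp
    qed (simp add: D_off)
  qed
qed (use D_off delta_1_test[OF ivl int, unfolded One_nat_def] in auto)

lemma Vol_cong: "(\<And>x y. x \<in> I \<Longrightarrow> y \<in> I \<Longrightarrow> f x y = g x y) \<Longrightarrow> Vol f = Vol g"
  unfolding Theta_dist_def by (intro ext if_cong refl integral_cong) auto

lemma Mult_cong: "(\<And>x. x \<in> I \<Longrightarrow> f x x = g x x) \<Longrightarrow> Mult f = Mult g"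
  by (auto simp: fun_eq_iff Mult_apply)

text \<open>Products of operators are recognised as integral operators by computing them as signed integrals.\<close>

lemma Vol_eqI:
  assumes "smooth2 I f" "\<And>\<phi> c x. \<phi> \<in> T \<Longrightarrow> c \<in> I \<Longrightarrow> (\<And>t. t \<le> c \<Longrightarrow> \<phi> t = 0) \<Longrightarrow> c \<in> interior I \<Longrightarrow> x \<in> I \<Longrightarrow>
     X \<phi> x = conv f (\<lambda>\<tau> y. \<phi> \<tau>) x c"
   "\<And>\<phi>. \<phi> \<notin> T \<Longrightarrow> X \<phi> = 0" "\<And>\<phi> x. x \<notin> I \<Longrightarrow> X \<phi> x = 0"
  shows "X = Vol f"
proof (intro ext)
  fix \<phi> x
  show "X \<phi> x = Vol f \<phi> x"
  proof (cases "\<phi> \<in> T \<and> x \<in> I")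
    case True
    obtain c where c: "c \<in> I" "\<And>t. t \<le> c \<Longrightarrow> \<phi> t = 0" "c \<in> interior I" using True test_funE by metis
    show ?thesis using assms(2)[of \<phi> c x] Vol_conv[of \<phi> f c x] True c assms(1) by auto
  next
    case False
    then show ?thesis using assms(3,4) Vol_off by auto
  qed
qed

lemma Vol_add:
  assumes "smooth2 I f" "smooth2 I g" shows "Vol f + Vol g = Vol (\<lambda>x y. f x y + g x y)"
proof (rule Vol_eqI[OF smooth2_add[OF assms]])
  fix \<phi> c x assume *: "\<phi> \<in> T" "c \<in> I" "\<And>t. t \<le> c \<Longrightarrow> \<phi> t = 0" "x \<in> I"
  show "(Vol f + Vol g) \<phi> x = conv (\<lambda>x y. f x y + g x y) (\<lambda>\<tau> y. \<phi> \<tau>) x c"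
    using Vol_conv[OF *(1) assms(1) *(2,3,4)] Vol_conv[OF *(1) assms(2) *(2,3,4)]
      conv_add_left[OF smooth2_cont[OF assms(1)] smooth2_cont[OF assms(2)] smooth2_cont[OF test_smooth2[OF *(1)]] *(4,2)] by simp
qed (auto simp: Vol_off)

lemma Mult_add: "Mult f + Mult g = Mult (\<lambda>x y. f x y + g x y)"
  by (auto simp: fun_eq_iff Mult_apply algebra_simps)

lemma Mult_Vol:
  assumes "smooth2 I g" "smooth2 I f" shows "Mult g \<star> Vol f = Vol (\<lambda>x y. g x x * f x y)"
proof (rule Vol_eqI[OF smooth2_mult[OF smooth2_diag[OF assms(1)] assms(2)]])
  fix \<phi> c x assume *: "\<phi> \<in> T" "c \<in> I" "\<And>t. t \<le> c \<Longrightarrow> \<phi> t = 0" "x \<in> I"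
  show "(Mult g \<star> Vol f) \<phi> x = conv (\<lambda>x y. g x x * f x y) (\<lambda>\<tau> y. \<phi> \<tau>) x c"
    using Vol_conv[OF *(1) assms(2) *(2,3,4)] * Vol_test[OF assms(2) *(1)]
    by (simp add: star_def Mult_apply conv_mult_left[of "\<lambda>x. g x x"])
qed (auto simp: star_def Mult_apply Vol_off fun_eq_iff)

lemma Vol_Mult:
  assumes "smooth2 I f" "smooth2 I g" shows "Vol f \<star> Mult g = Vol (\<lambda>x y. f x y * g y y)"
proof (rule Vol_eqI[OF smooth2_mult[OF assms(1) smooth2_swap[OF smooth2_diag[OF assms(2)]]]])
  fix \<phi> c x assume *: "\<phi> \<in> T" "c \<in> I" "\<And>t. t \<le> c \<Longrightarrow> \<phi> t = 0" "x \<in> I"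
  have z: "Mult g \<phi> t = 0" if "t \<le> c" for t using * that by (simp add: Mult_apply)
  have "(Vol f \<star> Mult g) \<phi> x = conv f (\<lambda>\<tau> y. Mult g \<phi> \<tau>) x c"
    using Vol_conv[OF Op_T[OF Op_Mult[OF assms(2)]] assms(1) *(2) z *(4)] by (simp add: star_def)
  also have "\<dots> = conv (\<lambda>x y. f x y * g y y) (\<lambda>\<tau> y. \<phi> \<tau>) x c"
    unfolding conv_def by (rule sint_cong) (use * in \<open>auto simp: Mult_apply\<close>)
  finally show "(Vol f \<star> Mult g) \<phi> x = conv (\<lambda>x y. f x y * g y y) (\<lambda>\<tau> y. \<phi> \<tau>) x c" .
next
  fix \<phi> assume "\<phi> \<notin> T"
  then have "Mult g \<phi> = 0" by (auto simp: Mult_apply fun_eq_iff)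
  then show "(Vol f \<star> Mult g) \<phi> = 0" using addi_zero[OF Op_addi[OF Op_Vol[OF assms(1)]]] by (simp add: star_def)
qed (auto simp: star_def Vol_off)

lemma Mult_Mult: "smooth2 I g \<Longrightarrow> Mult f \<star> Mult g = Mult (\<lambda>x y. f x y * g x y)"
  using Op_T[OF Op_Mult[of g]] by (auto simp: fun_eq_iff star_def) (auto simp: Mult_apply)

lemma Vol_Vol:
  assumes "smooth2 I f" "smooth2 I g" shows "Vol f \<star> Vol g = Vol (conv f g)"
proof (rule Vol_eqI[OF smooth2_conv[OF assms]])
  fix \<phi> c x assume *: "\<phi> \<in> T" "c \<in> I" "\<And>t. t \<le> c \<Longrightarrow> \<phi> t = 0" "x \<in> I"
  have z: "Vol g \<phi> t = 0" if "t \<le> c" for t by (rule Vol_left_zero[OF *(1,3) that])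
  have "(Vol f \<star> Vol g) \<phi> x = conv f (\<lambda>\<tau> y. Vol g \<phi> \<tau>) x c"
    using Vol_conv[OF Vol_test[OF assms(2) *(1)] assms(1) *(2) z *(4)] by (simp add: star_def)
  also have "\<dots> = conv f (conv g (\<lambda>\<tau> y. \<phi> \<tau>)) x c"
    unfolding conv_def[of f] by (rule sint_cong) (use * Vol_conv[OF *(1) assms(2) *(2,3)] in auto)
  also have "\<dots> = conv (conv f g) (\<lambda>\<tau> y. \<phi> \<tau>) x c"
    by (intro conv_assoc smooth2_cont assms test_smooth2 *)
  finally show "(Vol f \<star> Vol g) \<phi> x = conv (conv f g) (\<lambda>\<tau> y. \<phi> \<tau>) x c" .
next
  fix \<phi> assume "\<phi> \<notin> T"
  then have "Vol g \<phi> = 0" by (rule Vol_off)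
  then show "(Vol f \<star> Vol g) \<phi> = 0" using addi_zero[OF Op_addi[OF Op_Vol[OF assms(1)]]] by (simp add: star_def)
qed (auto simp: star_def Vol_off)

lemma D_Vol:
  assumes "smooth2 I f" shows "D \<star> Vol f = Mult f + Vol (dx I f)"
proof (intro ext)
  fix \<phi> x
  show "(D \<star> Vol f) \<phi> x = (Mult f + Vol (dx I f)) \<phi> x"
  proof (cases "\<phi> \<in> T \<and> x \<in> I")
    case True
    then have t: "\<phi> \<in> T" and x: "x \<in> I" by auto
    obtain c where c: "c \<in> I" "\<And>t. t \<le> c \<Longrightarrow> \<phi> t = 0" by (rule test_funE[OF t]) blast
    note p = smooth2_dx[OF assms]
    have "((\<lambda>x. conv f (\<lambda>\<tau> y. \<phi> \<tau>) x c) has_vector_derivative f x x * \<phi> x + conv (dx I f) (\<lambda>\<tau> y. \<phi> \<tau>) x c) (at x within I)"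
      using conv_pd1[OF smooth2_cont[OF assms] p(1) smooth2_cont[OF p(2)] smooth2_cont[OF test_smooth2[OF t]]] x c
      by (auto simp: pd1_def)
    then have "(Vol f \<phi> has_vector_derivative f x x * \<phi> x + conv (dx I f) (\<lambda>\<tau> y. \<phi> \<tau>) x c) (at x within I)"
      by (rule has_vector_derivative_transform[OF x, rotated]) (rule Vol_conv[OF t assms c])
    then show ?thesis
      using D_eqI[OF Vol_test[OF assms t] x] Vol_conv[OF t p(2) c x] t x by (simp add: star_def Mult_apply)
  next
    case False
    then show ?thesis using addi_zero[OF Op_addi[OF Op_D]] D_off Vol_off by (auto simp: star_def Mult_apply)
  qed
qed

lemma Mult_uminus: "- Mult f = Mult (\<lambda>x y. - f x y)" by (auto simp: fun_eq_iff Mult_apply)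
lemma Vol_uminus: "- Vol f = Vol (\<lambda>x y. - f x y)"
  by (auto simp: fun_eq_iff Theta_dist_def)

lemma Vol_D:
  assumes "smooth2 I f" shows "Vol f \<star> D = Mult f + Vol (\<lambda>x y. - dy I f x y)"
  using star_Theta_dist_delta_1[OF ivl int assms, unfolded One_nat_def]
  by (simp add: dy_def[abs_def] add.commute Mult_cong[of "\<lambda>x y. f x x" f])

lemma D_Mult:
  assumes "smooth2 I g" shows "D \<star> Mult g = Mult g \<star> D + Mult (dx I (\<lambda>x y. g x x))"
proof (intro ext)
  fix \<phi> x
  show "(D \<star> Mult g) \<phi> x = (Mult g \<star> D + Mult (dx I (\<lambda>x y. g x x))) \<phi> x"
  proof (cases "\<phi> \<in> T \<and> x \<in> I")
    case True
    then have t: "\<phi> \<in> T" and x: "x \<in> I" by auto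
    have "((\<lambda>x. g x x) has_vector_derivative dx I (\<lambda>x y. g x x) x x) (at x within I)"
      using smooth2_dx(1)[OF smooth2_diag[OF assms]] x by (auto simp: pd1_def)
    from has_vector_derivative_mult[OF this D_deriv[OF t x]]
    have "(Mult g \<phi> has_vector_derivative g x x * D \<phi> x + dx I (\<lambda>x y. g x x) x x * \<phi> x) (at x within I)"
      by (rule has_vector_derivative_transform[OF x, rotated]) (use t in \<open>auto simp: Mult_apply\<close>)
    from D_eqI[OF Op_T[OF Op_Mult[OF assms]] x this]
    show ?thesis using t x Op_T[OF Op_D, of \<phi>] by (simp add: star_def Mult_apply)
  next
    case False
    have "Mult g \<phi> = 0" if "\<phi> \<notin> T" using that by (auto simp: Mult_apply fun_eq_iff)
    then show ?thesis using False addi_zero[OF Op_addi[OF Op_D]] D_off by (auto simp: star_def Mult_apply)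
  qed
qed

lemma Theta_Vol: "\<Theta> = Vol (\<lambda>x y. 1)" by (simp add: Theta_def)
lemma one_Mult: "one_star I = Mult (\<lambda>x y. 1)" by (simp add: delta_def)

lemma Vol_zero: "Vol (\<lambda>x y. 0) = 0" by (auto simp: fun_eq_iff Theta_dist_def)
lemma Mult_zero: "Mult (\<lambda>x y. 0) = 0" by (auto simp: fun_eq_iff Mult_apply)

lemma D_Theta: "D \<star> \<Theta> = one_star I"
proof -
  have "Vol (dx I (\<lambda>x y. 1)) = Vol (\<lambda>x y. 0)"
    by (rule Vol_cong) (auto simp: dx_def intro!: vector_derivative_within at_I_nontrivial)
  then show ?thesis unfolding Theta_Vol D_Vol[OF smooth2_const] one_Mult by (simp add: Vol_zero)
qed

lemma Theta_D: "\<Theta> \<star> D = one_star I"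
proof -
  have "Vol (\<lambda>x y. - dy I (\<lambda>x y. 1) x y) = Vol (\<lambda>x y. 0)"
    by (rule Vol_cong) (auto simp: dy_def intro!: vector_derivative_within at_I_nontrivial)
  then show ?thesis unfolding Theta_Vol Vol_D[OF smooth2_const] one_Mult by (simp add: Vol_zero)
qed

lemma Op_Theta: "\<Theta> \<in> Op I" unfolding Theta_Vol by (rule Op_Vol[OF smooth2_const])

end

section \<open>Kernels are determined by their operators\<close>

text \<open>With \<open>p = 1\<close> these are the functions \<open>exp(-1/(s-c))\<close> for \<open>s > c\<close>, continued by \<open>0\<close>, which are smooth but vanish on the
  left of \<open>c\<close>; the polynomial factor makes the family closed under differentiation.\<close>

definition flat :: "real poly \<Rightarrow> real \<Rightarrow> real \<Rightarrow> real" where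
  "flat p c s = (if s \<le> c then 0 else poly p (inverse (s - c)) * exp (- inverse (s - c)))"

definition flat_deriv :: "real poly \<Rightarrow> real poly" where
  "flat_deriv p = [:0, 0, 1:] * (p - pderiv p)"

lemma poly_exp_tendsto: "((\<lambda>u::real. poly q u * exp (- u)) \<longlongrightarrow> 0) at_top"
proof -
  have "((\<lambda>u::real. \<Sum>i\<le>degree q. coeff q i * (u ^ i / exp u)) \<longlongrightarrow> (\<Sum>i\<le>degree q. coeff q i * 0)) at_top"
    by (intro tendsto_sum tendsto_mult tendsto_const tendsto_power_div_exp_0)
  moreover have "(\<lambda>u::real. \<Sum>i\<le>degree q. coeff q i * (u ^ i / exp u)) = (\<lambda>u. poly q u * exp (- u))"
    by (simp add: poly_altdef sum_distrib_right exp_minus divide_inverse mult.assoc)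
  ultimately show ?thesis by simp
qed

lemma flat_has_deriv: "(flat p c has_real_derivative flat (flat_deriv p) c s) (at s)"
proof -
  consider "s < c" | "s = c" | "s > c" by linarith
  then show ?thesis
  proof cases
    case 1
    have "((\<lambda>_. 0) has_real_derivative 0) (at s)" by simp
    then show ?thesis
      by (rule has_field_derivative_transform_within_open[of _ _ _ "{..<c}", THEN DERIV_cong])
        (use 1 in \<open>auto simp: flat_def\<close>)
  next
    case 2
    have "((\<lambda>z. (flat p c z - flat p c c) / (z - c)) \<longlongrightarrow> 0) (at c)"
    proof (rule filterlim_split_at)
      show "((\<lambda>z. (flat p c z - flat p c c) / (z - c)) \<longlongrightarrow> 0) (at_left c)"
        by (rule tendsto_eventually) (auto simp: flat_def eventually_at_filter)
      have "filterlim (\<lambda>z. inverse (z - c)) at_top (at_right c)"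
        by (subst at_right_to_0, subst filterlim_filtermap) (simp add: filterlim_inverse_at_top_right)
      from filterlim_compose[OF poly_exp_tendsto[of "[:0, 1:] * p"] this]
      have "((\<lambda>z. poly ([:0, 1:] * p) (inverse (z - c)) * exp (- inverse (z - c))) \<longlongrightarrow> 0) (at_right c)" .
      moreover have "\<forall>\<^sub>F z in at_right c. poly ([:0, 1:] * p) (inverse (z - c)) * exp (- inverse (z - c)) =
          (flat p c z - flat p c c) / (z - c)"
        by (auto simp: flat_def eventually_at_filter divide_inverse)
      ultimately show "((\<lambda>z. (flat p c z - flat p c c) / (z - c)) \<longlongrightarrow> 0) (at_right c)"
        by (rule Lim_transform_eventually)
    qed
    then show ?thesis using 2 by (simp add: has_field_derivative_iff flat_def)
  next
    case 3
    have "((\<lambda>s. poly p (inverse (s - c)) * exp (- inverse (s - c))) has_real_derivative flat (flat_deriv p) c s) (at s)"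
      using 3 by (auto intro!: derivative_eq_intros simp: flat_def flat_deriv_def algebra_simps power2_eq_square)
    then show ?thesis
      by (rule has_field_derivative_transform_within_open[of _ _ _ "{c<..}"])
        (use 3 in \<open>auto simp: flat_def\<close>)
  qed
qed

lemma flat_1_pos: "c < s \<Longrightarrow> 0 < flat 1 c s" by (simp add: flat_def)
lemma flat_zero: "s \<le> c \<Longrightarrow> flat p c s = 0" by (simp add: flat_def)
lemma flat_1_mono: "s \<le> t \<Longrightarrow> flat 1 c s \<le> flat 1 c t"
  by (auto simp: flat_def le_imp_inverse_le)
lemma flat_1_nonneg: "0 \<le> flat 1 c s" by (simp add: flat_def)

context time_interval
begin

lemma flat_smooth1: "smooth1 I (\<lambda>t. of_real (flat p c t))"
proof -
  have "((\<lambda>t. complex_of_real (flat q c t)) has_vector_derivative of_real (flat (flat_deriv q) c t)) (at t within I)" for q t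
    by (rule has_vector_derivative_of_real[OF has_field_derivative_at_within[OF flat_has_deriv]])
  then show ?thesis unfolding smooth1_def
    by (intro exI[of _ "\<lambda>k t. of_real (flat ((flat_deriv ^^ k) p) c t)"]) simp
qed

lemma flat_test:
  assumes "smooth2 I h" "x \<in> I" "c \<in> interior I"
  shows "(\<lambda>t. if t \<in> I then h t x * of_real (flat 1 c t) else 0) \<in> T"
proof (rule testI[of "\<lambda>t y. h t y * of_real (flat 1 c t)" x _ c])
  show "smooth2 I (\<lambda>t y. h t y * complex_of_real (flat 1 c t))"
    by (rule smooth2_mult[OF assms(1) smooth1_smooth2[OF flat_smooth1]])
qed (use assms in \<open>auto simp: flat_zero\<close>)

lemma interior_below:
  assumes "c \<in> interior I" "t \<in> I" "c \<le> s" "s < t" shows "s \<in> interior I"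
proof -
  obtain e where e: "e > 0" "ball c e \<subseteq> interior I" using assms(1) open_contains_ball open_interior by metis
  have "c - e/2 \<in> ball c e" using e(1) by (simp add: dist_real_def)
  then have "c - e/2 \<in> I" using e(2) interior_subset by blast
  then have "{c - e/2<..<t} \<subseteq> I" using Icc_I[of "c - e/2" t] assms(2) by force
  then have "{c - e/2<..<t} \<subseteq> interior I" by (rule interior_maximal) simp
  then show ?thesis using assms e by auto
qed

lemma interior_between:
  assumes "x \<in> I" "y \<in> I" "x < y" shows "\<exists>c\<in>interior I. x < c \<and> c < y"
proof -
  have "{x<..<y} \<subseteq> I" using Icc_I[OF assms(1,2)] by force
  then have "{x<..<y} \<subseteq> interior I" by (rule interior_maximal) simp
  then show ?thesis using assms(3) by (intro bexI[of _ "(x + y) / 2"]) auto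
qed

text \<open>At a left end point of \<open>I\<close> no test function is available on the left, but continuity carries over what
  is known at all other points.\<close>

lemma zero_by_density:
  assumes h: "continuous_on I h" and t: "t \<in> I" and e: "e > 0"
    and z: "\<And>s c. s \<in> I \<Longrightarrow> c \<in> interior I \<Longrightarrow> c < s \<Longrightarrow> \<bar>s - t\<bar> < e \<Longrightarrow> h s = (0::complex)"
  shows "h t = 0"
proof (cases "\<exists>c\<in>interior I. c < t")
  case True
  then show ?thesis using z[OF t] e by auto
next
  case False
  have lim: "(h \<longlongrightarrow> h t) (at t within I)" using h t by (auto simp: continuous_on)
  have "\<forall>\<^sub>F s in at t within I. h s = 0"
    unfolding eventually_at
  proof (intro exI[of _ e] conjI ballI impI e)
    fix s assume s: "s \<in> I" "s \<noteq> t \<and> dist s t < e"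
    have "t < s" using interior_between[OF s(1) t] False s(2) by force
    then obtain c where "c \<in> interior I" "t < c" "c < s" using interior_between[OF t s(1)] by blast
    then show "h s = 0" using z[OF s(1)] s by (simp add: dist_real_def)
  qed
  then have "(h \<longlongrightarrow> 0) (at t within I)" by (rule tendsto_eventually)
  with lim show ?thesis using tendsto_unique[OF at_I_nontrivial[OF t]] by blast
qed

text \<open>Applied to \<open>exp(-1/(t-c))\<close>, which is increasing, the integral operator contributes at \<open>s\<close> at most \<open>M (s - c)\<close> times
  the value of the test function at \<open>s\<close>.  As \<open>c\<close> tends to \<open>s\<close>, this forces \<open>g s s = 0\<close>.\<close>

lemma kernel_unique_diag:
  assumes f: "smooth2 I f" and g: "smooth2 I g" and eq: "Vol f + Mult g = 0" and t: "t \<in> I"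
  shows "g t t = 0"
proof (rule zero_by_density[of "\<lambda>t. g t t" t 1])
  show "continuous_on I (\<lambda>t. g t t)"
    by (rule cont2_compose[OF smooth2_cont[OF g]]) (auto intro!: continuous_intros)
  fix s c0 assume s: "s \<in> I" "c0 \<in> interior I" "c0 < s"
  have c0: "c0 \<in> I" using s interior_subset by auto
  obtain M where M: "0 \<le> M" "\<And>i j x y. i \<in> {()} \<Longrightarrow> j \<in> {()} \<Longrightarrow> x \<in> {c0..s} \<Longrightarrow> y \<in> {c0..s} \<Longrightarrow> norm (f x y) \<le> M"
    using cont2_bounded[of "{()}" "\<lambda>_ _. f" c0 s] smooth2_cont[OF f] Icc_I[OF c0 s(1)]
    by (metis finite.emptyI finite_insert)
  show "g s s = 0"
  proof (rule ccontr)
    assume ne: "g s s \<noteq> 0"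
    define q where "q = norm (g s s) / (2 * (M + 1))"
    have q: "q > 0" using ne M(1) by (simp add: q_def)
    \<comment> \<open>so close to \<open>s\<close> that the integral is at most half of \<open>|g s s|\<close> times the test function\<close>
    define c where "c = max c0 (s - q)"
    have c: "c0 \<le> c" "c < s" "s - c \<le> q" using s q by (auto simp: c_def)
    have ci: "c \<in> interior I" by (rule interior_below[OF s(2,1) c(1,2)])
    then have cI: "c \<in> I" using interior_subset by auto
    define \<phi> where "\<phi> = (\<lambda>t. if t \<in> I then 1 * complex_of_real (flat 1 c t) else 0)"
    have \<phi>: "\<phi> \<in> T" unfolding \<phi>_def by (rule flat_test[OF smooth2_const cI ci])
    have z: "\<phi> t = 0" if "t \<le> c" for t using that by (simp add: \<phi>_def flat_zero)
    have sub: "{c..s} \<subseteq> I" by (rule Icc_I[OF cI s(1)])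
    have "norm (conv f (\<lambda>\<tau> y. \<phi> \<tau>) s c) \<le> M * flat 1 c s * \<bar>s - c\<bar> ^ Suc 0 / real (Suc 0)"
    proof (rule conv_bound[OF smooth2_cont[OF f] smooth2_cont[OF test_smooth2[OF \<phi>]] sub _ _ M(1)])
      show "norm (f s \<tau>) \<le> M" if "\<tau> \<in> {c..s}" for \<tau> using M(2) that s c by auto
      show "norm (\<phi> \<tau>) \<le> flat 1 c s * \<bar>\<tau> - c\<bar> ^ 0" if "\<tau> \<in> {c..s}" for \<tau>
        using that sub flat_1_mono[of \<tau> s c] flat_1_nonneg[of c \<tau>] by (auto simp: \<phi>_def)
    qed (use c in auto)
    then have 1: "norm (Vol f \<phi> s) \<le> M * flat 1 c s * (s - c)"
      using Vol_conv[OF \<phi> f cI z s(1)] c by simp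
    have "(Vol f + Mult g) \<phi> s = 0" by (simp add: eq)
    then have "Vol f \<phi> s = - (g s s * \<phi> s)" using \<phi> s by (simp add: Mult_apply eq_neg_iff_add_eq_0)
    then have "norm (Vol f \<phi> s) = norm (g s s) * flat 1 c s"
      using s flat_1_nonneg[of c s] by (simp add: norm_mult \<phi>_def)
    then have "norm (g s s) * flat 1 c s \<le> (M * (s - c)) * flat 1 c s" using 1 by (simp add: mult_ac)
    then have "norm (g s s) \<le> M * (s - c)" using flat_1_pos[OF c(2)] by simp
    also have "\<dots> \<le> M * q" using c M by (intro mult_left_mono) auto
    also have "\<dots> \<le> (M + 1) * q" using q by simp
    also have "\<dots> = norm (g s s) / 2" using M(1) by (simp add: q_def field_simps)
    finally show False using ne by simp
  qed
qed (use t in auto)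

text \<open>Testing with \<open>exp(-1/(t-c))\<close> times the complex conjugate of \<open>f x\<close> yields a vanishing integral of a
  nonnegative continuous function.\<close>

lemma kernel_unique_off:
  assumes f: "smooth2 I f" and eq: "Vol f = 0" and x: "x \<in> I" and t: "t \<in> I" "t \<le> x"
  shows "f x t = 0"
proof -
  have *: "f x s = 0" if s: "s \<in> I" "s \<le> x" "c \<in> interior I" "c < s" and x: "x \<in> I" for x s c
  proof -
    have cI: "c \<in> I" using s interior_subset by auto
    have cx: "c \<le> x" using s by simp
    define fc where "fc = (\<lambda>x y. cnj (f x y))"
    define \<phi> where "\<phi> = (\<lambda>t. if t \<in> I then (\<lambda>s x. cnj (f x s)) t x * complex_of_real (flat 1 c t) else 0)"
    have "smooth2 I (\<lambda>x y. cnj (f x y))"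
    proof -
      have "Ck I n g \<Longrightarrow> Ck I n (\<lambda>x y. cnj (g x y))" for n g
      proof (induction n arbitrary: g)
        case 0
        then show ?case by (auto simp: case_prod_unfold intro!: continuous_intros)
      next
        case (Suc n)
        obtain f1 f2 where f: "pd1 I g f1" "pd2 I g f2" "Ck I n f1" "Ck I n f2" "cont2 g"
          by (rule Ck_SucE[OF Suc.prems])
        have "cont2 (\<lambda>x y. cnj (g x y))" using f(5) by (auto simp: case_prod_unfold intro!: continuous_intros)
        then show ?case
          by (intro Ck_SucI[of _ "\<lambda>x y. cnj (f1 x y)" "\<lambda>x y. cnj (f2 x y)"] Suc.IH f)
            (use f(1,2) in \<open>auto simp: pd1_def pd2_def intro!: has_vector_derivative_cnj\<close>)
      qed
      then show ?thesis using f by (simp add: smooth2_iff)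
    qed
    then have \<phi>: "\<phi> \<in> T" unfolding \<phi>_def by (intro flat_test[OF smooth2_swap] x s)
    have z: "\<phi> t = 0" if "t \<le> c" for t using that by (simp add: \<phi>_def flat_zero)
    have sub: "{c..x} \<subseteq> I" by (rule Icc_I[OF cI x])
    let ?h = "\<lambda>\<tau>. f x \<tau> * \<phi> \<tau>"
    have hc: "continuous_on I ?h"
      using conv_integrand[OF smooth2_cont[OF f] smooth2_cont[OF test_smooth2[OF \<phi>]] x x] by simp
    have "Vol f \<phi> x = 0" by (simp add: eq)
    then have "sint c x ?h = 0" using Vol_conv[OF \<phi> f cI z x] by (simp add: conv_def)
    then have "integral {c..x} ?h = 0" using sint_integral[OF hc cI x cx] by simp
    moreover have hint: "?h integrable_on {c..x}"
      by (intro integrable_continuous_real continuous_on_subset[OF hc] sub)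
    ultimately have "(?h has_integral 0) {c..x}" by (metis integrable_integral)
    from has_integral_linear[OF this bounded_linear_Re]
    have 0: "((\<lambda>\<tau>. Re (?h \<tau>)) has_integral 0) (cbox c x)" by (simp add: o_def)
    have re: "Re (?h \<tau>) = (cmod (f x \<tau>))\<^sup>2 * flat 1 c \<tau>" if "\<tau> \<in> {c..x}" for \<tau>
    proof -
      have "Re (?h \<tau>) = ((Re (f x \<tau>))\<^sup>2 + (Im (f x \<tau>))\<^sup>2) * flat 1 c \<tau>"
        using that sub by (auto simp: \<phi>_def power2_eq_square algebra_simps)
      then show ?thesis by (simp add: cmod_power2)
    qed
    have "continuous_on (cbox c x) (\<lambda>\<tau>. Re (?h \<tau>))"
      unfolding cbox_interval by (intro continuous_on_Re continuous_on_subset[OF hc] sub)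
    moreover have "0 \<le> Re (?h \<tau>)" if "\<tau> \<in> cbox c x" for \<tau>
      using re[of \<tau>] that flat_1_nonneg[of c \<tau>] by (simp del: times_complex.simps)
    moreover have "box c x \<noteq> {}" using s by auto
    ultimately have "Re (?h s) = 0"
      by (intro has_integral_0_cbox_imp_0[OF _ _ 0]) (use s in auto)
    then show ?thesis using re[of s] s flat_1_pos[of c s] by auto
  qed
  have c2: "continuous_on I (\<lambda>t. f x t)" by (rule cont2_1[OF smooth2_cont[OF f] x])
  have c3: "continuous_on I (\<lambda>t. f t t)"
    by (rule cont2_compose[OF smooth2_cont[OF f]]) (auto intro!: continuous_intros)
  show ?thesis
  proof (cases "t < x")
    case True
    then show ?thesis
      by (intro zero_by_density[OF c2 t(1), of "x - t"]) (use * x in auto)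
  next
    case False
    then have "t = x" using t by simp
    then show ?thesis using zero_by_density[OF c3 t(1), of 1] * by auto
  qed
qed

lemma kernel_unique:
  assumes f: "smooth2 I f" and g: "smooth2 I g" and f': "smooth2 I f'" and g': "smooth2 I g'"
    and eq: "Vol f + Mult g = Vol f' + Mult g'"
  shows "t \<in> I \<Longrightarrow> g t t = g' t t" "x \<in> I \<Longrightarrow> t \<in> I \<Longrightarrow> t \<le> x \<Longrightarrow> f x t = f' x t"
proof -
  have "Vol (\<lambda>x y. f x y + - f' x y) = Vol f - Vol f'"
    unfolding Vol_add[OF f smooth2_minus[OF f'], symmetric] Vol_uminus[symmetric] by simp
  moreover have "Mult (\<lambda>x y. g x y + - g' x y) = Mult g - Mult g'"
    unfolding Mult_add[symmetric] Mult_uminus[symmetric] by simp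
  ultimately have "Vol (\<lambda>x y. f x y + - f' x y) + Mult (\<lambda>x y. g x y + - g' x y) =
      (Vol f + Mult g) - (Vol f' + Mult g')"
    by (simp only: add_diff_add)
  then have 0: "Vol (\<lambda>x y. f x y + - f' x y) + Mult (\<lambda>x y. g x y + - g' x y) = 0"
    unfolding eq diff_self .
  have s: "smooth2 I (\<lambda>x y. f x y + - f' x y)" "smooth2 I (\<lambda>x y. g x y + - g' x y)"
    by (intro smooth2_add smooth2_minus assms)+
  have d: "g t t + - g' t t = 0" if "t \<in> I" for t by (rule kernel_unique_diag[OF s 0 that])
  then show "t \<in> I \<Longrightarrow> g t t = g' t t" by simp
  have "Mult (\<lambda>x y. g x y + - g' x y) = 0" unfolding Mult_zero[symmetric] by (rule Mult_cong) (use d in auto)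
  then have "Vol (\<lambda>x y. f x y + - f' x y) = 0" using 0 by simp
  from kernel_unique_off[OF s(1) this]
  show "x \<in> I \<Longrightarrow> t \<in> I \<Longrightarrow> t \<le> x \<Longrightarrow> f x t = f' x t" by simp
qed

end

section \<open>The order of an operator\<close>

text \<open>The powers of the Heaviside function, which inverts the operator \<open>\<delta>'\<close>.\<close>

primrec tpow :: "real set \<Rightarrow> nat \<Rightarrow> dist" where
  "tpow I 0 = one_star I"
| "tpow I (Suc n) = Theta I \<star> tpow I n"

text \<open>The integer powers of \<open>\<delta>'\<close>: since no boundary terms arise for functions that vanish on the left,
  differentiation and integration are inverse to each other on test functions.\<close>

definition dpow :: "real set \<Rightarrow> int \<Rightarrow> dist" where
  "dpow I k = (if k \<ge> 0 then delta I (nat k) else tpow I (nat (- k)))"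

text \<open>The class \<open>Sm\<^sub>\<Theta>(I)\<close>.\<close>

definition Sm :: "real set \<Rightarrow> dist set" where
  "Sm I = {Theta_dist I f | f. smooth2 I f}"

text \<open>The ring of integral plus multiplication operators, in which \<open>Sm\<^sub>\<Theta>(I)\<close> is an ideal.\<close>

definition Sm1 :: "real set \<Rightarrow> dist set" where
  "Sm1 I = {Theta_dist I f + delta_dist I 0 g | f g. smooth2 I f \<and> smooth2 I g}"

text \<open>Operators that integrate at least \<open>k\<close> times (differentiate at most \<open>-k\<close> times, for negative \<open>k\<close>).  For
  \<open>k \<ge> 1\<close> these are the integral operators whose kernel vanishes to order \<open>k - 1\<close> at the diagonal.\<close>

definition Ord :: "real set \<Rightarrow> int \<Rightarrow> dist set" where
  "Ord I k = {X \<in> Op I. dpow I k \<star> X \<in> Sm1 I}"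

context time_interval
begin

lemma Vol_in_Sm: "smooth2 I f \<Longrightarrow> Vol f \<in> Sm I" by (auto simp: Sm_def)
lemma Vol_Mult_in_Sm1: "smooth2 I f \<Longrightarrow> smooth2 I g \<Longrightarrow> Vol f + Mult g \<in> Sm1 I" by (auto simp: Sm1_def)

lemma Sm_Sm1: "X \<in> Sm I \<Longrightarrow> X \<in> Sm1 I"
proof -
  assume "X \<in> Sm I"
  then obtain f where f: "X = Vol f" "smooth2 I f" by (auto simp: Sm_def)
  then have "X = Vol f + Mult (\<lambda>x y. 0)" by (simp add: Mult_zero)
  then show ?thesis using Vol_Mult_in_Sm1[OF f(2) smooth2_const] by simp
qed

lemma Mult_in_Sm1: "smooth2 I g \<Longrightarrow> Mult g \<in> Sm1 I"
  using Vol_Mult_in_Sm1[OF smooth2_const[of 0], of g] by (simp add: Vol_zero)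

lemma Sm1_Op: "X \<in> Sm1 I \<Longrightarrow> X \<in> Op I"
  by (auto simp: Sm1_def intro!: Op_add Op_Vol Op_Mult)

lemma Sm_Op: "X \<in> Sm I \<Longrightarrow> X \<in> Op I" using Sm_Sm1 Sm1_Op by blast

lemma Sm_add: "X \<in> Sm I \<Longrightarrow> Y \<in> Sm I \<Longrightarrow> X + Y \<in> Sm I"
  by (auto simp: Sm_def Vol_add intro!: smooth2_add)

lemma Sm1_add: assumes "X \<in> Sm1 I" "Y \<in> Sm1 I" shows "X + Y \<in> Sm1 I"
proof -
  obtain f g f' g' where *: "X = Vol f + Mult g" "Y =
      Vol f' + Mult g'" "smooth2 I f" "smooth2 I g" "smooth2 I f'" "smooth2 I g'"
    using assms unfolding Sm1_def by blast
  have "X + Y = (Vol f + Vol f') + (Mult g + Mult g')" unfolding *(1,2) by (simp only: add_ac)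
  then show ?thesis unfolding Vol_add[OF *(3,5)] Mult_add using * by (auto intro!: Vol_Mult_in_Sm1 smooth2_add)
qed

lemma Sm1_star: assumes "X \<in> Sm1 I" "Y \<in> Sm1 I" shows "X \<star> Y \<in> Sm1 I"
proof -
  obtain f g f' g' where *: "X = Vol f + Mult g" "Y =
      Vol f' + Mult g'" "smooth2 I f" "smooth2 I g" "smooth2 I f'" "smooth2 I g'"
    using assms unfolding Sm1_def by blast
  have eq: "X \<star> Y = (Vol f \<star> Vol f' + Vol f \<star> Mult g') + (Mult g \<star> Vol f' + Mult g \<star> Mult g')"
    unfolding *(1,2) star_add_left
      star_add_right[OF Op_addi[OF Op_Vol[OF *(3)]] Op_Vol[OF *(5)] Op_Mult[OF *(6)]]
      star_add_right[OF Op_addi[OF Op_Mult[OF *(4)]] Op_Vol[OF *(5)] Op_Mult[OF *(6)]] ..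
  show ?thesis unfolding eq Vol_Vol[OF *(3,5)] Vol_Mult[OF *(3,6)] Mult_Vol[OF *(4,5)] Mult_Mult[OF *(6)]
    by (intro Sm1_add Sm_Sm1[OF Vol_in_Sm] Mult_in_Sm1 smooth2_conv smooth2_mult smooth2_diag[OF *(4)]
      smooth2_swap[OF smooth2_diag[OF *(6)]] *)
qed

lemma Sm_Sm1_star: assumes "X \<in> Sm I" "Y \<in> Sm1 I" shows "X \<star> Y \<in> Sm I"
proof -
  obtain f f' g' where *: "X = Vol f" "Y = Vol f' + Mult g'" "smooth2 I f" "smooth2 I f'" "smooth2 I g'"
    using assms unfolding Sm1_def Sm_def by blast
  have eq: "X \<star> Y = Vol f \<star> Vol f' + Vol f \<star> Mult g'"
    unfolding *(1,2) star_add_right[OF Op_addi[OF Op_Vol[OF *(3)]] Op_Vol[OF *(4)] Op_Mult[OF *(5)]] ..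
  show ?thesis unfolding eq Vol_Vol[OF *(3,4)] Vol_Mult[OF *(3,5)]
    by (intro Sm_add Vol_in_Sm smooth2_conv smooth2_mult smooth2_swap[OF smooth2_diag[OF *(5)]] *)
qed

lemma Sm1_Sm_star: assumes "X \<in> Sm1 I" "Y \<in> Sm I" shows "X \<star> Y \<in> Sm I"
proof -
  obtain f f' g where *: "X = Vol f + Mult g" "Y = Vol f'" "smooth2 I f" "smooth2 I f'" "smooth2 I g"
    using assms unfolding Sm1_def Sm_def by blast
  have eq: "X \<star> Y = Vol f \<star> Vol f' + Mult g \<star> Vol f'" unfolding *(1,2) star_add_left ..
  show ?thesis unfolding eq Vol_Vol[OF *(3,4)] Mult_Vol[OF *(5,4)]
    by (intro Sm_add Vol_in_Sm smooth2_conv smooth2_mult smooth2_diag[OF *(5)] *)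
qed

lemma one_Sm1: "one_star I \<in> Sm1 I" unfolding one_Mult by (rule Mult_in_Sm1[OF smooth2_const])
lemma Theta_Sm: "\<Theta> \<in> Sm I" unfolding Theta_Vol by (rule Vol_in_Sm[OF smooth2_const])
lemma zero_Sm: "0 \<in> Sm I" unfolding Vol_zero[symmetric] by (rule Vol_in_Sm[OF smooth2_const])

lemma scale_Mult: "X \<in> Op I \<Longrightarrow> scale c X = Mult (\<lambda>x y. c) \<star> X"
  using Op_off[of X] Op_T[of X] by (auto simp: fun_eq_iff star_def Mult_apply scale_def test_outside)

lemma Sm1_scale: "X \<in> Sm1 I \<Longrightarrow> scale c X \<in> Sm1 I"
  using scale_Mult[OF Sm1_Op] Sm1_star[OF Mult_in_Sm1[OF smooth2_const]] by simp

lemma Sm_scale: "X \<in> Sm I \<Longrightarrow> scale c X \<in> Sm I"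
  using scale_Mult[OF Sm_Op] Sm1_Sm_star[OF Mult_in_Sm1[OF smooth2_const]] by simp

lemma uminus_scale: "- X = scale (-1) X" by (intro ext) (simp add: scale_def)

lemma Sm_uminus: "X \<in> Sm I \<Longrightarrow> - X \<in> Sm I" unfolding uminus_scale by (rule Sm_scale)

lemma D_Sm_in_Sm1: assumes "X \<in> Sm I" shows "D \<star> X \<in> Sm1 I" "X \<star> D \<in> Sm1 I"
proof -
  obtain f where f: "X = Vol f" "smooth2 I f" using assms by (auto simp: Sm_def)
  show "D \<star> X \<in> Sm1 I" "X \<star> D \<in> Sm1 I" unfolding f(1) D_Vol[OF f(2)] Vol_D[OF f(2)]
    by (intro Sm1_add Mult_in_Sm1 Sm_Sm1[OF Vol_in_Sm] smooth2_dx smooth2_minus smooth2_dy f)+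
qed

lemma Theta_Sm1: assumes "X \<in> Sm1 I" shows "\<Theta> \<star> X \<in> Sm I" "X \<star> \<Theta> \<in> Sm I"
  using Sm_Sm1_star[OF Theta_Sm assms] Sm1_Sm_star[OF assms Theta_Sm] .

text \<open>Conjugation by \<open>\<delta>'\<close>, in either direction, preserves the ring of integral plus multiplication operators.
  This is why the order is additive.\<close>

lemma conj_D: "X \<in> Sm1 I \<Longrightarrow> D \<star> X \<star> \<Theta> \<in> Sm1 I"
proof -
  assume "X \<in> Sm1 I"
  then obtain f g where *: "X = Vol f + Mult g" "smooth2 I f" "smooth2 I g" by (auto simp: Sm1_def)
  have "D \<star> Mult g \<star> \<Theta> = Mult g + Mult (dx I (\<lambda>x y. g x x)) \<star> \<Theta>"
    unfolding D_Mult[OF *(3)] star_add_left star_assoc D_Theta star_one_right'[OF Op_Mult[OF *(3)]] ..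
  moreover have "D \<star> X \<star> \<Theta> = D \<star> Vol f \<star> \<Theta> + D \<star> Mult g \<star> \<Theta>"
    unfolding *(1) star_add_right[OF Op_addi[OF Op_D] Op_Vol[OF *(2)] Op_Mult[OF *(3)]] star_add_left ..
  moreover have "D \<star> Vol f \<star> \<Theta> + (Mult g + Mult (dx I (\<lambda>x y. g x x)) \<star> \<Theta>) \<in> Sm1 I"
    by (intro Sm1_add Sm_Sm1 Theta_Sm1 D_Sm_in_Sm1 Vol_in_Sm Mult_in_Sm1 smooth2_dx smooth2_diag[OF *(3)] *)
  ultimately show ?thesis by simp
qed

lemma conj_Theta: "X \<in> Sm1 I \<Longrightarrow> \<Theta> \<star> X \<star> D \<in> Sm1 I"
  by (intro D_Sm_in_Sm1 Theta_Sm1)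

lemma Op_tpow: "tpow I n \<in> Op I" by (induction n) (auto intro: Op_one Op_star Op_Theta)
lemma Op_delta: "delta I n \<in> Op I"
proof (induction n)
  case (Suc n)
  have "delta I (Suc n) = delta I n \<star> D" using star_delta_delta[OF ivl int, of n "Suc 0"] by simp
  then show ?case using Suc Op_star Op_D by simp
qed (rule Op_one)

lemma Op_dpow: "dpow I k \<in> Op I" by (simp add: dpow_def Op_tpow Op_delta)

lemma tpow_Suc_right: "tpow I (Suc n) = tpow I n \<star> \<Theta>"
proof (induction n)
  case (Suc n)
  have "tpow I (Suc (Suc n)) = \<Theta> \<star> (tpow I n \<star> \<Theta>)" using Suc by simp
  then show ?case by (simp add: star_assoc)
qed (simp add: Op_Theta)

lemma dpow_Suc: "dpow I (k + 1) = dpow I k \<star> D"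
proof (cases "k \<ge> 0")
  case True
  then have "nat (k + 1) = nat k + Suc 0" by simp
  then show ?thesis using True star_delta_delta[OF ivl int, of "nat k" "Suc 0"] by (simp add: dpow_def)
next
  case False
  define n where "n = nat (- k - 1)"
  have k: "k = - int n - 1" using False by (simp add: n_def)
  have "dpow I k \<star> D = tpow I n \<star> (\<Theta> \<star> D)"
    unfolding star_assoc[symmetric] tpow_Suc_right[symmetric] using k by (simp add: dpow_def nat_add_distrib)
  also have "\<dots> = tpow I n" by (simp add: Theta_D Op_tpow)
  also have "\<dots> = dpow I (k + 1)" using k by (auto simp: dpow_def)
  finally show ?thesis ..
qed

lemma dpow_pred: "dpow I (k - 1) = dpow I k \<star> \<Theta>"
proof -
  have "dpow I k \<star> \<Theta> = dpow I (k - 1) \<star> (D \<star> \<Theta>)" using dpow_Suc[of "k - 1"] by (simp add: star_assoc)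
  then show ?thesis by (simp add: D_Theta Op_dpow)
qed

lemma dpow_0: "dpow I 0 = one_star I" by (simp add: dpow_def)
lemma dpow_1: "dpow I 1 = D" by (simp add: dpow_def)
lemma dpow_m1: "dpow I (-1) = \<Theta>" by (simp add: dpow_def Op_Theta)

lemma dpow_add: "dpow I (a + b) = dpow I a \<star> dpow I b"
proof (induction b rule: int_induct[where k=0])
  case base
  then show ?case by (simp add: dpow_0 Op_dpow)
next
  case (step1 i)
  then show ?case using dpow_Suc[of "a + i"] by (simp add: dpow_Suc star_assoc add.assoc)
next
  case (step2 i)
  then show ?case using dpow_pred[of "a + i"] by (simp add: dpow_pred star_assoc add_diff_eq)
qed

lemma dpow_inv: "dpow I a \<star> dpow I (- a) = one_star I"
  using dpow_add[of a "- a"] by (simp add: dpow_0)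

lemma dpow_inv_cancel: "X \<in> Op I \<Longrightarrow> dpow I a \<star> (dpow I (- a) \<star> X) = X"
  "X \<in> Op I \<Longrightarrow> dpow I (- a) \<star> (dpow I a \<star> X) = X"
  using dpow_inv[of a] dpow_inv[of "- a"] by (simp_all add: star_assoc[symmetric])

lemma dpow_conj:
  assumes "\<And>X. X \<in> S \<Longrightarrow> D \<star> X \<star> \<Theta> \<in> S" "\<And>X. X \<in> S \<Longrightarrow> \<Theta> \<star> X \<star> D \<in> S" "S \<subseteq> Op I"
  shows "X \<in> S \<Longrightarrow> dpow I k \<star> X \<star> dpow I (- k) \<in> S"
proof (induction k arbitrary: X rule: int_induct[where k=0])
  case base
  then show ?case using assms(3) by (simp add: dpow_0 subset_iff)
next
  case (step1 i)
  have "dpow I (i + 1) \<star> X \<star> dpow I (- (i + 1)) = dpow I i \<star> (D \<star> X \<star> \<Theta>) \<star> dpow I (- i)"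
  proof -
    have "- (i + 1) = -1 + - i" by simp
    then have "dpow I (- (i + 1)) = \<Theta> \<star> dpow I (- i)" by (simp only: dpow_add dpow_m1)
    then show ?thesis unfolding dpow_Suc by (simp add: star_assoc)
  qed
  then show ?case using step1 assms(1) by simp
next
  case (step2 i)
  have "dpow I (i - 1) \<star> X \<star> dpow I (- (i - 1)) = dpow I i \<star> (\<Theta> \<star> X \<star> D) \<star> dpow I (- i)"
    using dpow_add[of 1 "- i"] by (simp add: dpow_pred star_assoc dpow_1)
  then show ?case using step2 assms(2) by simp
qed

lemma dpow_conj_Sm1: "X \<in> Sm1 I \<Longrightarrow> dpow I k \<star> X \<star> dpow I (- k) \<in> Sm1 I"
  by (rule dpow_conj) (auto intro: conj_D conj_Theta Sm1_Op)

lemma Ord_Op: "X \<in> Ord I k \<Longrightarrow> X \<in> Op I" by (simp add: Ord_def)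

text \<open>The factor \<open>\<delta>'\<^sup>b\<close> is moved across the first operator by conjugation, which stays in the ring.\<close>

lemma Ord_star: assumes "X \<in> Ord I a" "Y \<in> Ord I b" shows "X \<star> Y \<in> Ord I (a + b)"
proof -
  have "dpow I (a + b) \<star> (X \<star> Y) = (dpow I b \<star> (dpow I a \<star> X) \<star> dpow I (- b)) \<star> (dpow I b \<star> Y)"
    using dpow_inv_cancel[OF Ord_Op[OF assms(2)], of "- b"] dpow_add[of b a]
    by (simp add: star_assoc add.commute)
  moreover have "dpow I a \<star> X \<in> Sm1 I" "dpow I b \<star> Y \<in> Sm1 I" using assms by (auto simp: Ord_def)
  then have "(dpow I b \<star> (dpow I a \<star> X) \<star> dpow I (- b)) \<star> (dpow I b \<star> Y) \<in> Sm1 I"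
    by (intro Sm1_star[OF dpow_conj_Sm1])
  ultimately show ?thesis using assms by (simp add: Ord_def Op_star)
qed

lemma Ord_add: "X \<in> Ord I k \<Longrightarrow> Y \<in> Ord I k \<Longrightarrow> X + Y \<in> Ord I k"
  by (auto simp: Ord_def Op_add star_add_right[OF Op_addi[OF Op_dpow]] Sm1_add)

lemma Ord_scale: "X \<in> Ord I k \<Longrightarrow> scale c X \<in> Ord I k"
  by (auto simp: Ord_def Op_scale_op star_scale_right Op_dpow Sm1_scale)

lemma Ord_diff: "X \<in> Ord I k \<Longrightarrow> Y \<in> Ord I k \<Longrightarrow> X - Y \<in> Ord I k"
  using Ord_add[of X k "- Y"] Ord_scale[of Y k "-1"] by (simp add: uminus_scale[symmetric])

lemma Ord_0: "Ord I 0 = Sm1 I" by (auto simp: Ord_def dpow_0 Sm1_Op)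
lemma one_Ord: "one_star I \<in> Ord I 0" by (simp add: Ord_0 one_Sm1)

text \<open>An operator of order at least 1 has the form \<open>\<Theta> * \<rho>\<close> with \<open>\<rho>\<close> in the ring, and the Heaviside function
  lies in the ideal.\<close>

lemma Ord_1: "Ord I 1 = Sm I"
proof (intro equalityI subsetI)
  fix X assume X: "X \<in> Ord I 1"
  have "X = \<Theta> \<star> (D \<star> X)" using dpow_inv_cancel(2)[OF Ord_Op[OF X], of 1] by (simp add: dpow_1 dpow_m1)
  then show "X \<in> Sm I" using X Theta_Sm1(1)[of "D \<star> X"] by (simp add: Ord_def dpow_1)
qed (auto simp: Ord_def dpow_1 Sm_Op D_Sm_in_Sm1)

lemma Ord_mono1: "X \<in> Ord I (k + 1) \<Longrightarrow> X \<in> Ord I k"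
proof -
  assume X: "X \<in> Ord I (k + 1)"
  have "dpow I k \<star> X = \<Theta> \<star> (dpow I (k + 1) \<star> X)"
    using dpow_add[of "-1" "k + 1"] by (simp add: star_assoc dpow_m1)
  then show ?thesis using X by (auto simp: Ord_def intro!: Sm_Sm1[OF Theta_Sm1(1)])
qed

lemma Ord_antimono: "j \<le> k \<Longrightarrow> X \<in> Ord I k \<Longrightarrow> X \<in> Ord I j"
proof (induction k rule: int_ge_induct)
  case (step i)
  then show ?case using Ord_mono1 by blast
qed simp

lemma Ord_0_mem: "0 \<in> Ord I k" by (auto simp: Ord_def Op_0 star_0_right[OF Op_addi[OF Op_dpow]] Sm_Sm1 zero_Sm)

lemma Ord_sum: "(\<And>k. k \<in> A \<Longrightarrow> f k \<in> Ord I n) \<Longrightarrow> (\<Sum>k\<in>A. f k) \<in> Ord I n"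
  by (induction A rule: infinite_finite_induct) (auto simp: Ord_add Ord_0_mem)

lemma Ord_dpow: "dpow I k \<in> Ord I (- k)"
  using dpow_inv[of "- k"] by (simp add: Ord_def Op_dpow one_Sm1)

section \<open>Operators of finite order lie in the class D(I)\<close>

lemma addi_sum: "(\<And>k. k \<in> A \<Longrightarrow> f k \<in> addi I) \<Longrightarrow> (\<Sum>k\<in>A. f k) \<in> addi I"
proof (induction A rule: infinite_finite_induct)
  case (insert x A)
  then have "f x \<in> addi I" "sum f A \<in> addi I" by auto
  then show ?case unfolding sum.insert[OF insert.hyps] by (auto simp: addi_def algebra_simps)
qed (auto simp: Op_addi Op_0)

lemma derivs_on_eq:
  assumes "\<And>k t. t \<in> I \<Longrightarrow> (H k has_vector_derivative H (Suc k) t) (at t within I)"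
    "\<And>t. t \<in> I \<Longrightarrow> h t = H 0 t"
  shows "t \<in> I \<Longrightarrow> (deriv_on I ^^ i) h t = H i t"
proof (induction i arbitrary: t)
  case (Suc i)
  have "(deriv_on I ^^ Suc i) h t = deriv_on I (H i) t"
    using deriv_on_cong[OF Suc.prems, of "(deriv_on I ^^ i) h" "H i"] Suc.IH by simp
  then show ?case using deriv_on_eqI[OF ivl int Suc.prems assms(1)[OF Suc.prems]] by simp
qed (use assms in simp)

lemma derivs_on_add:
  assumes "smooth1 I h" "smooth1 I k" "t \<in> I"
  shows "(deriv_on I ^^ i) (\<lambda>t. h t + k t) t = (deriv_on I ^^ i) h t + (deriv_on I ^^ i) k t"
proof -
  obtain H where H: "\<And>t. t \<in> I \<Longrightarrow> h t = H 0 t" "\<And>k t. t \<in> I \<Longrightarrow>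
      (H k has_vector_derivative H (Suc k) t) (at t within I)"
    using assms(1) unfolding smooth1_def by metis
  obtain L where L: "\<And>t. t \<in> I \<Longrightarrow> k t = L 0 t" "\<And>k t. t \<in> I \<Longrightarrow>
      (L k has_vector_derivative L (Suc k) t) (at t within I)"
    using assms(2) unfolding smooth1_def by metis
  have "(deriv_on I ^^ i) (\<lambda>t. h t + k t) t = (\<lambda>i t. H i t + L i t) i t"
    by (rule derivs_on_eq) (use H L assms(3) in \<open>auto intro!: has_vector_derivative_add\<close>)
  then show ?thesis using derivs_on_eq[OF H(2,1) assms(3)] derivs_on_eq[OF L(2,1) assms(3)] by simp
qed

lemma derivs_on_cmult:
  assumes "smooth1 I h" "t \<in> I"
  shows "(deriv_on I ^^ i) (\<lambda>t. c * h t) t = c * (deriv_on I ^^ i) h t"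
proof -
  obtain H where H: "\<And>t. t \<in> I \<Longrightarrow> h t = H 0 t" "\<And>k t. t \<in> I \<Longrightarrow>
      (H k has_vector_derivative H (Suc k) t) (at t within I)"
    using assms(1) unfolding smooth1_def by metis
  have "(deriv_on I ^^ i) (\<lambda>t. c * h t) t = (\<lambda>i t. c * H i t) i t"
    by (rule derivs_on_eq) (use H assms(2) in \<open>auto intro!: has_vector_derivative_mult_right\<close>)
  then show ?thesis using derivs_on_eq[OF H(2,1) assms(2)] by simp
qed

lemma delta_dist_addi:
  assumes g: "smooth2 I g" shows "delta_dist I i g \<in> addi I"
proof -
  have "delta_dist I i g (\<phi> + \<psi>) x = delta_dist I i g \<phi> x + delta_dist I i g \<psi> x" if t: "\<phi> \<in> T" "\<psi> \<in> T"
      for \<phi> \<psi> x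
  proof (cases "x \<in> I")
    case True
    have s: "smooth1 I (\<lambda>t. g x t * \<phi> t)" if "\<phi> \<in> T" for \<phi>
    proof -
      have "smooth2 I (\<lambda>t y. g y t * \<phi> t)" by (rule smooth2_mult[OF smooth2_swap[OF g] test_smooth2[OF that]])
      then show ?thesis using smooth2_smooth1[OF _ True] by fast
    qed
    show ?thesis using derivs_on_add[OF s[OF t(1)] s[OF t(2)] True, of i] t test_add[OF t] True
      by (simp add: delta_dist_def distrib_left)
  qed (simp add: delta_dist_def)
  then show ?thesis by (auto simp: addi_def fun_eq_iff) (auto simp: delta_dist_def)
qed

lemma D_class_addi: "X \<in> D_class I \<Longrightarrow> X \<in> addi I"
proof -
  assume "X \<in> D_class I"
  then obtain f g M where X: "X =
      Vol f + (\<Sum>i\<le>(M::nat). delta_dist I i (g i))" "smooth2 I f" "\<forall>i\<le>M. smooth2 I (g i)"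
    unfolding D_class_def by blast
  have "(\<Sum>i\<le>M. delta_dist I i (g i)) \<in> addi I"
    by (rule addi_sum, rule delta_dist_addi) (use X in auto)
  moreover have "Vol f \<in> addi I" by (rule Op_addi[OF Op_Vol[OF X(2)]])
  ultimately show ?thesis unfolding X(1) by (auto simp: addi_def algebra_simps)
qed

lemma delta_dist_fst: "delta_dist I i (\<lambda>x y. g x) = Mult (\<lambda>x y. g x) \<star> delta I i"
proof (intro ext)
  fix \<phi> x
  show "delta_dist I i (\<lambda>x y. g x) \<phi> x = (Mult (\<lambda>x y. g x) \<star> delta I i) \<phi> x"
  proof (cases "\<phi> \<in> T \<and> x \<in> I")
    case True
    then have "smooth1 I \<phi>" by (simp add: test_fun_def)
    then show ?thesis using True derivs_on_cmult[of \<phi> x i "g x"] Op_T[OF Op_delta, of i \<phi>]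
      by (simp add: star_def Mult_apply delta_apply) (simp add: delta_dist_def)
  next
    case False
    then show ?thesis by (auto simp: delta_dist_def star_def Mult_apply delta_apply)
  qed
qed

text \<open>Moving \<open>\<delta>'\<close> from the right into an integral operator differentiates its kernel and releases one
  multiplication operator, so only multiples of derivatives of \<open>\<delta>\<close> and one integral operator remain.\<close>

lemma Sm1_delta_normal_form:
  assumes "X \<in> Sm1 I"
  shows "\<exists>f g M. X \<star> delta I n = Vol f + (\<Sum>i\<le>(M::nat). Mult (g i) \<star> delta I i) \<and> smooth2 I f \<and>
      (\<forall>i. smooth2 I (g i))"
proof (induction n)
  case 0
  obtain f g where *: "X = Vol f + Mult g" "smooth2 I f" "smooth2 I g" using assms by (auto simp: Sm1_def)
  show ?case
  proof (rule exI[of _ f], rule exI[of _ "\<lambda>_. g"], rule exI[of _ 0], intro conjI allI)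
    show "X \<star> delta I 0 = Vol f + (\<Sum>i\<le>0. Mult g \<star> delta I i)"
      unfolding star_one_right'[OF Sm1_Op[OF assms]] using *(1) star_one_right'[OF Op_Mult[OF *(3)]] by simp
  qed (use * in auto)
next
  case (Suc n)
  then obtain f g M where *: "X \<star> delta I n = Vol f + (\<Sum>i\<le>(M::nat). Mult (g i) \<star> delta I i)" "smooth2 I f"
      "\<And>i. smooth2 I (g i)"
    by blast
  have d: "delta I (Suc i) = delta I i \<star> D" for i using star_delta_delta[OF ivl int, of i "Suc 0"] by simp
  \<comment> \<open>the released multiplication operator becomes the coefficient of \<open>\<delta>\<close>, the others shift up\<close>
  define g' where "g' = (\<lambda>i. case i of 0 \<Rightarrow> f | Suc i \<Rightarrow> g i)"
  have "X \<star> delta I (Suc n) = (X \<star> delta I n) \<star> D" by (simp only: star_assoc d[symmetric])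
  also have "\<dots> = Vol f \<star> D + (\<Sum>i\<le>M. Mult (g i) \<star> delta I (Suc i))"
    by (simp only: *(1) star_add_left star_sum_left star_assoc d[symmetric])
  also have "Vol f \<star> D = Vol (\<lambda>x y. - dy I f x y) + Mult f" using Vol_D[OF *(2)] by (simp add: add.commute)
  also have "Vol (\<lambda>x y. - dy I f x y) + Mult f + (\<Sum>i\<le>M. Mult (g i) \<star> delta I (Suc i)) =
    Vol (\<lambda>x y. - dy I f x y) + (\<Sum>i\<le>Suc M. Mult (g' i) \<star> delta I i)"
    unfolding sum.atMost_Suc_shift by (simp add: g'_def add.assoc Op_Mult *(2) del: delta_dist_def)
  finally have "X \<star> delta I (Suc n) = Vol (\<lambda>x y. - dy I f x y) + (\<Sum>i\<le>Suc M. Mult (g' i) \<star> delta I i)" .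
  moreover have "smooth2 I (g' i)" for i using * by (auto simp: g'_def split: nat.split)
  moreover have "smooth2 I (\<lambda>x y. - dy I f x y)" by (intro smooth2_minus smooth2_dy *)
  ultimately show ?case by blast
qed

lemma Ord_D_class: assumes X: "X \<in> Ord I k" shows "X \<in> D_class I"
proof -
  define n where "n = nat (- k)"
  have Xn: "X \<in> Ord I (- int n)" by (rule Ord_antimono[OF _ X]) (simp add: n_def)
  have "X \<star> dpow I (- int n) \<in> Ord I (- int n + int n)" using Ord_star[OF Xn Ord_dpow[of "- int n"]] by simp
  then have R: "X \<star> dpow I (- int n) \<in> Sm1 I" by (simp add: Ord_0)
  have "(X \<star> dpow I (- int n)) \<star> delta I n = X \<star> (dpow I (- int n) \<star> dpow I (- (- int n)))"
    by (simp add: star_assoc dpow_def)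
  also have "\<dots> = X" unfolding dpow_inv using Ord_Op[OF X] by simp
  finally have "(X \<star> dpow I (- int n)) \<star> delta I n = X" .
  then obtain f g M where *: "X = Vol f + (\<Sum>i\<le>(M::nat). Mult (g i) \<star> delta I i)" "smooth2 I f"
      "\<And>i. smooth2 I (g i)"
    using Sm1_delta_normal_form[OF R, of n] by auto
  have "Mult (g i) \<star> delta I i = delta_dist I i (\<lambda>x y. g i x x)" for i
    using delta_dist_fst[of i "\<lambda>x. g i x x"] Mult_cong[of "g i" "\<lambda>x y. g i x x"] by simp
  then have "X = Vol f + (\<Sum>i\<le>M. delta_dist I i (\<lambda>x y. g i x x))" using *(1) by simp
  moreover have "\<forall>i\<le>M. smooth2 I (\<lambda>x y. g i x x)" using *(3) smooth2_diag by blast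
  ultimately show ?thesis unfolding D_class_def using *(2)
    by (intro CollectI exI[of _ f] exI[of _ "\<lambda>i x y. g i x x"] exI[of _ M]) blast
qed

end

section \<open>Matrices of operators\<close>

text \<open>The product of possibly rectangular matrices, for the matrices whose columns are the Lanczos vectors.\<close>

definition mmul :: "'k set \<Rightarrow> ('i \<Rightarrow> 'k \<Rightarrow> dist) \<Rightarrow> ('k \<Rightarrow> 'j \<Rightarrow> dist) \<Rightarrow> 'i \<Rightarrow> 'j \<Rightarrow> dist" where
  "mmul S X Y i j = (\<Sum>k\<in>S. X i k \<star> Y k j)"

lemma mat_mult_mmul: "mat_mult S X Y = mmul S X Y"
  by (intro ext) (simp only: mat_mult_def mmul_def)

lemma mmul_cong:
  assumes "\<And>k. k \<in> S \<Longrightarrow> X i k = X' i k" "\<And>k. k \<in> S \<Longrightarrow> Y k j = Y' k j"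
  shows "mmul S X Y i j = mmul S X' Y' i j"
  unfolding mmul_def by (rule sum.cong) (simp_all only: assms)

lemma mat_plus: fixes X Y :: "'i \<Rightarrow> 'j \<Rightarrow> dist" shows "(X + Y) i j = X i j + Y i j" by simp
lemma mat_minus: fixes X Y :: "'i \<Rightarrow> 'j \<Rightarrow> dist" shows "(X - Y) i j = X i j - Y i j" by simp

context time_interval
begin

lemma mmul_assoc:
  assumes "\<And>k. k \<in> A \<Longrightarrow> X i k \<in> addi I" "\<And>k l. k \<in> A \<Longrightarrow> l \<in> B \<Longrightarrow> Y k l \<in> Op I" "\<And>l. l \<in> B \<Longrightarrow> Z l j \<in> Op I"
  shows "mmul B (mmul A X Y) Z i j = mmul A X (mmul B Y Z) i j"
proof -
  have "mmul B (mmul A X Y) Z i j = (\<Sum>l\<in>B. \<Sum>k\<in>A. X i k \<star> (Y k l \<star> Z l j))"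
    unfolding mmul_def star_sum_left star_assoc ..
  also have "\<dots> = (\<Sum>k\<in>A. \<Sum>l\<in>B. X i k \<star> (Y k l \<star> Z l j))" by (rule sum.swap)
  also have "\<dots> = (\<Sum>k\<in>A. X i k \<star> (\<Sum>l\<in>B. Y k l \<star> Z l j))"
    by (intro sum.cong refl star_sum_right[symmetric] assms Op_star)
  finally show ?thesis unfolding mmul_def .
qed

lemma mmul_Op: "(\<And>k. k \<in> A \<Longrightarrow> X i k \<in> Op I) \<Longrightarrow> (\<And>k. k \<in> A \<Longrightarrow> Y k j \<in> Op I) \<Longrightarrow> mmul A X Y i j \<in> Op I"
  unfolding mmul_def by (intro Op_sum Op_star)

lemma mat_id_Op: "mat_id I A i j \<in> Op I" by (simp add: mat_id_def Op_one Op_0)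

lemma mmul_id_left:
  assumes "finite A" "i \<in> A" "X i j \<in> Op I"
  shows "mmul A (mat_id I A) X i j = X i j"
proof -
  have "mmul A (mat_id I A) X i j = (\<Sum>k\<in>A. if k = i then X i j else 0)"
    unfolding mmul_def by (rule sum.cong) (use assms in \<open>auto simp: mat_id_def\<close>)
  then show ?thesis using assms by (simp only: sum.delta if_True)
qed

lemma mmul_id_right:
  assumes "finite A" "j \<in> A" "\<And>k. k \<in> A \<Longrightarrow> X i k \<in> addi I"
  shows "mmul A X (mat_id I A) i j = X i j"
proof -
  have "mmul A X (mat_id I A) i j = (\<Sum>k\<in>A. if k = j then X i j else 0)"
    unfolding mmul_def by (rule sum.cong) (use assms star_one_right star_0_right in \<open>auto simp: mat_id_def\<close>)
  then show ?thesis using assms by (simp only: sum.delta if_True)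
qed

lemma mmul_diff_left: "mmul A (X - X') Y i j = mmul A X Y i j - mmul A X' Y i j"
  unfolding mmul_def mat_minus star_diff_left sum_subtractf ..

lemma mmul_add_left: "mmul A (X + X') Y i j = mmul A X Y i j + mmul A X' Y i j"
  unfolding mmul_def mat_plus star_add_left sum.distrib ..

lemma mmul_diff_right:
  assumes "\<And>k. k \<in> A \<Longrightarrow> X i k \<in> addi I" "\<And>k. k \<in> A \<Longrightarrow> Y k j \<in> Op I" "\<And>k. k \<in> A \<Longrightarrow> Y' k j \<in> Op I"
  shows "mmul A X (Y - Y') i j = mmul A X Y i j - mmul A X Y' i j"
proof -
  have "mmul A X (Y - Y') i j = (\<Sum>k\<in>A. X i k \<star> Y k j - X i k \<star> Y' k j)"
    unfolding mmul_def mat_minus by (intro sum.cong refl star_diff_right assms)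
  then show ?thesis unfolding mmul_def sum_subtractf .
qed

lemma mmul_add_right:
  assumes "\<And>k. k \<in> A \<Longrightarrow> X i k \<in> addi I" "\<And>k. k \<in> A \<Longrightarrow> Y k j \<in> Op I" "\<And>k. k \<in> A \<Longrightarrow> Y' k j \<in> Op I"
  shows "mmul A X (Y + Y') i j = mmul A X Y i j + mmul A X Y' i j"
proof -
  have "mmul A X (Y + Y') i j = (\<Sum>k\<in>A. X i k \<star> Y k j + X i k \<star> Y' k j)"
    unfolding mmul_def mat_plus by (intro sum.cong refl star_add_right assms)
  then show ?thesis unfolding mmul_def sum.distrib .
qed

lemma Vol_sum:
  assumes "finite A" "\<And>k. k \<in> A \<Longrightarrow> smooth2 I (f k)"
  shows "(\<Sum>k\<in>A. Vol (f k)) = Vol (\<lambda>x y. \<Sum>k\<in>A. f k x y)"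
  using assms
proof (induction A rule: finite_induct)
  case (insert a A)
  then show ?case unfolding sum.insert[OF insert.hyps]
    using Vol_add[of "f a" "\<lambda>x y. \<Sum>k\<in>A. f k x y"] smooth2_sum[of A f] by simp
next
  case empty
  show ?case unfolding sum.empty Vol_zero ..
qed

lemma volterra_matrix:
  assumes A: "finite A" and X: "\<And>i j. i \<in> A \<Longrightarrow> j \<in> A \<Longrightarrow> X i j \<in> Sm I"
  obtains Y where "\<And>i j. i \<in> A \<Longrightarrow> j \<in> A \<Longrightarrow> Y i j \<in> Sm I"
    "\<And>i j. i \<in> A \<Longrightarrow> j \<in> A \<Longrightarrow> Y i j = X i j + mmul A X Y i j"
    "\<And>i j. i \<in> A \<Longrightarrow> j \<in> A \<Longrightarrow> Y i j = X i j + mmul A Y X i j"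
proof -
  have "\<forall>i\<in>A. \<forall>j\<in>A. \<exists>f. X i j = Vol f \<and> smooth2 I f" using X by (auto simp: Sm_def)
  then obtain k where k: "\<And>i j. i \<in> A \<Longrightarrow> j \<in> A \<Longrightarrow> X i j = Vol (k i j)" "\<And>i j. i \<in> A \<Longrightarrow> j \<in> A \<Longrightarrow> smooth2 I (k i j)"
    by metis
  obtain r where r: "\<And>i j. i \<in> A \<Longrightarrow> j \<in> A \<Longrightarrow> smooth2 I (r i j)"
    "\<And>i j x y. i \<in> A \<Longrightarrow> j \<in> A \<Longrightarrow> x \<in> I \<Longrightarrow> y \<in> I \<Longrightarrow> r i j x y = k i j x y + mconv A k r i j x y"
    "\<And>i j x y. i \<in> A \<Longrightarrow> j \<in> A \<Longrightarrow> x \<in> I \<Longrightarrow> y \<in> I \<Longrightarrow> r i j x y = k i j x y + mconv A r k i j x y"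
    using volterra_resolvent[of A k, OF A k(2)] by blast
  have mm: "mmul A X' Y' i j = Vol (mconv A f g i j)"
    "smooth2 I (mconv A f g i j)"
    if "\<And>i j. i \<in> A \<Longrightarrow> j \<in> A \<Longrightarrow> X' i j = Vol (f i j)" "\<And>i j. i \<in> A \<Longrightarrow> j \<in> A \<Longrightarrow> Y' i j = Vol (g i j)"
      "\<And>i j. i \<in> A \<Longrightarrow> j \<in> A \<Longrightarrow> smooth2 I (f i j)" "\<And>i j. i \<in> A \<Longrightarrow> j \<in> A \<Longrightarrow> smooth2 I (g i j)"
      "i \<in> A" "j \<in> A" for X' Y' f g i j
  proof -
    have eq: "mconv A f g i j = (\<lambda>x y. \<Sum>p\<in>A. conv (f i p) (g p j) x y)" by (intro ext) (rule mconv_def)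
    have "mmul A X' Y' i j = (\<Sum>p\<in>A. Vol (conv (f i p) (g p j)))"
      unfolding mmul_def by (rule sum.cong) (simp_all add: that Vol_Vol)
    also have "\<dots> = Vol (mconv A f g i j)"
      unfolding eq by (rule Vol_sum[OF A]) (intro smooth2_conv that)
    finally show "mmul A X' Y' i j = Vol (mconv A f g i j)" .
    show "smooth2 I (mconv A f g i j)" unfolding eq by (intro smooth2_sum A smooth2_conv that)
  qed
  define Y where "Y = (\<lambda>i j. Vol (r i j))"
  have Y: "Y i j = Vol (r i j)" for i j by (simp add: Y_def)
  show ?thesis
  proof (rule that[of Y])
    fix i j assume ij: "i \<in> A" "j \<in> A"
    show "Y i j \<in> Sm I" unfolding Y by (rule Vol_in_Sm[OF r(1)[OF ij]])
    have "Vol (r i j) = Vol (\<lambda>x y. k i j x y + mconv A k r i j x y)" by (rule Vol_cong) (rule r(2)[OF ij])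
    also have "\<dots> = Vol (k i j) + Vol (mconv A k r i j)"
      by (rule Vol_add[symmetric]) (use k r mm ij in auto)
    also have "Vol (mconv A k r i j) = mmul A X Y i j" using mm(1)[of X k Y r i j, OF k(1) Y k(2) r(1) ij]
      by (rule sym)
    finally show "Y i j = X i j + mmul A X Y i j" unfolding Y[of i j] k(1)[OF ij] .
    have "Vol (r i j) = Vol (\<lambda>x y. k i j x y + mconv A r k i j x y)" by (rule Vol_cong) (rule r(3)[OF ij])
    also have "\<dots> = Vol (k i j) + Vol (mconv A r k i j)"
      by (rule Vol_add[symmetric]) (use k r mm ij in auto)
    also have "Vol (mconv A r k i j) = mmul A Y X i j" using mm(1)[of Y r X k i j, OF Y k(1) r(1) k(2) ij]
      by (rule sym)
    finally show "Y i j = X i j + mmul A Y X i j" unfolding Y[of i j] k(1)[OF ij] .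
  qed
qed

text \<open>Conjugation with the diagonal matrix of the powers \<open>\<delta>'\<close> to the \<open>d i\<close> turns \<open>X\<close> into a matrix of integral operators,
  whose resolvent exists.  The weights \<open>d i = i\<close> deal with tridiagonal matrices that have units on the
  superdiagonal, operators of order 1 on the diagonal and of order 2 below it; \<open>d i = 0\<close> deals with matrices
  over \<open>Sm\<^sub>\<Theta>(I)\<close>.\<close>

lemma balanced_inverse:
  fixes d :: "'k \<Rightarrow> int"
  assumes A: "finite A" and X: "\<And>i j. i \<in> A \<Longrightarrow> j \<in> A \<Longrightarrow> X i j \<in> Ord I (1 + d i - d j)"
    and X0: "\<And>i j. i \<notin> A \<or> j \<notin> A \<Longrightarrow> X i j = 0"
  obtains L where "\<And>i j. i \<in> A \<Longrightarrow> j \<in> A \<Longrightarrow> L i j \<in> Ord I (d i - d j)" "\<And>i j. i \<notin> A \<or> j \<notin> A \<Longrightarrow> L i j = 0"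
    "mat_mult A L (mat_id I A - X) = mat_id I A" "mat_mult A (mat_id I A - X) L = mat_id I A"
proof -
  have XO: "X i j \<in> Op I" for i j using X[of i j] X0[of i j] Ord_Op Op_0 by (cases "i \<in> A \<and> j \<in> A") auto
  \<comment> \<open>the weights make every entry an operator of order 1, hence an integral operator\<close>
  define X' where "X' = (\<lambda>i j. dpow I (d i) \<star> X i j \<star> dpow I (- d j))"
  have "X' i j \<in> Sm I" if "i \<in> A" "j \<in> A" for i j
  proof -
    have "X' i j \<in> Ord I (- d i + (1 + d i - d j) + - (- d j))"
      unfolding X'_def by (intro Ord_star Ord_dpow X that)
    then show ?thesis by (simp add: Ord_1)
  qed
  then obtain Y' where Y': "\<And>i j. i \<in> A \<Longrightarrow> j \<in> A \<Longrightarrow> Y' i j \<in> Sm I"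
    "\<And>i j. i \<in> A \<Longrightarrow> j \<in> A \<Longrightarrow> Y' i j = X' i j + mmul A X' Y' i j"
    "\<And>i j. i \<in> A \<Longrightarrow> j \<in> A \<Longrightarrow> Y' i j = X' i j + mmul A Y' X' i j"
    using volterra_matrix[OF A, of X'] by blast
  have Y'O: "Y' i j \<in> Op I" if "i \<in> A" "j \<in> A" for i j using Sm_Op Y'(1) that by blast
  have X'O: "X' i j \<in> Op I" for i j unfolding X'_def by (intro Op_star Op_dpow XO)
  define Y where "Y = (\<lambda>i j. if i \<in> A \<and> j \<in> A then dpow I (- d i) \<star> Y' i j \<star> dpow I (d j) else 0)"
  have YO: "Y i j \<in> Op I" for i j unfolding Y_def using Y'O Op_star Op_dpow Op_0 by simp
  have YF: "Y i j \<in> Ord I (d i - d j)" if "i \<in> A" "j \<in> A" for i j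
  proof -
    have "dpow I (- d i) \<star> Y' i j \<star> dpow I (d j) \<in> Ord I (- (- d i) + 1 + - d j)"
      by (intro Ord_star Ord_dpow) (use Y'(1) that Ord_1 in auto)
    then have "Y i j \<in> Ord I (d i - d j + 1)" using that by (simp add: Y_def algebra_simps)
    then show ?thesis by (rule Ord_mono1)
  qed
  have c1: "dpow I (- a) \<star> (dpow I a \<star> Z) = Z" "dpow I a \<star> (dpow I (- a) \<star> Z) = Z" if "Z \<in> Op I" for a Z
    using dpow_inv_cancel that by auto
  have X'e: "dpow I (- d i) \<star> X' i j \<star> dpow I (d j) = X i j" for i j
    unfolding X'_def star_assoc using dpow_inv[of "- d j"] XO
    by (simp add: c1 Op_star Op_dpow)
  have Y1: "Y i j = X i j + mmul A X Y i j" if ij: "i \<in> A" "j \<in> A" for i j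
  proof -
    have "Y i j =
        dpow I (- d i) \<star> X' i j \<star> dpow I (d j) + (\<Sum>p\<in>A. dpow I (- d i) \<star> (X' i p \<star> Y' p j) \<star> dpow I (d j))"
      unfolding Y_def Y'(2)[OF ij] mmul_def using ij
      by (simp add: star_add_right[OF Op_addi[OF Op_dpow]] X'O Y'O Op_sum Op_star star_add_left
        star_sum_right[OF Op_addi[OF Op_dpow]] star_sum_left)
    also have "(\<Sum>p\<in>A. dpow I (- d i) \<star> (X' i p \<star> Y' p j) \<star> dpow I (d j)) = mmul A X Y i j"
      unfolding mmul_def
    proof (rule sum.cong[OF refl])
      fix p assume p: "p \<in> A"
      have "X i p \<star> Y p j = X i p \<star> (dpow I (- d p) \<star> Y' p j \<star> dpow I (d j))" using p ij by (simp add: Y_def)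
      also have "\<dots> = dpow I (- d i) \<star> (X' i p \<star> Y' p j) \<star> dpow I (d j)"
        unfolding X'_def star_assoc by (simp add: c1 Op_star Op_dpow XO Y'O p ij)
      finally show "dpow I (- d i) \<star> (X' i p \<star> Y' p j) \<star> dpow I (d j) = X i p \<star> Y p j" ..
    qed
    finally show ?thesis unfolding X'e .
  qed
  have Y2: "Y i j = X i j + mmul A Y X i j" if ij: "i \<in> A" "j \<in> A" for i j
  proof -
    have "Y i j =
        dpow I (- d i) \<star> X' i j \<star> dpow I (d j) + (\<Sum>p\<in>A. dpow I (- d i) \<star> (Y' i p \<star> X' p j) \<star> dpow I (d j))"
      unfolding Y_def Y'(3)[OF ij] mmul_def using ij
      by (simp add: star_add_right[OF Op_addi[OF Op_dpow]] X'O Y'O Op_sum Op_star star_add_left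
        star_sum_right[OF Op_addi[OF Op_dpow]] star_sum_left)
    also have "(\<Sum>p\<in>A. dpow I (- d i) \<star> (Y' i p \<star> X' p j) \<star> dpow I (d j)) = mmul A Y X i j"
      unfolding mmul_def
    proof (rule sum.cong[OF refl])
      fix p assume p: "p \<in> A"
      have "Y i p \<star> X p j = (dpow I (- d i) \<star> Y' i p \<star> dpow I (d p)) \<star> X p j" using p ij by (simp add: Y_def)
      also have "\<dots> = dpow I (- d i) \<star> (Y' i p \<star> (dpow I (d p) \<star> (X p j \<star> (dpow I (- d j) \<star> dpow I (d j)))))"
        using dpow_inv[of "- d j"] XO by (simp add: star_assoc)
      also have "\<dots> = dpow I (- d i) \<star> (Y' i p \<star> X' p j) \<star> dpow I (d j)"
        unfolding X'_def star_assoc ..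
      finally show "dpow I (- d i) \<star> (Y' i p \<star> X' p j) \<star> dpow I (d j) = Y i p \<star> X p j" ..
    qed
    finally show ?thesis unfolding X'e .
  qed
  define L where "L = mat_id I A + Y"
  have LO: "L i j \<in> Op I" for i j by (simp add: L_def Op_add mat_id_Op YO)
  show ?thesis
  proof (rule that[of L])
    show "L i j \<in> Ord I (d i - d j)" if "i \<in> A" "j \<in> A" for i j
      unfolding L_def mat_plus by (intro Ord_add YF that) (use Ord_0_mem one_Ord in \<open>auto simp: mat_id_def\<close>)
    show "L i j = 0" if "i \<notin> A \<or> j \<notin> A" for i j
      using that by (auto simp: L_def Y_def mat_id_def)
    have out: "mat_mult A Z W i j = mat_id I A i j"
      if "i \<notin> A \<or> j \<notin> A" "\<And>i j. i \<notin> A \<or> j \<notin> A \<Longrightarrow> Z i j = 0" "\<And>i j. i \<notin> A \<or> j \<notin> A \<Longrightarrow> W i j = 0"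
        "\<And>i j. Z i j \<in> Op I" for Z W i j
    proof -
      have "mat_mult A Z W i j = (\<Sum>k\<in>A. 0)"
        unfolding mat_mult_def by (rule sum.cong) (use that star_0_right[OF Op_addi] in auto)
      then show ?thesis using that(1) by (auto simp: mat_id_def)
    qed
    have L0: "L i j = 0" if "i \<notin> A \<or> j \<notin> A" for i j using that by (auto simp: L_def Y_def mat_id_def)
    have M0: "(mat_id I A - X) i j = 0" if "i \<notin> A \<or> j \<notin> A" for i j using that X0[of i j]
      by (auto simp: mat_id_def)
    have MO: "(mat_id I A - X) i j \<in> Op I" for i j by (simp add: Op_diff mat_id_Op XO)
    note ad = Op_addi[OF XO] Op_addi[OF YO] Op_addi[OF mat_id_Op] Op_addi[OF LO]
    show "mat_mult A L (mat_id I A - X) = mat_id I A"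
    proof (rule ext, rule ext)
      fix i j
      show "mat_mult A L (mat_id I A - X) i j = mat_id I A i j"
      proof (cases "i \<in> A \<and> j \<in> A")
        case True
        then have ij: "i \<in> A" "j \<in> A" by auto
        have "mmul A L (mat_id I A - X) i j = mmul A L (mat_id I A) i j - mmul A L X i j"
          by (rule mmul_diff_right) (intro ad mat_id_Op XO)+
        also have "mmul A L (mat_id I A) i j = mat_id I A i j + Y i j"
          using mmul_id_right[of A j L i, OF A ij(2) ad(4)] unfolding L_def mat_plus .
        also have "mmul A L X i j = X i j + mmul A Y X i j"
          unfolding L_def mmul_add_left mmul_id_left[OF A ij(1) XO] ..
        also have "(mat_id I A i j + Y i j) - (X i j + mmul A Y X i j) = mat_id I A i j"
          unfolding Y2[OF ij, symmetric] by (rule add_diff_cancel_right')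
        finally show ?thesis unfolding mat_mult_mmul .
      next
        case False
        show ?thesis by (rule out) (use False L0 M0 LO in blast)+
      qed
    qed
    show "mat_mult A (mat_id I A - X) L = mat_id I A"
    proof (rule ext, rule ext)
      fix i j
      show "mat_mult A (mat_id I A - X) L i j = mat_id I A i j"
      proof (cases "i \<in> A \<and> j \<in> A")
        case True
        then have ij: "i \<in> A" "j \<in> A" by auto
        have "mmul A (mat_id I A - X) L i j = mmul A (mat_id I A) L i j - mmul A X L i j"
          by (rule mmul_diff_left)
        also have "mmul A (mat_id I A) L i j = mat_id I A i j + Y i j"
          using mmul_id_left[of A i L j, OF A ij(1) LO] unfolding L_def mat_plus .
        also have "mmul A X L i j = mmul A X (mat_id I A) i j + mmul A X Y i j"
          unfolding L_def by (rule mmul_add_right) (intro ad mat_id_Op YO)+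
        also have "mmul A X (mat_id I A) i j = X i j" by (rule mmul_id_right[OF A ij(2)]) (rule ad)
        also have "(mat_id I A i j + Y i j) - (X i j + mmul A X Y i j) = mat_id I A i j"
          unfolding Y1[OF ij, symmetric] by (rule add_diff_cancel_right')
        finally show ?thesis unfolding mat_mult_mmul .
      next
        case False
        show ?thesis by (rule out) (use False L0 M0 MO in blast)+
      qed
    qed
  qed
qed

text \<open>A two-sided inverse with entries of finite order lies in \<open>D(I)\<close>.  Any other inverse \<open>Y\<close> in \<open>D(I)\<close> equals it by
  \<open>Y = Y (Z L) = (Y Z) L = L\<close>, where additivity of the entries of \<open>Y\<close> gives associativity.\<close>

lemma mat_inverse_eq:
  assumes A: "finite A" and Z: "\<And>i j. Z i j \<in> Op I" and L: "\<And>i j. i \<in> A \<Longrightarrow> j \<in> A \<Longrightarrow> L i j \<in> Ord I (d i - d j)"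
      "\<And>i j. i \<notin> A \<or> j \<notin> A \<Longrightarrow> L i j = 0"
    "mat_mult A L Z = mat_id I A" "mat_mult A Z L = mat_id I A"
  shows "L \<in> D_mats I A" "mat_inverse I A Z = L"
proof -
  show LD: "L \<in> D_mats I A" unfolding D_mats_def using L(1)[THEN Ord_D_class] L(2) by blast
  have LO: "L i j \<in> Op I" for i j using L(1,2)[of i j] Ord_Op Op_0 by (cases "i \<in> A \<and> j \<in> A") auto
  show "mat_inverse I A Z = L"
    unfolding mat_inverse_def
  proof (rule the_equality)
    fix Y assume Y: "Y \<in> D_mats I A \<and> mat_mult A Y Z = mat_id I A \<and> mat_mult A Z Y = mat_id I A"
    then have Ya: "Y i j \<in> addi I" if "i \<in> A" "j \<in> A" for i j using that D_class_addi by (auto simp: D_mats_def)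
    show "Y = L"
    proof (rule ext, rule ext)
      fix i j
      show "Y i j = L i j"
      proof (cases "i \<in> A \<and> j \<in> A")
        case True
        then have ij: "i \<in> A" "j \<in> A" by auto
        have "Y i j = mmul A Y (mat_id I A) i j"
          by (rule mmul_id_right[of A j Y i, OF A ij(2) Ya[OF ij(1)], symmetric])
        also have "\<dots> = mmul A Y (mmul A Z L) i j" unfolding mat_mult_mmul[symmetric] L(4) ..
        also have "\<dots> = mmul A (mmul A Y Z) L i j" by (rule mmul_assoc[symmetric]) (use Ya ij Z LO in auto)
        also have "\<dots> = mmul A (mat_id I A) L i j" using Y unfolding mat_mult_mmul[symmetric] by simp
        also have "\<dots> = L i j" by (rule mmul_id_left[OF A ij(1) LO])
        finally show ?thesis .
      next
        case False
        then show ?thesis using Y L(2)[of i j] unfolding D_mats_def by auto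
      qed
    qed
  qed (use L LD in auto)
qed

lemma mat_pow_Op:
  assumes "\<And>i j. Z i j \<in> Op I" shows "mat_pow I A Z q i j \<in> Op I"
  by (induction q arbitrary: i j) (use assms in \<open>auto simp: mat_id_Op mat_mult_def intro!: Op_sum Op_star\<close>)

section \<open>Intertwining\<close>

lemma intertwine_pow:
  assumes A: "finite A" "finite B" and O: "\<And>i j. X i j \<in> Op I" "\<And>i j. X' i j \<in> Op I" "\<And>i j. i \<in> A \<Longrightarrow> j \<in> B \<Longrightarrow>
      V i j \<in> Op I"
    and eq: "\<And>i j. i \<in> A \<Longrightarrow> j \<in> B \<Longrightarrow> mmul A X V i j = mmul B V X' i j"
  shows "i \<in> A \<Longrightarrow> j \<in> B \<Longrightarrow> mmul A (mat_pow I A X q) V i j = mmul B V (mat_pow I B X' q) i j"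
proof (induction q arbitrary: i j)
  case 0
  then show ?case
    using mmul_id_left[of A i V j, OF A(1) 0(1) O(3)[OF 0]]
      mmul_id_right[of B j V i, OF A(2) 0(2) Op_addi[OF O(3)[OF 0(1)]]] by simp
next
  case (Suc q)
  note PO = mat_pow_Op[of X A q, OF O(1)] mat_pow_Op[of X' B q, OF O(2)]
  have "mmul A (mat_pow I A X (Suc q)) V i j = mmul A (mmul A X (mat_pow I A X q)) V i j"
    by (simp add: mat_mult_mmul)
  also have "\<dots> = mmul A X (mmul A (mat_pow I A X q) V) i j"
    by (rule mmul_assoc) (use O PO Suc.prems Op_addi in auto)
  also have "\<dots> = mmul A X (mmul B V (mat_pow I B X' q)) i j"
    by (rule mmul_cong) (use Suc in auto)
  also have "\<dots> = mmul B (mmul A X V) (mat_pow I B X' q) i j"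
    by (rule mmul_assoc[symmetric]) (use O PO Suc.prems Op_addi in auto)
  also have "\<dots> = mmul B (mmul B V X') (mat_pow I B X' q) i j"
    by (rule mmul_cong) (use eq Suc.prems in auto)
  also have "\<dots> = mmul B V (mmul B X' (mat_pow I B X' q)) i j"
    by (rule mmul_assoc) (use O PO Suc.prems Op_addi in auto)
  finally show ?case by (simp add: mat_mult_mmul)
qed

text \<open>From \<open>(1 - X) V = V (1 - X')\<close>, multiplied by a left inverse of \<open>1 - X\<close> and a right inverse of \<open>1 - X'\<close>.\<close>

lemma intertwine_inverse:
  assumes A: "finite A" "finite B" and O: "\<And>i j. X i j \<in> Op I" "\<And>i j. X' i j \<in> Op I" "\<And>i j. i \<in> A \<Longrightarrow> j \<in> B \<Longrightarrow>
      V i j \<in> Op I"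
    and L: "\<And>i j. L i j \<in> Op I" "\<And>i j. L' i j \<in> Op I" "mat_mult A L (mat_id I A - X) =
        mat_id I A" "mat_mult B (mat_id I B - X') L' = mat_id I B"
    and eq: "\<And>i j. i \<in> A \<Longrightarrow> j \<in> B \<Longrightarrow> mmul A X V i j = mmul B V X' i j"
    and ij: "i \<in> A" "j \<in> B"
  shows "mmul A L V i j = mmul B V L' i j"
proof -
  have e: "mmul A (mat_id I A - X) V i j = mmul B V (mat_id I B - X') i j" if ij: "i \<in> A" "j \<in> B" for i j
  proof -
    have "mmul A (mat_id I A - X) V i j = V i j - mmul A X V i j"
      unfolding mmul_diff_left mmul_id_left[of A i V j, OF A(1) ij(1) O(3)[OF ij]] ..
    moreover have "mmul B V (mat_id I B - X') i j = mmul B V (mat_id I B) i j - mmul B V X' i j"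
      by (rule mmul_diff_right) (intro Op_addi O mat_id_Op ij; assumption)+
    moreover have "mmul B V (mat_id I B) i j = V i j"
      by (rule mmul_id_right[OF A(2) ij(2)]) (intro Op_addi O ij; assumption)
    ultimately show ?thesis using eq[OF ij] by simp
  qed
  have MO: "(mat_id I A - X) i j \<in> Op I" "(mat_id I B - X') k l \<in> Op I" for i j k l
    using O by (simp_all add: Op_diff mat_id_Op)
  have VL: "mmul B V L' l j \<in> Op I" if "l \<in> A" for l by (rule mmul_Op) (use that O L ij in auto)
  have "mmul A L V i j = mmul A L (mmul B V (mat_id I B)) i j"
    by (rule mmul_cong[OF refl]) (simp add: mmul_id_right[of B j V, OF A(2) ij(2) Op_addi[OF O(3)]])
  also have "\<dots> = mmul A L (mmul B V (mmul B (mat_id I B - X') L')) i j"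
    unfolding mat_mult_mmul[symmetric] L(4) ..
  also have "\<dots> = mmul A L (mmul B (mmul B V (mat_id I B - X')) L') i j"
    by (rule mmul_cong[OF refl], rule mmul_assoc[symmetric]) (use O L MO Op_addi in auto)
  also have "\<dots> = mmul A L (mmul B (mmul A (mat_id I A - X) V) L') i j"
    by (rule mmul_cong[OF refl], rule mmul_cong[OF _ refl]) (use e in auto)
  also have "\<dots> = mmul A L (mmul A (mat_id I A - X) (mmul B V L')) i j"
    by (rule mmul_cong[OF refl], rule mmul_assoc) (use O L MO Op_addi in auto)
  also have "\<dots> = mmul A (mmul A L (mat_id I A - X)) (mmul B V L') i j"
    by (rule mmul_assoc[symmetric]) (use O L MO Op_addi VL in auto)
  also have "\<dots> = mmul A (mat_id I A) (mmul B V L') i j"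
    unfolding mat_mult_mmul[symmetric] L(3) ..
  also have "\<dots> = mmul B V L' i j"
    by (rule mmul_id_left[OF A(1) ij(1)]) (intro mmul_Op O L ij; assumption)
  finally show ?thesis .
qed

section \<open>Inverses of operators of order 2\<close>

text \<open>Order 2 forces \<open>b\<close> to vanish on the diagonal, so that \<open>\<delta>'' * \<beta>\<close> is multiplication by \<open>\<partial>\<^sub>1 b(t,t) = - \<partial>\<^sub>2 b(t,t)\<close> plus an
  integral operator.  The first part is invertible, and the second is a perturbation that has a resolvent.\<close>

lemma beta_inverse:
  assumes b: "smooth2 I b" and F2: "Vol b \<in> Ord I 2"
    and nz: "\<And>t. t \<in> I \<Longrightarrow> vector_derivative (\<lambda>s. b t s) (at t within I) \<noteq> 0"
  obtains \<gamma> where "\<gamma> \<in> Ord I (-2)" "\<gamma> \<star> Vol b = one_star I" "Vol b \<star> \<gamma> = one_star I"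
proof -
  note b1 = smooth2_dx(2)[OF b] and b11 = smooth2_dx(2)[OF smooth2_dx(2)[OF b]]
  have "D \<star> Vol b \<in> Ord I (- 1 + 2)" using Ord_star[OF Ord_dpow[of 1] F2] by (simp add: dpow_1)
  then have "D \<star> Vol b \<in> Sm I" by (simp add: Ord_1)
  then obtain h where h: "D \<star> Vol b = Vol h" "smooth2 I h" by (auto simp: Sm_def)
  have "Vol (dx I b) + Mult b = Vol h + Mult (\<lambda>x y. 0)"
    using h(1) unfolding D_Vol[OF b] Mult_zero by (simp add: add.commute)
  then have diag: "b t t = 0" if "t \<in> I" for t
    using kernel_unique(1)[OF b1 b h(2) smooth2_const _ that] by simp
  have "Mult b = 0" unfolding Mult_zero[symmetric] by (rule Mult_cong) (rule diag)
  then have D1: "D \<star> Vol b = Vol (dx I b)" unfolding D_Vol[OF b] by simp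
  have dxdy: "dx I b t t \<noteq> 0" if t: "t \<in> I" for t
  proof -
    have "((\<lambda>z. b z z) has_vector_derivative dx I b t t + dy I b t t) (at t within I)"
      by (rule diag_deriv[OF t _ smooth2_dy(1)[OF b] smooth2_cont[OF smooth2_dy(2)[OF b]]])
        (use smooth2_dx(1)[OF b] t in \<open>auto simp: pd1_def\<close>)
    moreover have "((\<lambda>z. b z z) has_vector_derivative 0) (at t within I)"
      by (rule has_vector_derivative_transform[OF t _ has_vector_derivative_const[of 0]]) (rule diag)
    ultimately have "dx I b t t + dy I b t t = 0" by (rule vd_unique[OF t])
    moreover have "dy I b t t \<noteq> 0" using nz[OF t] by (simp add: dy_def)
    ultimately show ?thesis by auto
  qed
  \<comment> \<open>the operator \<open>\<delta>'' * \<beta>\<close>\<close>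
  define \<rho> where "\<rho> = Mult (dx I b) + Vol (dx I (dx I b))"
  have d2: "dpow I 2 \<star> Vol b = \<rho>"
    using dpow_Suc[of 1] by (simp add: dpow_1 star_assoc D1 D_Vol[OF b1] \<rho>_def)
  define u where "u = (\<lambda>x y::real. inverse (dx I b x x))"
  have u: "smooth2 I u" unfolding u_def by (rule smooth2_inverse[OF smooth2_diag[OF b1]]) (rule dxdy)
  have gu: "Mult (dx I b) \<star> Mult u = one_star I" "Mult u \<star> Mult (dx I b) = one_star I"
    unfolding Mult_Mult[OF u] Mult_Mult[OF b1] one_Mult by (rule Mult_cong, simp add: u_def dxdy)+
  define X where "X = - (Mult u \<star> Vol (dx I (dx I b)))"
  have X: "X \<in> Sm I" unfolding X_def by (intro Sm_uminus Sm1_Sm_star Mult_in_Sm1 u Vol_in_Sm b11)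
  note XO = Sm_Op[OF X]
  have \<rho>O: "\<rho> \<in> Op I" unfolding \<rho>_def by (intro Op_add Op_Mult Op_Vol b1 b11)
  have mu: "Mult u \<star> \<rho> = one_star I - X"
    unfolding \<rho>_def star_add_right[OF Op_addi[OF Op_Mult[OF u]] Op_Mult[OF b1] Op_Vol[OF b11]] gu X_def by simp
  obtain L where L: "\<And>i j. i \<in> {()} \<Longrightarrow> j \<in> {()} \<Longrightarrow> L i j \<in> Ord I ((\<lambda>_. 0) i - (\<lambda>_. 0) j)"
    "mat_mult {()} L (mat_id I {()} - (\<lambda>_ _. X)) = mat_id I {()}"
    "mat_mult {()} (mat_id I {()} - (\<lambda>_ _. X)) L = mat_id I {()}"
    by (rule balanced_inverse[of "{()}" "\<lambda>_ _. X" "\<lambda>_. 0"]) (use X Ord_1 in auto)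
  define l where "l = L () ()"
  have l: "l \<in> Sm1 I" using L(1)[of "()" "()"] by (simp add: l_def Ord_0)
  note lO = Sm1_Op[OF l]
  have l1: "l \<star> (one_star I - X) = one_star I"
    using fun_cong[OF fun_cong[OF L(2)], of "()" "()"]
      by (simp add: mat_mult_def mat_id_def l_def mat_minus del: minus_apply)
  have l2: "(one_star I - X) \<star> l = one_star I"
    using fun_cong[OF fun_cong[OF L(3)], of "()" "()"]
      by (simp add: mat_mult_def mat_id_def l_def mat_minus del: minus_apply)
  \<comment> \<open>\<open>Mult u\<close> turns \<open>\<rho>\<close> into \<open>1 - X\<close>, which \<open>l\<close> inverts\<close>
  define \<sigma> where "\<sigma> = l \<star> Mult u"
  have \<sigma>: "\<sigma> \<in> Sm1 I" unfolding \<sigma>_def by (intro Sm1_star l Mult_in_Sm1 u)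
  note \<sigma>O = Sm1_Op[OF \<sigma>]
  have s1: "\<sigma> \<star> \<rho> = one_star I" unfolding \<sigma>_def star_assoc mu l1 ..
  have "\<rho> = Mult (dx I b) \<star> (Mult u \<star> \<rho>)" unfolding star_assoc[symmetric] gu using \<rho>O by simp
  then have "\<rho> \<star> \<sigma> = Mult (dx I b) \<star> (((one_star I - X) \<star> l) \<star> Mult u)"
    unfolding mu \<sigma>_def by (simp add: star_assoc)
  then have s2: "\<rho> \<star> \<sigma> = one_star I" unfolding l2 using gu Op_Mult[OF u] by simp
  show ?thesis
  proof (rule that[of "\<sigma> \<star> dpow I 2"])
    have "\<sigma> \<star> dpow I 2 \<in> Ord I (0 + - 2)" by (intro Ord_star Ord_dpow) (simp add: Ord_0 \<sigma>)
    then show "\<sigma> \<star> dpow I 2 \<in> Ord I (-2)" by simp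
    show "\<sigma> \<star> dpow I 2 \<star> Vol b = one_star I" unfolding star_assoc d2 s1 ..
    have "Vol b = dpow I (- 2) \<star> \<rho>" unfolding d2[symmetric] using dpow_inv_cancel(2)[OF Op_Vol[OF b], of 2]
      by simp
    then have "Vol b \<star> (\<sigma> \<star> dpow I 2) = dpow I (- 2) \<star> ((\<rho> \<star> \<sigma>) \<star> dpow I 2)" by (simp add: star_assoc)
    then show "Vol b \<star> (\<sigma> \<star> dpow I 2) = one_star I"
      unfolding s2 using dpow_inv[of "- 2"] Op_dpow by simp
  qed
qed

lemma star_inverse_eq:
  assumes "\<beta> \<in> Op I" "\<gamma> \<in> D_class I" "\<gamma> \<in> Op I" "\<gamma> \<star> \<beta> = one_star I" "\<beta> \<star> \<gamma> = one_star I"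
  shows "star_inverse I \<beta> = \<gamma>"
  unfolding star_inverse_def
proof (rule the_equality)
  fix g assume g: "g \<in> D_class I \<and> g \<star> \<beta> = one_star I \<and> \<beta> \<star> g = one_star I"
  have "g = g \<star> (\<beta> \<star> \<gamma>)" unfolding assms(5) using star_one_right[OF D_class_addi] g by simp
  also have "\<dots> = \<gamma>" using g assms(3) by (simp add: star_assoc[symmetric])
  finally show "g = \<gamma>" .
qed (use assms in auto)

lemma no_breakdown_inverse:
  assumes "no_breakdown I \<beta>" "\<beta> \<in> Ord I 2"
  shows "star_inverse I \<beta> \<in> Ord I (-2)" "star_inverse I \<beta> \<star> \<beta> = one_star I" "\<beta> \<star> star_inverse I \<beta> = one_star I"
proof -
  obtain b where b: "smooth2 I b" "\<beta> = Vol b" "\<And>t. t \<in> I \<Longrightarrow> vector_derivative (\<lambda>s. b t s) (at t within I) \<noteq> 0"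
    using assms(1) unfolding no_breakdown_def by blast
  obtain \<gamma> where g: "\<gamma> \<in> Ord I (-2)" "\<gamma> \<star> \<beta> = one_star I" "\<beta> \<star> \<gamma> = one_star I"
    using beta_inverse[OF b(1) _ b(3)] assms(2) unfolding b(2) by blast
  have "star_inverse I \<beta> = \<gamma>" by (rule star_inverse_eq) (use g assms Ord_Op Ord_D_class in auto)
  then show "star_inverse I \<beta> \<in> Ord I (-2)" "star_inverse I \<beta> \<star> \<beta> = one_star I" "\<beta> \<star> star_inverse I \<beta> =
      one_star I"
    using g by auto
qed

lemma row_col_row_mat:
  fixes x y :: "'N::finite \<Rightarrow> dist"
  assumes "\<And>i. x i \<in> Op I" "\<And>i j. A i j \<in> Op I" "\<And>i. y i \<in> Op I"
  shows "row_col (row_mat x A) y = row_col x (mat_col A y)"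
  using mmul_assoc[of UNIV "\<lambda>_. x" "()" UNIV A "\<lambda>i _. y i" "()"] assms Op_addi
  unfolding row_col_def row_mat_def mat_col_def mmul_def by auto

lemma row_col_left_mult:
  fixes x y :: "'N::finite \<Rightarrow> dist"
  assumes "a \<in> Op I" "\<And>i. x i \<in> Op I" "\<And>i. y i \<in> Op I"
  shows "row_col (\<lambda>i. a \<star> x i) y = a \<star> row_col x y"
  unfolding row_col_def star_assoc by (rule star_sum_right[symmetric]) (use assms Op_addi Op_star in auto)

lemma row_col_right_mult:
  fixes x y :: "'N::finite \<Rightarrow> dist"
  shows "row_col x (\<lambda>i. y i \<star> a) = row_col x y \<star> a"
  unfolding row_col_def star_sum_left star_assoc ..

lemma row_col_add_left: "row_col (\<lambda>i. x i + x' i) y = row_col x y + row_col x' y"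
  unfolding row_col_def star_add_left sum.distrib ..

lemma row_col_add_right:
  fixes x y :: "'N::finite \<Rightarrow> dist"
  assumes "\<And>i. x i \<in> Op I" "\<And>i. y i \<in> Op I" "\<And>i. y' i \<in> Op I"
  shows "row_col x (\<lambda>i. y i + y' i) = row_col x y + row_col x y'"
proof -
  have "row_col x (\<lambda>i. y i + y' i) = (\<Sum>k\<in>UNIV. x k \<star> y k + x k \<star> y' k)"
    unfolding row_col_def by (intro sum.cong refl star_add_right Op_addi assms)
  then show ?thesis unfolding row_col_def sum.distrib .
qed

lemma row_col_0_right:
  fixes x :: "'N::finite \<Rightarrow> dist"
  shows "(\<And>i. x i \<in> Op I) \<Longrightarrow> row_col x (\<lambda>_. 0) = 0"
  unfolding row_col_def by (simp add: star_0_right[OF Op_addi])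

lemma row_col_Ord:
  fixes x y :: "'N::finite \<Rightarrow> dist"
  shows "(\<And>i. x i \<in> Ord I a) \<Longrightarrow> (\<And>i. y i \<in> Ord I b) \<Longrightarrow> row_col x y \<in> Ord I (a + b)"
  unfolding row_col_def by (intro Ord_sum Ord_star)

lemma row_mat_Ord:
  fixes x :: "'N::finite \<Rightarrow> dist"
  shows "(\<And>i. x i \<in> Ord I a) \<Longrightarrow> (\<And>i j. A i j \<in> Ord I b) \<Longrightarrow> row_mat x A i \<in> Ord I (a + b)"
  unfolding row_mat_def by (intro Ord_sum Ord_star)

lemma mat_col_Ord:
  fixes y :: "'N::finite \<Rightarrow> dist"
  shows "(\<And>i j. A i j \<in> Ord I a) \<Longrightarrow> (\<And>i. y i \<in> Ord I b) \<Longrightarrow> mat_col A y i \<in> Ord I (a + b)"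
  unfolding mat_col_def by (intro Ord_sum Ord_star)

end

section \<open>Biorthogonality and orders of the Lanczos vectors\<close>

text \<open>The situation common to both kinds of lucky breakdown at step \<open>n\<close>.\<close>

locale lanczos = time_interval +
  fixes A :: "'N::finite \<Rightarrow> 'N \<Rightarrow> dist" and w v :: "complex^'N" and n :: nat
  assumes AF: "\<And>i j. A i j \<in> Ord I 1"
    and wv: "(\<Sum>i\<in>UNIV. cnj (w $ i) * v $ i) = 1"
    and nb: "\<And>j. 1 \<le> j \<Longrightarrow> j < n \<Longrightarrow> no_breakdown I (lz_beta I A w v j)"
begin

abbreviation \<alpha> where "\<alpha> \<equiv> lz_alpha I A w v"
abbreviation \<beta> where "\<beta> \<equiv> lz_beta I A w v"
abbreviation ww where "ww \<equiv> lz_w I A w v"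
abbreviation vv where "vv \<equiv> lz_v I A w v"
abbreviation vh where "vh \<equiv> lz_vhat I A w v"

text \<open>The vector \<open>v\<^sub>k\<^sub>-\<^sub>1\<close>, with \<open>v\<^sub>-\<^sub>1 = 0\<close>.\<close>

definition vp :: "nat \<Rightarrow> 'N \<Rightarrow> dist" where "vp k i = (if k = 0 then 0 else vv (k - 1) i)"

text \<open>Here \<open>k - 1\<close> is truncated; for \<open>k = 0\<close> the last term is nevertheless \<open>0\<close>, because \<open>\<beta>\<^sub>0 = 0\<close>.\<close>

lemma ww_Suc: "ww (Suc k) i = row_mat (ww k) A i - \<alpha> k \<star> ww k i - \<beta> k \<star> ww (k - 1) i"
  by (cases k) (simp_all del: lz_alpha.simps lz_beta.simps(2) add: lz_beta.simps(1))

lemma vh_Suc: "vh (Suc k) i = mat_col A (vv k) i - vv k i \<star> \<alpha> k - vp k i"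
  by (cases k) (simp_all del: lz_alpha.simps lz_v.simps add: vp_def)

lemma vv_Suc: "vv (Suc k) i = vh (Suc k) i \<star> star_inverse I (\<beta> (Suc k))"
  by simp

lemma \<alpha>_eq: "\<alpha> k = row_col (row_mat (ww k) A) (vv k)" by simp
lemma \<beta>_0: "\<beta> 0 = 0" by simp
lemma \<beta>_Suc: "\<beta> (Suc k) = row_col (row_mat (ww (Suc k)) A) (vv k)" by simp

declare lz_alpha.simps [simp del] lz_beta.simps [simp del] lz_w.simps [simp del] lz_v.simps [simp del] lz_vhat.simps [simp del]

text \<open>Each step of the recurrence raises the order of \<open>w\<^sub>k\<close> by one; \<open>\<beta>\<^sub>k\<close> then has order 2 and its inverse order
  -2, which lowers the order of \<open>v\<^sub>k\<close> by one per step.  In \<open>\<alpha>\<^sub>k = w\<^sub>k A v\<^sub>k\<close> the two cancel: although \<open>v\<^sub>k\<close> contains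
  derivatives of \<open>\<delta>\<close>, \<open>\<alpha>\<^sub>k\<close> lies in \<open>Sm\<^sub>\<Theta>(I)\<close>.\<close>

lemma lanczos_orders:
  "k < n \<Longrightarrow> (\<forall>j\<le>k. (\<forall>i. ww j i \<in> Ord I (int j)) \<and> (\<forall>i. vv j i \<in> Ord I (- int j)) \<and> \<alpha> j \<in> Ord I 1 \<and>
      \<beta> j \<in> Ord I 2)"
proof (induction k)
  case 0
  have w0: "ww 0 i \<in> Ord I 0" for i unfolding lz_w.simps by (rule Ord_scale[OF one_Ord])
  have v0: "vv 0 i \<in> Ord I 0" for i unfolding lz_v.simps by (rule Ord_scale[OF one_Ord])
  have "\<alpha> 0 \<in> Ord I (0 + 1 + 0)" unfolding \<alpha>_eq by (intro row_col_Ord row_mat_Ord w0 v0 AF)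
  moreover have "\<beta> 0 \<in> Ord I 2" unfolding \<beta>_0 by (rule Ord_0_mem)
  ultimately show ?case using w0 v0 by simp
next
  case (Suc k)
  then have IH: "\<And>i j. j \<le> k \<Longrightarrow> ww j i \<in> Ord I (int j)" "\<And>i j. j \<le> k \<Longrightarrow> vv j i \<in> Ord I (- int j)"
    "\<And>j. j \<le> k \<Longrightarrow> \<alpha> j \<in> Ord I 1" "\<And>j. j \<le> k \<Longrightarrow> \<beta> j \<in> Ord I 2"
    by auto
  have bw: "\<beta> k \<star> ww (k - 1) i \<in> Ord I (int k + 1)" for i
  proof (cases k)
    case 0
    then show ?thesis by (simp add: \<beta>_0 Ord_0_mem)
  next
    case (Suc p)
    have "\<beta> k \<star> ww p i \<in> Ord I (2 + int p)" by (intro Ord_star IH) (use Suc in auto)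
    then show ?thesis using Suc by (simp add: algebra_simps)
  qed
  have w: "ww (Suc k) i \<in> Ord I (int (Suc k))" for i
  proof -
    have "row_mat (ww k) A i \<in> Ord I (int k + 1)" by (intro row_mat_Ord IH AF) simp
    moreover have "\<alpha> k \<star> ww k i \<in> Ord I (1 + int k)" by (intro Ord_star IH) auto
    ultimately show ?thesis unfolding ww_Suc using bw[of i] by (simp add: Ord_diff add.commute)
  qed
  have "\<beta> (Suc k) \<in> Ord I (int (Suc k) + 1 + - int k)" unfolding \<beta>_Suc
    by (intro row_col_Ord row_mat_Ord w IH AF) simp
  then have b: "\<beta> (Suc k) \<in> Ord I 2" by simp
  have vpF: "vp k i \<in> Ord I (1 - int k)" for i
  proof (cases k)
    case (Suc p)
    have "vv p i \<in> Ord I (- int p)" by (rule IH) (use Suc in auto)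
    then show ?thesis using Suc by (simp add: vp_def)
  qed (simp add: vp_def Ord_0_mem)
  have vhF: "vh (Suc k) i \<in> Ord I (1 - int k)" for i
  proof -
    have "mat_col A (vv k) i \<in> Ord I (1 + - int k)" by (intro mat_col_Ord IH AF) simp
    moreover have "vv k i \<star> \<alpha> k \<in> Ord I (- int k + 1)" by (intro Ord_star IH) auto
    ultimately show ?thesis unfolding vh_Suc using vpF[of i] by (simp add: Ord_diff)
  qed
  have "vv (Suc k) i \<in> Ord I ((1 - int k) + (-2))" for i
    unfolding vv_Suc by (intro Ord_star vhF no_breakdown_inverse(1) nb b) (use Suc.prems in auto)
  then have v: "vv (Suc k) i \<in> Ord I (- int (Suc k))" for i by (simp add: algebra_simps)
  have "\<alpha> (Suc k) \<in> Ord I (int (Suc k) + 1 + - int (Suc k))" unfolding \<alpha>_eq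
    by (intro row_col_Ord row_mat_Ord w v AF)
  then have a: "\<alpha> (Suc k) \<in> Ord I 1" by simp
  show ?case using IH w v a b le_Suc_eq by auto
qed

lemma wO: "k < n \<Longrightarrow> ww k i \<in> Op I" using lanczos_orders Ord_Op by blast
lemma vO: "k < n \<Longrightarrow> vv k i \<in> Op I" using lanczos_orders Ord_Op by blast
lemma \<alpha>F: "k < n \<Longrightarrow> \<alpha> k \<in> Ord I 1" using lanczos_orders by blast
lemma \<beta>F: "k < n \<Longrightarrow> \<beta> k \<in> Ord I 2" using lanczos_orders by blast
lemma \<alpha>O: "k < n \<Longrightarrow> \<alpha> k \<in> Op I" using \<alpha>F Ord_Op by blast
lemma \<beta>O: "k < n \<Longrightarrow> \<beta> k \<in> Op I" using \<beta>F Ord_Op by blast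
lemma AO: "A i j \<in> Op I" using AF Ord_Op by blast
lemma vpO: "k < n \<Longrightarrow> vp k i \<in> Op I" by (simp add: vp_def Op_0 vO)

lemma vhO: "k < n \<Longrightarrow> vh (Suc k) i \<in> Op I"
  unfolding vh_Suc mat_col_def by (intro Op_diff Op_sum Op_star AO vO \<alpha>O vpO)

lemma rec_w: "row_mat (ww k) A = (\<lambda>i. ww (Suc k) i + (\<alpha> k \<star> ww k i + \<beta> k \<star> ww (k - 1) i))"
  unfolding ww_Suc by (rule ext) (simp only: diff_diff_eq diff_add_cancel)

lemma rec_v: "mat_col A (vv k) = (\<lambda>i. vh (Suc k) i + (vv k i \<star> \<alpha> k + vp k i))"
  unfolding vh_Suc by (rule ext) (simp only: diff_diff_eq diff_add_cancel)

lemma vhat_eq: "Suc k < n \<Longrightarrow> vh (Suc k) i = vv (Suc k) i \<star> \<beta> (Suc k)"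
  unfolding vv_Suc star_assoc using no_breakdown_inverse(2)[OF nb \<beta>F, of "Suc k"] vhO[of k i] by simp

abbreviation "s \<equiv> (\<lambda>j k. row_col (ww j) (vv k))"

text \<open>The matrix element \<open>w\<^sub>j A v\<^sub>k\<close>, with the recurrence for \<open>w\<close> on the left.\<close>

lemma matrix_element_w:
  assumes "j < n" "k < n"
  shows "row_col (row_mat (ww j) A) (vv k) = s (Suc j) k + (\<alpha> j \<star> s j k + \<beta> j \<star> s (j - 1) k)"
  unfolding rec_w row_col_add_left
  using row_col_left_mult[of "\<alpha> j" "ww j" "vv k", OF \<alpha>O[OF assms(1)] wO[OF assms(1)] vO[OF assms(2)]]
    row_col_left_mult[of "\<beta> j" "ww (j - 1)" "vv k", OF \<beta>O[OF assms(1)] wO[of "j - 1"] vO[OF assms(2)]] assms(1) by simp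

text \<open>The same matrix element, with the recurrence for \<open>v\<close> on the right.\<close>

lemma matrix_element_v:
  assumes "\<And>i. ww j i \<in> Op I" "k < n"
  shows "row_col (row_mat (ww j) A) (vv k) =
      row_col (ww j) (vh (Suc k)) + (s j k \<star> \<alpha> k + row_col (ww j) (vp k))"
  unfolding row_col_row_mat[OF assms(1) AO vO[OF assms(2)]] rec_v
  by (simp only: row_col_add_right assms vhO vO \<alpha>O vpO Op_star Op_add row_col_right_mult)

lemma sum_scale: "(\<Sum>i\<in>B. scale (c i) X) = scale (\<Sum>i\<in>B. c i) X"
proof (induction B rule: infinite_finite_induct)
  case (insert b B)
  show ?case unfolding sum.insert[OF insert.hyps] insert.IH by (intro ext) (simp add: scale_def distrib_right)
next
  case (infinite B)
  show ?case unfolding sum.infinite[OF infinite] by (intro ext) (simp add: scale_def)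
next
  case empty
  show ?case unfolding sum.empty by (intro ext) (simp add: scale_def)
qed

lemma w0_v0: "s 0 0 = one_star I"
proof -
  have "s 0 0 = (\<Sum>i\<in>UNIV. scale (cnj (w $ i) * v $ i) (one_star I))"
    unfolding row_col_def lz_w.simps lz_v.simps
    by (rule sum.cong) (simp_all only: star_scale_left star_scale_right Op_one star_one_left, simp_all add: scale_def mult.assoc)
  also have "\<dots> = scale (\<Sum>i\<in>UNIV. cnj (w $ i) * v $ i) (one_star I)"
    by (rule sum_scale)
  finally show ?thesis by (simp add: wv scale_def)
qed

text \<open>As in the classical two-sided Lanczos process: \<open>\<alpha>\<^sub>k\<close> and \<open>\<beta>\<^sub>k\<close> remove the components along the last two vectors,
  the components along earlier ones vanish because the recurrence on the other side has three terms, and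
  division by \<open>\<beta>\<^sub>k\<^sub>+\<^sub>1\<close> normalises.\<close>

lemma biorthogonality: "k < n \<Longrightarrow> (\<forall>i\<le>k. \<forall>j\<le>k. s i j = (if i = j then one_star I else 0))"
proof (induction k)
  case 0
  then show ?case using w0_v0 by simp
next
  case (Suc k)
  then have k: "k < n" and Sk: "Suc k < n" and IH: "\<And>i j. i \<le> k \<Longrightarrow> j \<le> k \<Longrightarrow> s i j = (if i =
      j then one_star I else 0)"
    by auto
  have z: "f \<star> 0 = 0" if "f \<in> Op I" for f using star_0_right[OF Op_addi[OF that]] .
  have vpj: "row_col (ww i) (vp j) = (if j = 0 then 0 else s i (j - 1))" if "i < n" for i j
    using row_col_0_right[OF wO[OF that]] by (auto simp: vp_def[abs_def])
  have vpj': "row_col (ww (Suc k)) (vp j) = (if j = 0 then 0 else s (Suc k) (j - 1))" for j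
    using row_col_0_right[OF wO[OF Sk]] by (auto simp: vp_def[abs_def])
  have new_w: "s (Suc k) j = 0" if j: "j \<le> k" for j
  proof -
    have jn: "j < n" using j k by simp
    have e: "row_col (row_mat (ww k) A) (vv j) = s (Suc k) j + (\<alpha> k \<star> s k j + \<beta> k \<star> s (k - 1) j)"
      by (rule matrix_element_w[OF k jn])
    consider "j = k" | "k \<noteq> 0" "j = k - 1" | "Suc j < k" using j by linarith
    then show ?thesis
    proof cases
      case 1
      have "\<alpha> k \<star> s k j + \<beta> k \<star> s (k - 1) j = \<alpha> k"
        using 1 IH[of k k] IH[of "k - 1" k] \<alpha>O[OF k] \<beta>O[OF k] z by (cases "k = 0") (auto simp: \<beta>_0)
      then show ?thesis using e 1 by (simp add: \<alpha>_eq[of k, symmetric])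
    next
      case 2
      have "\<alpha> k \<star> s k j + \<beta> k \<star> s (k - 1) j = \<beta> k"
        using 2 IH[of k j] IH[of j j] \<alpha>O[OF k] \<beta>O[OF k] z by auto
      moreover have "row_col (row_mat (ww k) A) (vv j) = \<beta> k" using 2 \<beta>_Suc[of j] by simp
      ultimately show ?thesis using e by simp
    next
      case 3
      have "\<alpha> k \<star> s k j + \<beta> k \<star> s (k - 1) j = 0"
        using 3 IH[of k j] IH[of "k - 1" j] \<alpha>O[OF k] \<beta>O[OF k] z by auto
      moreover have "row_col (row_mat (ww k) A) (vv j) = 0"
      proof -
        have "Suc j < n" using 3 k by simp
        then have "vh (Suc j) = (\<lambda>i. vv (Suc j) i \<star> \<beta> (Suc j))" by (intro ext[of "vh (Suc j)"] vhat_eq)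
        then have "row_col (ww k) (vh (Suc j)) = s k (Suc j) \<star> \<beta> (Suc j)"
          by (simp only: row_col_right_mult)
        then show ?thesis unfolding matrix_element_v[OF wO[OF k] jn] vpj[OF k]
          using 3 IH[of k "Suc j"] IH[of k j] IH[of k "j - 1"] by auto
      qed
      ultimately show ?thesis using e by simp
    qed
  qed
  have vh: "row_col (ww j) (vh (Suc k)) = (if j = Suc k then \<beta> (Suc k) else 0)" if j: "j \<le> Suc k" for j
  proof -
    have jn: "j < n" using j Sk by simp
    have e: "row_col (row_mat (ww j) A) (vv k) =
        row_col (ww j) (vh (Suc k)) + (s j k \<star> \<alpha> k + row_col (ww j) (vp k))"
      by (rule matrix_element_v[OF wO[OF jn] k])
    consider "j = Suc k" | "j = k" | "k \<noteq> 0" "j = k - 1" | "Suc j < k" using j by linarith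
    then show ?thesis
    proof cases
      case 1
      have "s j k \<star> \<alpha> k + row_col (ww j) (vp k) = 0"
        using 1 new_w[of k] new_w[of "k - 1"] vpj' by auto
      then show ?thesis using e 1 \<beta>_Suc[of k] by simp
    next
      case 2
      have "s j k \<star> \<alpha> k + row_col (ww j) (vp k) = \<alpha> k"
        using 2 IH[of k k] IH[of k "k - 1"] vpj[OF k] \<alpha>O[OF k] by auto
      then show ?thesis using e 2 \<alpha>_eq[of k] by simp
    next
      case 3
      have "s j k \<star> \<alpha> k + row_col (ww j) (vp k) = one_star I"
        using 3 IH[of j k] IH[of j j] vpj[OF jn] by auto
      moreover have "\<alpha> j \<star> s j k + \<beta> j \<star> s (j - 1) k = 0"
        using 3 IH[of j k] IH[of "j - 1" k] \<alpha>O[OF jn] \<beta>O[OF jn] z by auto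
      moreover have "s (Suc j) k = one_star I" using 3 IH[of k k] by simp
      ultimately show ?thesis using e matrix_element_w[OF jn k] 3 by simp
    next
      case 4
      have "s j k \<star> \<alpha> k + row_col (ww j) (vp k) = 0"
        using 4 IH[of j k] IH[of j "k - 1"] vpj[OF jn] by auto
      moreover have "\<alpha> j \<star> s j k + \<beta> j \<star> s (j - 1) k = 0"
        using 4 IH[of j k] IH[of "j - 1" k] \<alpha>O[OF jn] \<beta>O[OF jn] z by auto
      moreover have "s (Suc j) k = 0" using 4 IH[of "Suc j" k] by simp
      ultimately show ?thesis using e matrix_element_w[OF jn k] 4 by simp
    qed
  qed
  have new_v: "s j (Suc k) = (if j = Suc k then one_star I else 0)" if j: "j \<le> Suc k" for j
  proof -
    have "vv (Suc k) = (\<lambda>i. vh (Suc k) i \<star> star_inverse I (\<beta> (Suc k)))" by (rule ext) (rule vv_Suc)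
    then have "s j (Suc k) = row_col (ww j) (vh (Suc k)) \<star> star_inverse I (\<beta> (Suc k))"
      by (simp only: row_col_right_mult)
    then show ?thesis unfolding vh[OF j]
      using no_breakdown_inverse(3)[OF nb \<beta>F, of "Suc k"] Sk by auto
  qed
  show ?case
  proof (intro allI impI)
    fix i j assume ij: "i \<le> Suc k" "j \<le> Suc k"
    show "s i j = (if i = j then one_star I else 0)"
    proof (cases "j = Suc k")
      case True
      then show ?thesis using new_v[OF ij(1)] by simp
    next
      case False
      then show ?thesis using new_w[of j] IH[of i j] ij by (cases "i = Suc k") auto
    qed
  qed
qed

end

section \<open>Lucky breakdown\<close>

lemma tridiagonal_sum:
  fixes a b c :: "'a::comm_monoid_add"
  assumes k: "k < n"
    and f: "\<And>l. l < n \<Longrightarrow> f l = (if l = k then a else if l = Suc k then b else if Suc l = k then c else 0)"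
    and b: "Suc k = n \<Longrightarrow> b = 0" and c: "k = 0 \<Longrightarrow> c = 0"
  shows "(\<Sum>l<n. f l) = a + b + c"
proof -
  have "(\<Sum>l<n. f l) = (\<Sum>l<n. (if l = k then a else 0) + (if l = Suc k then b else 0) + (if l =
      k - 1 then c else 0))"
    by (rule sum.cong) (use f c in auto)
  also have "\<dots> = a + b + c"
    unfolding sum.distrib using k b c by (auto simp: not_less_less_Suc_eq)
  finally show ?thesis .
qed

context lanczos
begin

abbreviation Tn where "Tn \<equiv> lz_T I A w v n"
abbreviation B where "B \<equiv> {..<n}"

lemma Tn_Ord: assumes "i \<in> B" "j \<in> B" shows "Tn i j \<in> Ord I (1 + int i - int j)"
proof -
  consider "j = i" | "j = Suc i" | "i = Suc j" | "j \<noteq> i" "j \<noteq> Suc i" "i \<noteq> Suc j" by blast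
  then show ?thesis
  proof cases
    case 1
    then show ?thesis using assms \<alpha>F by (simp add: lz_T_def)
  next
    case 2
    then show ?thesis using assms one_Ord by (simp add: lz_T_def)
  next
    case 3
    then show ?thesis using assms \<beta>F by (simp add: lz_T_def)
  next
    case 4
    then have "Tn i j = 0" by (simp add: lz_T_def)
    then show ?thesis using Ord_0_mem by simp
  qed
qed

lemma Tn_0: "i \<notin> B \<or> j \<notin> B \<Longrightarrow> Tn i j = 0" by (auto simp: lz_T_def)

lemma Tn_Op: "Tn i j \<in> Op I"
  using Tn_Ord[of i j] Tn_0[of i j] Ord_Op Op_0 by (cases "i \<in> B \<and> j \<in> B") auto

text \<open>The coefficients of the recurrence for \<open>v\<close> form the columns of the tridiagonal matrix; its last column is
  complete because the residual vanishes.\<close>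

lemma A_V_eq_V_T:
  assumes vn: "vh n = 0" and k: "k \<in> B"
  shows "mmul UNIV A (\<lambda>i k. vv k i) i k = mmul B (\<lambda>i k. vv k i) Tn i k"
proof -
  have kn: "k < n" using k by simp
  have "mmul B (\<lambda>i k. vv k i) Tn i k = vv k i \<star> \<alpha> k + vh (Suc k) i + vp k i"
    unfolding mmul_def
  proof (rule tridiagonal_sum[OF kn])
    show "vv l i \<star> Tn l k = (if l = k then vv k i \<star> \<alpha> k else if l = Suc k then vh (Suc k) i else if Suc l =
        k then vp k i else 0)"
      if "l < n" for l
      using that kn vhat_eq[of k i] vO[OF that, of i] star_0_right[OF Op_addi[OF vO[OF that]], of i]
      by (auto simp: lz_T_def vp_def)
  qed (use vn in \<open>auto simp: vp_def\<close>)
  also have "\<dots> = mat_col A (vv k) i" unfolding rec_v by (simp only: add_ac)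
  also have "\<dots> = mmul UNIV A (\<lambda>i k. vv k i) i k" unfolding mat_col_def mmul_def ..
  finally show ?thesis ..
qed

text \<open>Likewise the coefficients of the recurrence for \<open>w\<close> form the rows of the tridiagonal matrix.\<close>

lemma T_W_eq_W_A:
  assumes wn: "ww n = 0" and k: "k \<in> B"
  shows "mmul B Tn ww k i = mmul UNIV ww A k i"
proof -
  have kn: "k < n" using k by simp
  have "mmul B Tn ww k i = \<alpha> k \<star> ww k i + ww (Suc k) i + \<beta> k \<star> ww (k - 1) i"
    unfolding mmul_def
  proof (rule tridiagonal_sum[OF kn])
    show "Tn k l \<star> ww l i = (if l = k then \<alpha> k \<star> ww k i else if l = Suc k then ww (Suc k) i else if Suc l =
        k then \<beta> k \<star> ww (k - 1) i else 0)"
      if "l < n" for l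
      using that kn wO[OF that, of i] by (auto simp: lz_T_def)
  qed (use wn in \<open>auto simp: \<beta>_0\<close>)
  also have "\<dots> = row_mat (ww k) A i" unfolding rec_w by (simp only: add_ac)
  also have "\<dots> = mmul UNIV ww A k i" unfolding row_mat_def mmul_def ..
  finally show ?thesis .
qed

lemma sandwich_wv:
  assumes X: "\<And>i j. X i j \<in> Op I"
  shows "sandwich UNIV (($) w) X (($) v) = row_col (ww 0) (mat_col X (vv 0))"
proof -
  have "ww 0 i \<star> mat_col X (vv 0) i = (\<Sum>j\<in>UNIV. scale (cnj (w $ i) * v $ j) (X i j))" for i
  proof -
    have "mat_col X (vv 0) i = (\<Sum>j\<in>UNIV. scale (v $ j) (X i j))"
      unfolding mat_col_def lz_v.simps
      by (rule sum.cong) (simp_all only: star_scale_right[OF X Op_one] star_one_right'[OF X])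
    then have "ww 0 i \<star> mat_col X (vv 0) i = (\<Sum>j\<in>UNIV. ww 0 i \<star> scale (v $ j) (X i j))"
      unfolding lz_w.simps by (simp only: star_sum_right Op_addi Op_scale_op X Op_one)
    also have "\<dots> = (\<Sum>j\<in>UNIV. scale (cnj (w $ i) * v $ j) (X i j))"
      unfolding lz_w.simps
      by (rule sum.cong) (simp_all only: star_scale_left star_one_left Op_scale_op X, simp_all add: scale_def mult.assoc)
    finally show ?thesis .
  qed
  then show ?thesis unfolding sandwich_def row_col_def by simp
qed

lemma sandwich_e1:
  assumes "0 < n" shows "sandwich B e1 X e1 = X 0 0"
proof -
  have 1: "scale (cnj (e1 i) * e1 j) (X i j) = (if j = 0 then (if i = 0 then X 0 0 else 0) else 0)" for i j
    by (intro ext) (auto simp: scale_def e1_def)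
  have "sandwich B e1 X e1 = (\<Sum>i\<in>B. if i = 0 then X 0 0 else 0)"
    unfolding sandwich_def 1 by (rule sum.cong) (use assms in simp_all)
  then show ?thesis using assms by simp
qed

text \<open>Biorthogonality makes \<open>w\<^sub>0 V\<close> and \<open>W v\<^sub>0\<close> the first unit vector, so an intertwining relation for either family
  of Lanczos vectors identifies the scalar \<open>w\<^sup>H X v\<close> with the corner entry of \<open>X'\<close>.\<close>

lemma corner_entry:
  assumes n: "0 < n" and O: "\<And>i j. X i j \<in> Op I" "\<And>i j. X' i j \<in> Op I"
    and eq: "(\<forall>i. mmul UNIV X (\<lambda>i k. vv k i) i 0 = mmul B (\<lambda>i k. vv k i) X' i 0) \<or> (\<forall>i. mmul B X' ww 0 i =
        mmul UNIV ww X 0 i)"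
  shows "sandwich UNIV (($) w) X (($) v) = X' 0 0"
proof -
  have s: "s i j = (if i = j then one_star I else 0)" if "i < n" "j < n" for i j
    using biorthogonality[of "max i j"] that by auto
  have e: "sandwich UNIV (($) w) X (($) v) = row_col (ww 0) (mat_col X (vv 0))" by (rule sandwich_wv[OF O(1)])
  from eq show ?thesis
  proof
    assume *: "\<forall>i. mmul UNIV X (\<lambda>i k. vv k i) i 0 = mmul B (\<lambda>i k. vv k i) X' i 0"
    have "mat_col X (vv 0) i = mmul B (\<lambda>i k. vv k i) X' i 0" for i
      using * unfolding mat_col_def mmul_def by blast
    then have "row_col (ww 0) (mat_col X (vv 0)) = mmul UNIV (\<lambda>_. ww 0) (mmul B (\<lambda>i k. vv k i) X') () 0"
      unfolding row_col_def mmul_def by simp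
    also have "\<dots> = mmul B (mmul UNIV (\<lambda>_. ww 0) (\<lambda>i k. vv k i)) X' () 0"
      by (rule mmul_assoc[symmetric]) (use O wO[OF n] vO Op_addi in auto)
    also have "\<dots> = (\<Sum>l<n. s 0 l \<star> X' l 0)" unfolding mmul_def row_col_def ..
    also have "\<dots> = (\<Sum>l<n. if l = 0 then X' 0 0 else 0)"
      by (rule sum.cong) (use s n O in auto)
    finally show ?thesis using e n by simp
  next
    assume *: "\<forall>i. mmul B X' ww 0 i = mmul UNIV ww X 0 i"
    have "row_mat (ww 0) X i = mmul B X' ww 0 i" for i
      using * unfolding row_mat_def mmul_def by simp
    then have "row_col (row_mat (ww 0) X) (vv 0) = mmul UNIV (mmul B X' ww) (\<lambda>i _. vv 0 i) 0 ()"
      unfolding row_col_def mmul_def by simp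
    also have "\<dots> = mmul B X' (mmul UNIV ww (\<lambda>i _. vv 0 i)) 0 ()"
      by (rule mmul_assoc) (use O wO vO[OF n] Op_addi in auto)
    also have "\<dots> = (\<Sum>l<n. X' 0 l \<star> s l 0)" unfolding mmul_def row_col_def ..
    also have "\<dots> = (\<Sum>l<n. if l = 0 then X' 0 0 else 0)"
      by (rule sum.cong) (use s n O star_0_right[OF Op_addi[OF O(2)]] in auto)
    finally show ?thesis using e n row_col_row_mat[of "ww 0" X "vv 0", OF wO[OF n] O(1) vO[OF n]] by simp
  qed
qed

lemma moments_eq:
  assumes n: "0 < n" and br: "vh n = 0 \<or> ww n = 0"
  shows "sandwich UNIV (($) w) (mat_pow I UNIV A q) (($) v) = sandwich B e1 (mat_pow I B Tn q) e1"
  unfolding sandwich_e1[OF n]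
proof (rule corner_entry[OF n, where X="mat_pow I UNIV A q" and X'="mat_pow I B Tn q"])
  show "mat_pow I UNIV A q i j \<in> Op I" for i j by (rule mat_pow_Op[OF AO])
  show "mat_pow I B Tn q i j \<in> Op I" for i j by (rule mat_pow_Op[OF Tn_Op])
  from br show "(\<forall>i. mmul UNIV (mat_pow I UNIV A q) (\<lambda>i k. vv k i) i 0 =
      mmul B (\<lambda>i k. vv k i) (mat_pow I B Tn q) i 0)
    \<or> (\<forall>i. mmul B (mat_pow I B Tn q) ww 0 i = mmul UNIV ww (mat_pow I UNIV A q) 0 i)"
  proof
    assume "vh n = 0"
    then have "mmul UNIV (mat_pow I UNIV A q) (\<lambda>i k. vv k i) i 0 =
        mmul B (\<lambda>i k. vv k i) (mat_pow I B Tn q) i 0" for i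
      by (intro intertwine_pow AO Tn_Op A_V_eq_V_T) (use n vO in auto)
    then show ?thesis by blast
  next
    assume "ww n = 0"
    then have "mmul B (mat_pow I B Tn q) ww 0 i = mmul UNIV ww (mat_pow I UNIV A q) 0 i" for i
      by (intro intertwine_pow AO Tn_Op T_W_eq_W_A) (use n wO in auto)
    then show ?thesis by blast
  qed
qed

text \<open>The resolvent series is not summed: the inverse of \<open>1 - T\<close> is intertwined with that of \<open>1 - A\<close> just as the powers are.\<close>

lemma resolvent_entry_eq:
  assumes n: "0 < n" and br: "vh n = 0 \<or> ww n = 0"
  obtains L where "mat_invertible I B (mat_id I B - Tn)" "\<And>i j. L i j \<in> Sm1 I"
    "mat_mult UNIV L (mat_id I UNIV - A) = mat_id I UNIV"
    "star_resolvent I B Tn 0 0 = sandwich UNIV (($) w) L (($) v)"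
proof -
  obtain LT where LT: "\<And>i j. i \<in> B \<Longrightarrow> j \<in> B \<Longrightarrow> LT i j \<in> Ord I (int i - int j)" "\<And>i j. i \<notin> B \<or> j \<notin> B \<Longrightarrow> LT i j = 0"
    "mat_mult B LT (mat_id I B - Tn) = mat_id I B" "mat_mult B (mat_id I B - Tn) LT = mat_id I B"
    by (rule balanced_inverse[of B Tn int, OF finite_lessThan Tn_Ord Tn_0]) (assumption | rule that)+
  obtain L where L: "\<And>i j. i \<in> UNIV \<Longrightarrow> j \<in> UNIV \<Longrightarrow> L i j \<in> Ord I ((\<lambda>_. 0) i - (\<lambda>_. 0) j)"
    "mat_mult UNIV L (mat_id I UNIV - A) = mat_id I UNIV" "mat_mult UNIV (mat_id I UNIV - A) L = mat_id I UNIV"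
    by (rule balanced_inverse[of UNIV A "\<lambda>_. 0"]) (use AF in auto)
  have LR: "L i j \<in> Sm1 I" for i j using L(1)[of i j] by (simp add: Ord_0)
  have LTO: "LT i j \<in> Op I" for i j using LT(1,2)[of i j] Ord_Op Op_0 by (cases "i \<in> B \<and> j \<in> B") auto
  have MO: "(mat_id I B - Tn) i j \<in> Op I" for i j unfolding mat_minus by (intro Op_diff mat_id_Op Tn_Op)
  note inv = mat_inverse_eq[OF finite_lessThan MO LT]
  have "star_resolvent I B Tn = LT" unfolding star_resolvent_def by (rule inv(2))
  moreover have "mat_invertible I B (mat_id I B - Tn)"
    unfolding mat_invertible_def using inv(1) LT(3,4) by blast
  moreover have "sandwich UNIV (($) w) L (($) v) = LT 0 0"
  proof (rule corner_entry[of L LT, OF n Sm1_Op[OF LR] LTO])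
    from br show "(\<forall>i. mmul UNIV L (\<lambda>i k. vv k i) i 0 = mmul B (\<lambda>i k. vv k i) LT i 0)
      \<or> (\<forall>i. mmul B LT ww 0 i = mmul UNIV ww L 0 i)"
    proof
      assume z: "vh n = 0"
      have "mmul UNIV L (\<lambda>i k. vv k i) i 0 = mmul B (\<lambda>i k. vv k i) LT i 0" for i
        by (rule intertwine_inverse[OF finite finite_lessThan AO Tn_Op _ Sm1_Op[OF LR] LTO L(2) LT(4) A_V_eq_V_T[OF z]])
          (simp_all add: n vO)
      then show ?thesis by blast
    next
      assume z: "ww n = 0"
      have "mmul B LT ww 0 i = mmul UNIV ww L 0 i" for i
        by (rule intertwine_inverse[OF finite_lessThan finite Tn_Op AO _ LTO Sm1_Op[OF LR] LT(3) L(3) T_W_eq_W_A[OF z]])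
          (simp_all add: n wO)
      then show ?thesis by blast
    qed
  qed
  ultimately show ?thesis using that[OF _ LR L(2)] by simp
qed

end

context time_interval
begin

section \<open>The time-ordered exponential as a kernel\<close>

lemma star_mat_eq:
  assumes "smooth1 I (\<lambda>t. A t $ i $ j)"
  shows "star_mat I A i j = Mult (\<lambda>x y. A x $ i $ j) \<star> \<Theta>" "star_mat I A i j \<in> Sm I"
proof -
  note s = smooth1_smooth2[OF assms]
  show "star_mat I A i j = Mult (\<lambda>x y. A x $ i $ j) \<star> \<Theta>"
    unfolding Theta_Vol Mult_Vol[OF s smooth2_const] by (simp add: star_mat_def)
  show "star_mat I A i j \<in> Sm I" unfolding star_mat_def by (rule Vol_in_Sm[OF s])
qed

text \<open>Multiplying \<open>L (1 - A) = 1\<close> by \<open>\<Theta>\<close> on the left and \<open>\<delta>'\<close> on the right turns it into the backward equation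
  \<open>\<partial>\<^sub>t p(x,t) = - p(x,t) A(t)\<close>, \<open>p(t,t) = 1\<close>, for the kernel \<open>p\<close> of \<open>\<Theta> * L\<close>.  Therefore \<open>p(x,s) U(s,t)\<close> is constant for
  \<open>s\<close> between \<open>t\<close> and \<open>x\<close>; its values at the ends are \<open>p(x,t)\<close> and \<open>U(x,t)\<close>.\<close>

lemma evolution_kernel:
  fixes A :: "real \<Rightarrow> complex^'N^'N"
  assumes A: "\<And>i j. smooth1 I (\<lambda>t. A t $ i $ j)" and L: "\<And>i j. L i j \<in> Sm1 I"
    "mat_mult UNIV L (mat_id I UNIV - star_mat I A) = mat_id I UNIV"
    and U: "time_ordered_exp I A U"
  obtains p where "\<And>i j. smooth2 I (p i j)" "\<And>i j. \<Theta> \<star> L i j = Vol (p i j)"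
    "\<And>i j t x. t \<in> I \<Longrightarrow> x \<in> I \<Longrightarrow> t \<le> x \<Longrightarrow> U x t $ i $ j = p i j x t"
proof -
  have "\<forall>i j. \<exists>f. \<Theta> \<star> L i j = Vol f \<and> smooth2 I f" using Theta_Sm1(1)[OF L(1)] by (auto simp: Sm_def)
  then obtain p where p: "\<And>i j. \<Theta> \<star> L i j = Vol (p i j)" "\<And>i j. smooth2 I (p i j)" by metis
  \<comment> \<open>the matrix \<open>A\<close> as a matrix of multiplication operators: \<open>A\<^sub>k\<^sub>j * \<delta>'\<close> has no integral part\<close>
  define a where "a = (\<lambda>k j (x::real) (y::real). A x $ k $ j)"
  have a: "smooth2 I (a k j)" for k j unfolding a_def by (rule smooth1_smooth2[OF A])
  have a': "smooth2 I (\<lambda>x y. a k j y y)" for k j by (rule smooth2_swap[OF smooth2_diag[OF a]])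
  have LO: "L i j \<in> Op I" for i j by (rule Sm1_Op[OF L(1)])
  have AO: "star_mat I A i j \<in> Op I" for i j by (rule Sm_Op[OF star_mat_eq(2)[OF A]])
  have AD: "star_mat I A k j \<star> D = Mult (a k j)" for k j
    unfolding star_mat_eq(1)[OF A] star_assoc Theta_D a_def
    using star_one_right'[OF Op_Mult[OF a[of k j]]] unfolding a_def .
  \<comment> \<open>\<open>\<Theta> * L (1 - A) * \<delta>' = \<Theta> * \<delta>'\<close>, sorted into integral and multiplication operators\<close>
  have main: "Vol (\<lambda>x y. - dy I (p i j) x y + - (\<Sum>k\<in>UNIV. p i k x y * a k j y y)) + Mult (p i j)
     = Vol (\<lambda>x y. 0) + Mult (\<lambda>x y. if i = j then 1 else 0)" for i j
  proof -
    have "mat_mult UNIV L (mat_id I UNIV - star_mat I A) i j = L i j - mmul UNIV L (star_mat I A) i j"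
      unfolding mat_mult_mmul
      using mmul_diff_right[of UNIV L i "mat_id I UNIV" j "star_mat I A", OF Op_addi[OF LO] mat_id_Op AO]
        mmul_id_right[of UNIV j L i, OF finite UNIV_I Op_addi[OF LO]] by simp
    then have e: "L i j - mmul UNIV L (star_mat I A) i j = mat_id I UNIV i j" unfolding L(2) by simp
    have "\<Theta> \<star> (L i j - mmul UNIV L (star_mat I A) i j) \<star> D =
        Vol (p i j) \<star> D - (\<Sum>k\<in>UNIV. Vol (p i k) \<star> Mult (a k j))"
    proof -
      have "\<Theta> \<star> (L i j - mmul UNIV L (star_mat I A) i j) \<star> D
        = \<Theta> \<star> L i j \<star> D - (\<Theta> \<star> mmul UNIV L (star_mat I A) i j) \<star> D"
        using star_diff_right[OF Op_addi[OF Op_Theta] LO[of i j] mmul_Op[of UNIV L i "star_mat I A" j]] LO AO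
        by (simp only: star_diff_left UNIV_I)
      also have "\<Theta> \<star> mmul UNIV L (star_mat I A) i j = (\<Sum>k\<in>UNIV. Vol (p i k) \<star> star_mat I A k j)"
        unfolding mmul_def p(1)[symmetric] star_assoc
        by (rule star_sum_right[OF Op_addi[OF Op_Theta]]) (intro Op_star LO AO)
      also have "(\<Sum>k\<in>UNIV. Vol (p i k) \<star> star_mat I A k j) \<star> D = (\<Sum>k\<in>UNIV. Vol (p i k) \<star> Mult (a k j))"
        unfolding star_sum_left star_assoc AD ..
      finally show ?thesis unfolding p(1) .
    qed
    also have "(\<Sum>k\<in>UNIV. Vol (p i k) \<star> Mult (a k j)) = Vol (\<lambda>x y. \<Sum>k\<in>UNIV. p i k x y * a k j y y)"
      unfolding Vol_Mult[OF p(2) a] by (rule Vol_sum) (auto intro: smooth2_mult p(2) a')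
    also have "Vol (p i j) \<star> D = Mult (p i j) + Vol (\<lambda>x y. - dy I (p i j) x y)" by (rule Vol_D[OF p(2)])
    also have "Mult (p i j) + Vol (\<lambda>x y. - dy I (p i j) x y) - Vol (\<lambda>x y. \<Sum>k\<in>UNIV. p i k x y * a k j y y)
      = (Vol (\<lambda>x y. - dy I (p i j) x y) + Vol (\<lambda>x y. - (\<Sum>k\<in>UNIV. p i k x y * a k j y y))) + Mult (p i j)"
      unfolding Vol_uminus[symmetric, of "\<lambda>x y. \<Sum>k\<in>UNIV. p i k x y * a k j y y"]
        by (simp only: diff_conv_add_uminus add_ac)
    also have "Vol (\<lambda>x y. - dy I (p i j) x y) + Vol (\<lambda>x y. - (\<Sum>k\<in>UNIV. p i k x y * a k j y y)) =
       Vol (\<lambda>x y. - dy I (p i j) x y + - (\<Sum>k\<in>UNIV. p i k x y * a k j y y))"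
      by (rule Vol_add) (auto intro!: smooth2_minus smooth2_dy p(2) smooth2_sum smooth2_mult a')
    finally have "\<Theta> \<star> mat_id I UNIV i j \<star> D =
        Vol (\<lambda>x y. - dy I (p i j) x y + - (\<Sum>k\<in>UNIV. p i k x y * a k j y y)) + Mult (p i j)"
      unfolding e .
    moreover have "\<Theta> \<star> mat_id I UNIV i j \<star> D = Mult (\<lambda>x y. if i = j then 1 else 0)"
      using Op_Theta Theta_D star_0_right[OF Op_addi[OF Op_Theta]]
        by (simp add: mat_id_def one_Mult[symmetric] Mult_zero)
    ultimately show ?thesis by (simp add: Vol_zero)
  qed
  have sm: "smooth2 I (\<lambda>x y. - dy I (p i j) x y + - (\<Sum>k\<in>UNIV. p i k x y * a k j y y))" for i j
    by (intro smooth2_add smooth2_minus smooth2_dy p(2) smooth2_sum finite smooth2_mult a')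
  have pd: "p i j t t = (if i = j then 1 else 0)" if "t \<in> I" for i j t
    using kernel_unique(1)[OF sm p(2) smooth2_const smooth2_const main that] .
  have pe: "dy I (p i j) x t = - (\<Sum>k\<in>UNIV. p i k x t * A t $ k $ j)" if "x \<in> I" "t \<in> I" "t \<le> x" for i j x t
    using kernel_unique(2)[OF sm p(2) smooth2_const smooth2_const main that]
      by (simp add: a_def eq_neg_iff_add_eq_0 add.commute neg_eq_iff_add_eq_0)
  have "U x t $ i $ j = p i j x t" if t: "t \<in> I" and x: "x \<in> I" and tx: "t \<le> x" for i j t x
  proof -
    define h where "h = (\<lambda>s. \<Sum>k\<in>UNIV. p i k x s * U s t $ k $ j)"
    have sub: "{t..x} \<subseteq> I" by (rule Icc_I[OF t x])
    have hd: "(h has_vector_derivative 0) (at s within {t..x})" if s: "s \<in> {t..x}" for s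
    proof -
      have sI: "s \<in> I" "t \<le> s" "s \<le> x" using s sub by auto
      have "((\<lambda>s. U s t) has_vector_derivative A s ** U s t) (at s within {s \<in> I. t \<le> s})"
        using U t sI unfolding time_ordered_exp_def by blast
      then have dU0: "((\<lambda>s. U s t) has_vector_derivative A s ** U s t) (at s within {t..x})"
        by (rule has_vector_derivative_within_subset) (use sub in auto)
      have dU: "((\<lambda>s. U s t $ k $ j) has_vector_derivative (A s ** U s t) $ k $ j) (at s within {t..x})" for k
        using bounded_linear.has_vector_derivative[OF bounded_linear_vec_nth bounded_linear.has_vector_derivative[OF bounded_linear_vec_nth dU0]] .
      have dp: "((\<lambda>s. p i k x s) has_vector_derivative dy I (p i k) x s) (at s within {t..x})" for k
        by (rule has_vector_derivative_within_subset[OF _ sub])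
          (use smooth2_dy(1)[OF p(2)] x sI in \<open>auto simp: pd2_def\<close>)
      have "(h has_vector_derivative (\<Sum>k\<in>UNIV. p i k x s * (A s ** U s t) $ k $ j + dy I (p i k) x s * U s t $ k $ j)) (at s within {t..x})"
        unfolding h_def by (intro has_vector_derivative_sum has_vector_derivative_mult dp dU)
      moreover have "(\<Sum>k\<in>UNIV. p i k x s * (A s ** U s t) $ k $ j + dy I (p i k) x s * U s t $ k $ j) = 0"
      proof -
        have "(\<Sum>k\<in>UNIV. p i k x s * (A s ** U s t) $ k $ j) =
            (\<Sum>k\<in>UNIV. \<Sum>l\<in>UNIV. p i k x s * A s $ k $ l * U s t $ l $ j)"
          by (simp add: matrix_matrix_mult_def sum_distrib_left mult.assoc)
        also have "\<dots> = (\<Sum>l\<in>UNIV. \<Sum>k\<in>UNIV. p i k x s * A s $ k $ l * U s t $ l $ j)" by (rule sum.swap)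
        also have "\<dots> = - (\<Sum>l\<in>UNIV. dy I (p i l) x s * U s t $ l $ j)"
          unfolding pe[OF x sI(1,3)] by (simp add: sum_distrib_right sum_negf)
        finally show ?thesis unfolding sum.distrib by simp
      qed
      ultimately show ?thesis by simp
    qed
    obtain c where c: "\<And>s. s \<in> {t..x} \<Longrightarrow> h s = c"
      by (rule has_vector_derivative_zero_constant[OF convex_real_interval(5) hd]) (assumption, rule that)
    have "h x = (\<Sum>k\<in>UNIV. if k = i then U x t $ i $ j else 0)"
      unfolding h_def by (rule sum.cong) (use pd[OF x] in auto)
    moreover have "h t = (\<Sum>k\<in>UNIV. if k = j then p i j x t else 0)"
    proof -
      have "U t t = mat 1" using U t unfolding time_ordered_exp_def by blast
      then show ?thesis unfolding h_def by (intro sum.cong) (auto simp: mat_def)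
    qed
    moreover have "h x = h t" using c[of x] c[of t] tx by simp
    ultimately show ?thesis by simp
  qed
  then show ?thesis using that p by blast
qed

end

theorem proposition3p3:
  fixes I :: "real set"
    and A :: "real \<Rightarrow> complex^'N^'N"
    and U :: "real \<Rightarrow> real \<Rightarrow> complex^'N^'N"
    and v w :: "complex^'N"
    and n :: nat
  assumes "is_interval I" and "interior I \<noteq> {}"
    and "\<And>i j. smooth1 I (\<lambda>t. A t $ i $ j)"
    and "(\<Sum>i\<in>UNIV. cnj (w $ i) * v $ i) = 1"
    and "time_ordered_exp I A U"
    and "n \<ge> 1"
    and "\<And>j. 1 \<le> j \<Longrightarrow> j \<le> n - 1 \<Longrightarrow> no_breakdown I (lz_beta I (star_mat I A) w v j)"
    and "lz_vhat I (star_mat I A) w v n = 0 \<or> lz_w I (star_mat I A) w v n = 0"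
  shows "(\<forall>j. sandwich UNIV (($) w) (mat_pow I UNIV (star_mat I A) j) (($) v)
            = sandwich {..<n} e1 (mat_pow I {..<n} (lz_T I (star_mat I A) w v n) j) e1)
       \<and> mat_invertible I {..<n} (mat_id I {..<n} - lz_T I (star_mat I A) w v n)
       \<and> (\<exists>f. smooth2 I f
            \<and> Theta I \<star> star_resolvent I {..<n} (lz_T I (star_mat I A) w v n) 0 0 = Theta_dist I f
            \<and> (\<forall>t\<in>I. \<forall>t'\<in>I. t \<le> t' \<longrightarrow>
                 (\<Sum>i\<in>UNIV. cnj (w $ i) * (U t' t *v v) $ i) = f t' t))"
proof -
  interpret time_interval I by unfold_locales (rule assms)+
  interpret lanczos I "star_mat I A" w v n
  proof unfold_locales
    show "star_mat I A i j \<in> Ord I 1" for i j unfolding Ord_1 by (rule star_mat_eq(2)[OF assms(3)])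
  qed (use assms in auto)
  have n: "0 < n" using assms(6) by simp
  obtain L where L: "mat_invertible I B (mat_id I B - Tn)" "\<And>i j. L i j \<in> Sm1 I"
    "mat_mult UNIV L (mat_id I UNIV - star_mat I A) = mat_id I UNIV"
    "star_resolvent I B Tn 0 0 = sandwich UNIV (($) w) L (($) v)"
    using resolvent_entry_eq[OF n assms(8)] by blast
  obtain p where p: "\<And>i j. smooth2 I (p i j)" "\<And>i j. \<Theta> \<star> L i j = Vol (p i j)"
    "\<And>i j t x. t \<in> I \<Longrightarrow> x \<in> I \<Longrightarrow> t \<le> x \<Longrightarrow> U x t $ i $ j = p i j x t"
    using evolution_kernel[OF assms(3) L(2,3) assms(5)] by blast
  define f where "f = (\<lambda>x y. \<Sum>i\<in>UNIV. \<Sum>j\<in>UNIV. cnj (w $ i) * v $ j * p i j x y)"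
  have sc: "smooth2 I (\<lambda>x y. c * p i j x y)" for c i j by (rule smooth2_mult[OF smooth2_const p(1)])
  have scale_Vol: "scale c (Vol g) = Vol (\<lambda>x y. c * g x y)" if "smooth2 I g" for c g
    unfolding scale_Mult[OF Op_Vol[OF that]] Mult_Vol[OF smooth2_const that] ..
  have "\<Theta> \<star> star_resolvent I B Tn 0 0 = (\<Sum>i\<in>UNIV. \<Sum>j\<in>UNIV. scale (cnj (w $ i) * v $ j) (\<Theta> \<star> L i j))"
    unfolding L(4) sandwich_def
    by (simp only: star_sum_right[OF Op_addi[OF Op_Theta]] Op_sum Op_scale_op Sm1_Op L(2) star_scale_right Op_Theta)
  also have "\<dots> = (\<Sum>i\<in>UNIV. \<Sum>j\<in>UNIV. Vol (\<lambda>x y. cnj (w $ i) * v $ j * p i j x y))"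
    unfolding p(2) scale_Vol[OF p(1)] ..
  also have "\<dots> = (\<Sum>i\<in>UNIV. Vol (\<lambda>x y. \<Sum>j\<in>UNIV. cnj (w $ i) * v $ j * p i j x y))"
    by (rule sum.cong[OF refl], rule Vol_sum[OF finite sc])
  also have "\<dots> = Vol f" unfolding f_def by (rule Vol_sum[OF finite smooth2_sum[OF finite sc]])
  finally have 1: "\<Theta> \<star> star_resolvent I B Tn 0 0 = Vol f" .
  have 2: "smooth2 I f" unfolding f_def by (intro smooth2_sum finite sc)
  have 3: "(\<Sum>i\<in>UNIV. cnj (w $ i) * (U t' t *v v) $ i) = f t' t" if "t \<in> I" "t' \<in> I" "t \<le> t'" for t t'
    unfolding f_def by (simp add: matrix_vector_mult_def sum_distrib_left p(3)[OF that] mult_ac)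
  show ?thesis using moments_eq[OF n assms(8)] L(1) 1 2 3 by blast
qed

end
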